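(* If a Lie group $G$ has the property that for every left invariant Riemannian metric, the sectional curvature has a constant sign, then $G$ does not carry any left invariant contact (or exact symplectic) structure. Moreover, such a Lie group is unique, up to a local isomorphism, in any dimension.
   Context: A left invariant contact structure on a Lie group of dimension $2n+1$ is given by a left invariant 1-form $\eta^+$ with $(d\eta^+)^n\wedge\eta^+\neq0$ pointwise. A left invariant exact symplectic structure on a Lie group is a symplectic form of the type $d\alpha^+$ where $\alpha^+$ is a left invariant 1-form. Two Lie groups are locally isomorphic if their Lie algebras are isomorphic.
   Formalization: Contact structures are excluded only in dimension other than 1 and exact symplectic ones only in dimension other than 2, where the claim fails (the line; the affine group); constant sign means everywhere positive or everywhere negative, not zero; dimension is at least 1. *)

theory Defs
  imports "HOL-Analysis.Analysis"
begin

section \<open>Smoothness on open subsets of Euclidean spaces\<close>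

primrec Ck_on :: "nat \<Rightarrow> 'e::euclidean_space set \<Rightarrow> ('e \<Rightarrow> 'f::real_normed_vector) \<Rightarrow> bool" where
  "Ck_on 0 S f \<longleftrightarrow> continuous_on S f"
| "Ck_on (Suc k) S f \<longleftrightarrow>
     (\<forall>x\<in>S. f differentiable (at x)) \<and> (\<forall>v. Ck_on k S (\<lambda>x. frechet_derivative f (at x) v))"

text \<open>Only used for open \<open>S\<close>, so that \<^term>\<open>at x\<close> sees no values of \<open>f\<close> outside \<open>S\<close>.\<close>

definition smooth_on :: "'e::euclidean_space set \<Rightarrow> ('e \<Rightarrow> 'f::real_normed_vector) \<Rightarrow> bool" where
  "smooth_on S f \<longleftrightarrow> (\<forall>k. Ck_on k S f)"


section \<open>Lie groups\<close>

text \<open>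
  A manifold is a whole type with a Hausdorff, second countable topology (imposed by type
  classes in the theorem), together with an atlas of charts \<open>(U, \<phi>)\<close> into a Euclidean
  space \<open>'e\<close>; its dimension is \<open>DIM('e)\<close>.
\<close>

type_synonym ('a, 'e) chart = "'a set \<times> ('a \<Rightarrow> 'e)"

definition smooth_atlas :: "('a::topological_space, 'e::euclidean_space) chart set \<Rightarrow> bool" where
  "smooth_atlas A \<longleftrightarrow>
     (\<Union>(U, \<phi>)\<in>A. U) = UNIV \<and>
     (\<forall>(U, \<phi>)\<in>A. open U \<and> open (\<phi> ` U) \<and> homeomorphism U (\<phi> ` U) \<phi> (inv_into U \<phi>)) \<and>
     (\<forall>(U, \<phi>)\<in>A. \<forall>(V, \<psi>)\<in>A. smooth_on (\<phi> ` (U \<inter> V)) (\<psi> \<circ> inv_into U \<phi>))"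

definition prod_atlas ::
  "('a, 'e) chart set \<Rightarrow> ('b, 'f) chart set \<Rightarrow> ('a \<times> 'b, 'e \<times> 'f) chart set" where
  "prod_atlas A B = {(U \<times> V, map_prod \<phi> \<psi>) | U \<phi> V \<psi>. (U, \<phi>) \<in> A \<and> (V, \<psi>) \<in> B}"

definition smooth_map ::
  "('a::topological_space, 'e::euclidean_space) chart set \<Rightarrow>
   ('b::topological_space, 'f::euclidean_space) chart set \<Rightarrow> ('a \<Rightarrow> 'b) \<Rightarrow> bool" where
  "smooth_map A B F \<longleftrightarrow>
     continuous_on UNIV F \<and>
     (\<forall>(U, \<phi>)\<in>A. \<forall>(V, \<psi>)\<in>B. smooth_on (\<phi> ` (U \<inter> F -` V)) (\<psi> \<circ> F \<circ> inv_into U \<phi>))"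

record ('a, 'e) lie_data =
  gmult :: "'a \<Rightarrow> 'a \<Rightarrow> 'a"
  gone :: 'a
  ginv :: "'a \<Rightarrow> 'a"
  atlas :: "('a, 'e) chart set"

definition lie_group :: "('a::{t2_space,second_countable_topology}, 'e::euclidean_space) lie_data \<Rightarrow> bool" where
  "lie_group G \<longleftrightarrow>
     group (gmult G) (gone G) (ginv G) \<and>
     smooth_atlas (atlas G) \<and>
     smooth_map (prod_atlas (atlas G) (atlas G)) (atlas G) (\<lambda>(a, b). gmult G a b) \<and>
     smooth_map (atlas G) (atlas G) (ginv G)"


section \<open>Smooth functions and vector fields\<close>

definition smooth_funs :: "('a::topological_space, 'e::euclidean_space) lie_data \<Rightarrow> ('a \<Rightarrow> real) set" where
  "smooth_funs G = {f. \<forall>(U, \<phi>)\<in>atlas G. smooth_on (\<phi> ` U) (f \<circ> inv_into U \<phi>)}"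

type_synonym 'a vf = "('a \<Rightarrow> real) \<Rightarrow> 'a \<Rightarrow> real"

text \<open>
  Vector fields are the derivations of the algebra of smooth functions. They are normalized to
  be zero on functions that are not smooth, so that equality of vector fields is HOL equality.
\<close>

definition vector_fields :: "('a::topological_space, 'e::euclidean_space) lie_data \<Rightarrow> 'a vf set" where
  "vector_fields G = {X.
     (\<forall>f\<in>smooth_funs G. X f \<in> smooth_funs G) \<and>
     (\<forall>f. f \<notin> smooth_funs G \<longrightarrow> X f = (\<lambda>p. 0)) \<and>
     (\<forall>f\<in>smooth_funs G. \<forall>h\<in>smooth_funs G. X (\<lambda>p. f p + h p) = (\<lambda>p. X f p + X h p)) \<and>
     (\<forall>c. \<forall>f\<in>smooth_funs G. X (\<lambda>p. c * f p) = (\<lambda>p. c * X f p)) \<and>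
     (\<forall>f\<in>smooth_funs G. \<forall>h\<in>smooth_funs G. X (\<lambda>p. f p * h p) = (\<lambda>p. X f p * h p + f p * X h p))}"

definition vplus :: "'a vf \<Rightarrow> 'a vf \<Rightarrow> 'a vf" where
  "vplus X Y = (\<lambda>f p. X f p + Y f p)"

definition vminus :: "'a vf \<Rightarrow> 'a vf \<Rightarrow> 'a vf" where
  "vminus X Y = (\<lambda>f p. X f p - Y f p)"

definition vscale :: "('a \<Rightarrow> real) \<Rightarrow> 'a vf \<Rightarrow> 'a vf" where
  "vscale u X = (\<lambda>f p. u p * X f p)"

definition lie_bracket :: "'a vf \<Rightarrow> 'a vf \<Rightarrow> 'a vf" where
  "lie_bracket X Y = (\<lambda>f p. X (Y f) p - Y (X f) p)"

definition vanishes_at :: "'a vf \<Rightarrow> 'a \<Rightarrow> bool" where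
  "vanishes_at X p \<longleftrightarrow> (\<forall>f. X f p = 0)"

definition independent_at :: "'a vf \<Rightarrow> 'a vf \<Rightarrow> 'a \<Rightarrow> bool" where
  "independent_at X Y p \<longleftrightarrow>
     (\<forall>a b. vanishes_at (vplus (vscale (\<lambda>q. a) X) (vscale (\<lambda>q. b) Y)) p \<longrightarrow> a = 0 \<and> b = 0)"


section \<open>Left translations and the Lie algebra\<close>

text \<open>The push-forward of a vector field by the left translation \<open>p \<mapsto> a p\<close>.\<close>

definition push :: "('a, 'e) lie_data \<Rightarrow> 'a \<Rightarrow> 'a vf \<Rightarrow> 'a vf" where
  "push G a X = (\<lambda>f p. X (\<lambda>q. f (gmult G a q)) (gmult G (ginv G a) p))"

definition lie_algebra :: "('a::topological_space, 'e::euclidean_space) lie_data \<Rightarrow> 'a vf set" where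
  "lie_algebra G = {X \<in> vector_fields G. \<forall>a. push G a X = X}"

definition locally_isomorphic ::
  "('a::topological_space, 'e::euclidean_space) lie_data \<Rightarrow>
   ('b::topological_space, 'f::euclidean_space) lie_data \<Rightarrow> bool" where
  "locally_isomorphic G H \<longleftrightarrow>
     (\<exists>h. bij_betw h (lie_algebra G) (lie_algebra H) \<and>
        (\<forall>X\<in>lie_algebra G. \<forall>Y\<in>lie_algebra G. h (vplus X Y) = vplus (h X) (h Y)) \<and>
        (\<forall>c. \<forall>X\<in>lie_algebra G. h (vscale (\<lambda>p. c) X) = vscale (\<lambda>p. c) (h X)) \<and>
        (\<forall>X\<in>lie_algebra G. \<forall>Y\<in>lie_algebra G. h (lie_bracket X Y) = lie_bracket (h X) (h Y)))"


section \<open>Riemannian metrics and sectional curvature\<close>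

text \<open>
  Tensor fields are maps on vector fields that are multilinear over the smooth functions.
\<close>

definition one_form :: "('a::topological_space, 'e::euclidean_space) lie_data \<Rightarrow> ('a vf \<Rightarrow> 'a \<Rightarrow> real) \<Rightarrow> bool" where
  "one_form G \<eta> \<longleftrightarrow>
     (\<forall>X\<in>vector_fields G. \<eta> X \<in> smooth_funs G) \<and>
     (\<forall>X\<in>vector_fields G. \<forall>Y\<in>vector_fields G. \<eta> (vplus X Y) = (\<lambda>p. \<eta> X p + \<eta> Y p)) \<and>
     (\<forall>u\<in>smooth_funs G. \<forall>X\<in>vector_fields G. \<eta> (vscale u X) = (\<lambda>p. u p * \<eta> X p))"

definition bilinear_form ::
  "('a::topological_space, 'e::euclidean_space) lie_data \<Rightarrow> ('a vf \<Rightarrow> 'a vf \<Rightarrow> 'a \<Rightarrow> real) \<Rightarrow> bool" where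
  "bilinear_form G b \<longleftrightarrow>
     (\<forall>X\<in>vector_fields G. one_form G (b X)) \<and>
     (\<forall>Y\<in>vector_fields G. one_form G (\<lambda>X. b X Y))"

definition riemannian_metric ::
  "('a::topological_space, 'e::euclidean_space) lie_data \<Rightarrow> ('a vf \<Rightarrow> 'a vf \<Rightarrow> 'a \<Rightarrow> real) \<Rightarrow> bool" where
  "riemannian_metric G g \<longleftrightarrow>
     bilinear_form G g \<and>
     (\<forall>X\<in>vector_fields G. \<forall>Y\<in>vector_fields G. g X Y = g Y X) \<and>
     (\<forall>X\<in>vector_fields G. \<forall>p. \<not> vanishes_at X p \<longrightarrow> g X X p > 0)"

definition left_invariant_metric ::
  "('a::topological_space, 'e::euclidean_space) lie_data \<Rightarrow> ('a vf \<Rightarrow> 'a vf \<Rightarrow> 'a \<Rightarrow> real) \<Rightarrow> bool" where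
  "left_invariant_metric G g \<longleftrightarrow>
     riemannian_metric G g \<and>
     (\<forall>a p. \<forall>X\<in>vector_fields G. \<forall>Y\<in>vector_fields G.
        g (push G a X) (push G a Y) (gmult G a p) = g X Y p)"

definition levi_civita ::
  "('a::topological_space, 'e::euclidean_space) lie_data \<Rightarrow>
   ('a vf \<Rightarrow> 'a vf \<Rightarrow> 'a \<Rightarrow> real) \<Rightarrow> ('a vf \<Rightarrow> 'a vf \<Rightarrow> 'a vf) \<Rightarrow> bool" where
  "levi_civita G g D \<longleftrightarrow>
     (\<forall>X\<in>vector_fields G. \<forall>Y\<in>vector_fields G. D X Y \<in> vector_fields G) \<and>
     (\<forall>X\<in>vector_fields G. \<forall>X'\<in>vector_fields G. \<forall>Y\<in>vector_fields G.
        D (vplus X X') Y = vplus (D X Y) (D X' Y)) \<and>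
     (\<forall>u\<in>smooth_funs G. \<forall>X\<in>vector_fields G. \<forall>Y\<in>vector_fields G.
        D (vscale u X) Y = vscale u (D X Y)) \<and>
     (\<forall>X\<in>vector_fields G. \<forall>Y\<in>vector_fields G. \<forall>Y'\<in>vector_fields G.
        D X (vplus Y Y') = vplus (D X Y) (D X Y')) \<and>
     (\<forall>u\<in>smooth_funs G. \<forall>X\<in>vector_fields G. \<forall>Y\<in>vector_fields G.
        D X (vscale u Y) = vplus (vscale (X u) Y) (vscale u (D X Y))) \<and>
     (\<forall>X\<in>vector_fields G. \<forall>Y\<in>vector_fields G.
        vminus (D X Y) (D Y X) = lie_bracket X Y) \<and>
     (\<forall>X\<in>vector_fields G. \<forall>Y\<in>vector_fields G. \<forall>Z\<in>vector_fields G. \<forall>p.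
        X (g Y Z) p = g (D X Y) Z p + g Y (D X Z) p)"

definition curvature :: "('a vf \<Rightarrow> 'a vf \<Rightarrow> 'a vf) \<Rightarrow> 'a vf \<Rightarrow> 'a vf \<Rightarrow> 'a vf \<Rightarrow> 'a vf" where
  "curvature D X Y Z = vminus (vminus (D X (D Y Z)) (D Y (D X Z))) (D (lie_bracket X Y) Z)"

text \<open>The sectional curvature at \<open>p\<close> of the plane spanned by the values of \<open>X\<close> and \<open>Y\<close> at \<open>p\<close>.\<close>

definition sectional ::
  "('a vf \<Rightarrow> 'a vf \<Rightarrow> 'a \<Rightarrow> real) \<Rightarrow> ('a vf \<Rightarrow> 'a vf \<Rightarrow> 'a vf) \<Rightarrow> 'a vf \<Rightarrow> 'a vf \<Rightarrow> 'a \<Rightarrow> real" where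
  "sectional g D X Y p =
     g (curvature D X Y Y) X p / (g X X p * g Y Y p - (g X Y p)\<^sup>2)"

text \<open>
  A constant sign means: positive on all tangent planes, or negative on all tangent planes;
  which of the two may depend on the metric. Allowing zero curvature would admit the
  abelian groups, all of whose left invariant metrics are flat, and so contradict uniqueness.
  The connection \<open>D\<close> is determined by \<open>g\<close>.
\<close>

definition constant_sign_curvature :: "('a::topological_space, 'e::euclidean_space) lie_data \<Rightarrow> bool" where
  "constant_sign_curvature G \<longleftrightarrow>
     (\<forall>g D. left_invariant_metric G g \<and> levi_civita G g D \<longrightarrow>
        (\<forall>X\<in>vector_fields G. \<forall>Y\<in>vector_fields G. \<forall>p.
           independent_at X Y p \<longrightarrow> sectional g D X Y p > 0) \<or>
        (\<forall>X\<in>vector_fields G. \<forall>Y\<in>vector_fields G. \<forall>p.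
           independent_at X Y p \<longrightarrow> sectional g D X Y p < 0))"


section \<open>Contact and exact symplectic structures\<close>

definition left_invariant_one_form ::
  "('a::topological_space, 'e::euclidean_space) lie_data \<Rightarrow> ('a vf \<Rightarrow> 'a \<Rightarrow> real) \<Rightarrow> bool" where
  "left_invariant_one_form G \<eta> \<longleftrightarrow>
     one_form G \<eta> \<and>
     (\<forall>a p. \<forall>X\<in>vector_fields G. \<eta> (push G a X) (gmult G a p) = \<eta> X p)"

definition ext_deriv :: "('a vf \<Rightarrow> 'a \<Rightarrow> real) \<Rightarrow> 'a vf \<Rightarrow> 'a vf \<Rightarrow> 'a \<Rightarrow> real" where
  "ext_deriv \<eta> X Y = (\<lambda>p. X (\<eta> Y) p - Y (\<eta> X) p - \<eta> (lie_bracket X Y) p)"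

text \<open>
  A differential form of degree \<open>k\<close> is evaluated on a sequence of vector fields,
  of which it reads only the first \<open>k\<close> entries.
\<close>

type_synonym 'a dform = "(nat \<Rightarrow> 'a vf) \<Rightarrow> 'a \<Rightarrow> real"

definition wedge :: "nat \<Rightarrow> nat \<Rightarrow> 'a dform \<Rightarrow> 'a dform \<Rightarrow> 'a dform" where
  "wedge k l \<alpha> \<beta> = (\<lambda>v p.
     (\<Sum>\<sigma> | \<sigma> permutes {..<k + l}.
        of_int (sign \<sigma>) * \<alpha> (\<lambda>i. v (\<sigma> i)) p * \<beta> (\<lambda>i. v (\<sigma> (k + i))) p) / (fact k * fact l))"

primrec two_form_power :: "'a dform \<Rightarrow> nat \<Rightarrow> 'a dform" where
  "two_form_power \<omega> 0 = (\<lambda>v p. 1)"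
| "two_form_power \<omega> (Suc n) = wedge 2 (2 * n) \<omega> (two_form_power \<omega> n)"

definition left_invariant_contact ::
  "('a::topological_space, 'e::euclidean_space) lie_data \<Rightarrow> ('a vf \<Rightarrow> 'a \<Rightarrow> real) \<Rightarrow> bool" where
  "left_invariant_contact G \<eta> \<longleftrightarrow>
     left_invariant_one_form G \<eta> \<and>
     (\<exists>n. DIM('e) = 2 * n + 1 \<and>
        (\<forall>p. \<exists>v. (\<forall>i. v i \<in> vector_fields G) \<and>
           wedge (2 * n) 1 (two_form_power (\<lambda>v. ext_deriv \<eta> (v 0) (v 1)) n) (\<lambda>v. \<eta> (v 0)) v p \<noteq> 0))"

definition symplectic_form ::
  "('a::topological_space, 'e::euclidean_space) lie_data \<Rightarrow> ('a vf \<Rightarrow> 'a vf \<Rightarrow> 'a \<Rightarrow> real) \<Rightarrow> bool" where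
  "symplectic_form G \<omega> \<longleftrightarrow>
     bilinear_form G \<omega> \<and>
     (\<forall>X\<in>vector_fields G. \<forall>p. \<omega> X X p = 0) \<and>
     (\<forall>X\<in>vector_fields G. \<forall>Y\<in>vector_fields G. \<forall>Z\<in>vector_fields G. \<forall>p.
        X (\<omega> Y Z) p - Y (\<omega> X Z) p + Z (\<omega> X Y) p
        - \<omega> (lie_bracket X Y) Z p + \<omega> (lie_bracket X Z) Y p - \<omega> (lie_bracket Y Z) X p = 0) \<and>
     (\<forall>X\<in>vector_fields G. \<forall>p. (\<forall>Y\<in>vector_fields G. \<omega> X Y p = 0) \<longrightarrow> vanishes_at X p)"

definition left_invariant_exact_symplectic ::
  "('a::topological_space, 'e::euclidean_space) lie_data \<Rightarrow> ('a vf \<Rightarrow> 'a \<Rightarrow> real) \<Rightarrow> bool" where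
  "left_invariant_exact_symplectic G \<alpha> \<longleftrightarrow>
     left_invariant_one_form G \<alpha> \<and> symplectic_form G (ext_deriv \<alpha>)"

end

theory Submission
  imports Defs
begin

text \<open>
  Left invariant geometry on a Lie group is linear algebra on its Lie algebra. The left invariant
  vector fields form a global frame: all vector fields are combinations of them with smooth
  coefficients (\<open>left_invariant_frame_exists\<close>). Here vector fields are derivations of the algebra
  of smooth functions, so this rests on Hadamard's lemma, on cut-off functions, and on translating
  a derivation at a point to the identity. In the frame, a left invariant metric is an inner
  product \<open>B\<close> on the Lie algebra, its Levi-Civita connection is the flat connection of the frame
  plus a bilinear product \<open>\<Gamma>\<close>, and the derivatives of coefficient functions cancel from the
  curvature. The sign condition thus says that for each \<open>B\<close> the numbers \<open>B (R(x,y)y) x\<close>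
  have the same sign for all independent \<open>x\<close>, \<open>y\<close> (\<open>constant_sign_algebraic\<close>, \<open>constant_sign_negative\<close>).

  Suppose that \<open>[x,y]\<close> is not in the span of \<open>x\<close> and \<open>y\<close> for some \<open>x\<close>, \<open>y\<close>. Milnor's rescaling
  of a basis through \<open>x\<close>, \<open>y\<close>, \<open>[x,y]\<close> lets the structure constants tend to those of the
  Heisenberg algebra (with an abelian factor), which has planes of curvature \<open>-3/4\<close> and \<open>1/4\<close>.
  Curvature depends continuously on the structure constants, so some metric has planes of both
  signs (\<open>mixed_curvature\<close>). If on the other hand \<open>[x,y]\<close> is always in the span of \<open>x\<close> and \<open>y\<close>,
  then \<open>[x,y] = \<alpha>(x) y - \<alpha>(y) x\<close> for a linear form \<open>\<alpha>\<close> (\<open>bracket_in_span_special\<close>). From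
  dimension two on, \<open>\<alpha>\<close> is not zero, because abelian groups are flat; in dimension one every
  \<open>\<alpha>\<close> gives the same bracket, so that it can be chosen to be nonzero.

  The rest follows from this bracket. Two nonzero linear forms on spaces of equal dimension
  correspond under a linear isomorphism, so the Lie algebra is unique. For each metric the
  curvature is constant and equal to minus the square of the length of \<open>\<alpha>\<close>, and the algebra is that
  of an explicit group, a line acting on a vector space by dilations; so such groups exist. Finally
  \<open>d\<eta> = - \<alpha> \<and> \<eta>\<close> for each left invariant \<open>\<eta>\<close>: this is annihilated by the wedge product with
  \<open>\<eta>\<close> and has rank at most two, which excludes contact forms in dimension at least three and exact
  symplectic forms in every dimension but two.
\<close>

section \<open>Calculus of differentiable maps of class \<open>C\<^sup>k\<close>\<close>

lemma frechet_derivative_eqI: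
  "(f has_derivative f') (at x) \<Longrightarrow> frechet_derivative f (at x) = f'"
  using frechet_derivative_at by metis

lemma Ck_on_SucI:
  assumes "\<And>x. x \<in> S \<Longrightarrow> (f has_derivative f' x) (at x)"
    and "\<And>v. Ck_on k S (\<lambda>x. frechet_derivative f (at x) v)"
  shows "Ck_on (Suc k) S f"
  using assms by (auto simp: differentiable_def)

lemma Ck_on_cong:
  assumes "open S" "\<And>x. x \<in> S \<Longrightarrow> f x = g x" "Ck_on k S f"
  shows "Ck_on k S g"
  using assms(2,3)
proof (induction k arbitrary: f g)
  case 0
  then show ?case by (auto cong: continuous_on_cong)
next
  case (Suc k)
  have d: "(g has_derivative frechet_derivative f (at x)) (at x)" if "x \<in> S" for x
  proof (rule has_derivative_transform_within_open[OF _ assms(1) that])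
    show "(f has_derivative frechet_derivative f (at x)) (at x)"
      using Suc.prems(2) that by (auto simp: frechet_derivative_works)
  qed (use Suc.prems in auto)
  show ?case
  proof (rule Ck_on_SucI[OF d])
    fix v
    show "Ck_on k S (\<lambda>x. frechet_derivative g (at x) v)"
    proof (rule Suc.IH)
      show "frechet_derivative f (at x) v = frechet_derivative g (at x) v" if "x \<in> S" for x
        using frechet_derivative_eqI[OF d[OF that]] by simp
      show "Ck_on k S (\<lambda>x. frechet_derivative f (at x) v)"
        using Suc.prems by simp
    qed
  qed
qed

lemma Ck_on_subset: "Ck_on k S f \<Longrightarrow> T \<subseteq> S \<Longrightarrow> Ck_on k T f"
  by (induction k arbitrary: f) (auto intro: continuous_on_subset)

lemma Ck_on_SucI':
  assumes "open S" "\<And>x. x \<in> S \<Longrightarrow> (f has_derivative f' x) (at x)"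
    and "\<And>v. Ck_on k S (\<lambda>x. f' x v)"
  shows "Ck_on (Suc k) S f"
proof (rule Ck_on_SucI[OF assms(2)])
  fix v
  show "Ck_on k S (\<lambda>x. frechet_derivative f (at x) v)"
    by (rule Ck_on_cong[OF assms(1) _ assms(3)[of v]])
      (use frechet_derivative_eqI[OF assms(2)] in auto)
qed

lemma Ck_on_SucD: "Ck_on (Suc k) S f \<Longrightarrow> Ck_on k S f"
proof (induction k arbitrary: f)
  case 0
  then show ?case
    by (auto intro!: continuous_at_imp_continuous_on differentiable_imp_continuous_within)
next
  case (Suc k)
  have "Ck_on (Suc k) S (\<lambda>x. frechet_derivative f (at x) v)" for v
    using Suc.prems by simp
  from Suc.IH[OF this] show ?case using Suc.prems by simp
qed

lemma Ck_on_has_derivative: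
  "Ck_on (Suc k) S f \<Longrightarrow> x \<in> S \<Longrightarrow> (f has_derivative frechet_derivative f (at x)) (at x)"
  by (auto simp: frechet_derivative_works)

lemma Ck_on_local:
  assumes "\<And>x. x \<in> S \<Longrightarrow> \<exists>T. open T \<and> x \<in> T \<and> Ck_on k T f"
  shows "Ck_on k S f"
  using assms
proof (induction k arbitrary: f)
  case 0
  then show ?case
    unfolding Ck_on.simps
    by (intro continuous_at_imp_continuous_on ballI) (metis continuous_on_eq_continuous_at)
next
  case (Suc k)
  show ?case
    unfolding Ck_on.simps
  proof (intro conjI ballI allI)
    show "f differentiable at x" if "x \<in> S" for x
      using Suc.prems[OF that] by auto
    show "Ck_on k S (\<lambda>x. frechet_derivative f (at x) v)" for v
    proof (rule Suc.IH)
      show "\<exists>T. open T \<and> x \<in> T \<and> Ck_on k T (\<lambda>x. frechet_derivative f (at x) v)" if "x \<in> S" for x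
        using Suc.prems[OF that] by auto
    qed
  qed
qed

lemma Ck_on_const: "Ck_on k S (\<lambda>x. c)"
  by (induction k arbitrary: c) (auto simp: frechet_derivative_const)

lemma Ck_on_add:
  assumes "open S"
  shows "Ck_on k S f \<Longrightarrow> Ck_on k S g \<Longrightarrow> Ck_on k S (\<lambda>x. f x + g x)"
proof (induction k arbitrary: f g)
  case 0
  then show ?case by (auto intro: continuous_on_add)
next
  case (Suc k)
  show ?case
  proof (rule Ck_on_SucI'[OF assms])
    show "((\<lambda>x. f x + g x) has_derivative
        (\<lambda>v. frechet_derivative f (at x) v + frechet_derivative g (at x) v)) (at x)" if "x \<in> S" for x
      using Suc.prems that by (intro has_derivative_add Ck_on_has_derivative)
  qed (use Suc in auto)
qed

lemma Ck_on_bounded_linear_comp: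
  assumes "open S" "bounded_linear h"
  shows "Ck_on k S f \<Longrightarrow> Ck_on k S (\<lambda>x. h (f x))"
proof (induction k arbitrary: f)
  case 0
  then show ?case by (auto intro: bounded_linear.continuous_on[OF assms(2)])
next
  case (Suc k)
  show ?case
  proof (rule Ck_on_SucI'[OF assms(1)])
    show "((\<lambda>x. h (f x)) has_derivative (\<lambda>v. h (frechet_derivative f (at x) v))) (at x)"
      if "x \<in> S" for x
      using Suc.prems that by (intro bounded_linear.has_derivative[OF assms(2)] Ck_on_has_derivative)
  qed (use Suc in auto)
qed

lemma Ck_on_bounded_linear:
  assumes "open S" "bounded_linear f"
  shows "Ck_on k S f"
proof (cases k)
  case 0
  then show ?thesis using linear_continuous_on[OF assms(2)] by simp
next
  case (Suc m)
  have "Ck_on (Suc m) S f"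
    by (rule Ck_on_SucI'[OF assms(1), where f' = "\<lambda>x. f"])
      (auto intro: bounded_linear_imp_has_derivative assms Ck_on_const)
  then show ?thesis using Suc by simp
qed

lemma Ck_on_scaleR:
  assumes "open S"
  shows "Ck_on k S u \<Longrightarrow> Ck_on k S g \<Longrightarrow> Ck_on k S (\<lambda>x. u x *\<^sub>R g x)"
proof (induction k arbitrary: u g)
  case 0
  then show ?case by (auto intro: continuous_on_scaleR)
next
  case (Suc k)
  show ?case
  proof (rule Ck_on_SucI'[OF assms])
    show "((\<lambda>x. u x *\<^sub>R g x) has_derivative
        (\<lambda>v. u x *\<^sub>R frechet_derivative g (at x) v + frechet_derivative u (at x) v *\<^sub>R g x)) (at x)"
      if "x \<in> S" for x
      using Suc.prems that by (intro has_derivative_scaleR Ck_on_has_derivative)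
    show "Ck_on k S (\<lambda>x. u x *\<^sub>R frechet_derivative g (at x) v + frechet_derivative u (at x) v *\<^sub>R g x)" for v
      using Suc.prems Ck_on_SucD[OF Suc.prems(1)] Ck_on_SucD[OF Suc.prems(2)]
      by (intro Ck_on_add[OF assms] Suc.IH) auto
  qed
qed

lemma Ck_on_mult:
  fixes u g :: "'e::euclidean_space \<Rightarrow> real"
  assumes "open S" "Ck_on k S u" "Ck_on k S g"
  shows "Ck_on k S (\<lambda>x. u x * g x)"
  using Ck_on_scaleR[OF assms] by simp

lemma Ck_on_sum:
  assumes "open S" "\<And>i. i \<in> I \<Longrightarrow> Ck_on k S (f i)"
  shows "Ck_on k S (\<lambda>x. \<Sum>i\<in>I. f i x)"
  using assms(2) by (induction I rule: infinite_finite_induct)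
    (auto intro!: Ck_on_const Ck_on_add[OF assms(1)])

text \<open>The induction concerns directional derivatives in a fixed direction, whereas the chain rule
  differentiates \<open>g\<close> in the variable direction \<open>f' v\<close>; expanding this direction in a basis leaves
  only fixed ones.\<close>

lemma Ck_on_compose:
  fixes f :: "'e::euclidean_space \<Rightarrow> 'f::euclidean_space"
  assumes "open S" "open T" "f ` S \<subseteq> T"
  shows "Ck_on k S f \<Longrightarrow> Ck_on k T g \<Longrightarrow> Ck_on k S (\<lambda>x. g (f x))"
proof (induction k arbitrary: g)
  case 0
  then show ?case using assms by (auto intro: continuous_on_compose2)
next
  case (Suc k)
  have lin: "frechet_derivative g (at y) w
      = (\<Sum>b\<in>Basis. (w \<bullet> b) *\<^sub>R frechet_derivative g (at y) b)" if "y \<in> T" for y w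
  proof -
    have l: "linear (frechet_derivative g (at y))"
      using Suc.prems that by (auto intro: linear_frechet_derivative)
    have "frechet_derivative g (at y) (\<Sum>b\<in>Basis. (w \<bullet> b) *\<^sub>R b)
      = (\<Sum>b\<in>Basis. (w \<bullet> b) *\<^sub>R frechet_derivative g (at y) b)"
      by (simp add: linear_sum[OF l] linear_scale[OF l])
    then show ?thesis by (simp add: euclidean_representation)
  qed
  show ?case
  proof (rule Ck_on_SucI'[OF assms(1)])
    show "((\<lambda>x. g (f x)) has_derivative
        (\<lambda>v. frechet_derivative g (at (f x)) (frechet_derivative f (at x) v))) (at x)" if "x \<in> S" for x
      using has_derivative_compose[OF Ck_on_has_derivative[OF Suc.prems(1) that]
          Ck_on_has_derivative[OF Suc.prems(2), of "f x"]] that assms(3) by auto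
    show "Ck_on k S (\<lambda>x. frechet_derivative g (at (f x)) (frechet_derivative f (at x) v))" for v
    proof (rule Ck_on_cong[OF assms(1)])
      show "Ck_on k S (\<lambda>x. \<Sum>b\<in>Basis. (frechet_derivative f (at x) v \<bullet> b) *\<^sub>R frechet_derivative g (at (f x)) b)"
        using Suc.prems Ck_on_SucD[OF Suc.prems(1)]
        by (intro Ck_on_sum[OF assms(1)] Ck_on_scaleR[OF assms(1)] Suc.IH
            Ck_on_bounded_linear_comp[OF assms(1) bounded_linear_inner_left]) auto
    qed (use lin assms(3) in \<open>auto simp: image_subset_iff\<close>)
  qed
qed

lemma Ck_on_Pair:
  assumes "open S" 
  shows "Ck_on k S f \<Longrightarrow> Ck_on k S g \<Longrightarrow> Ck_on k S (\<lambda>x. (f x, g x))"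
proof (induction k arbitrary: f g)
  case 0
  then show ?case by (auto intro: continuous_on_Pair)
next
  case (Suc k)
  show ?case
  proof (rule Ck_on_SucI'[OF assms])
    show "((\<lambda>x. (f x, g x)) has_derivative
        (\<lambda>v. (frechet_derivative f (at x) v, frechet_derivative g (at x) v))) (at x)" if "x \<in> S" for x
      using Suc.prems that by (intro has_derivative_Pair Ck_on_has_derivative)
  qed (use Suc in auto)
qed

lemma smooth_onD: "smooth_on S f \<Longrightarrow> Ck_on k S f"
  by (simp add: smooth_on_def)

lemma smooth_on_cong:
  "open S \<Longrightarrow> smooth_on S f \<Longrightarrow> (\<And>x. x \<in> S \<Longrightarrow> f x = g x) \<Longrightarrow> smooth_on S g"
  unfolding smooth_on_def using Ck_on_cong[of S f g] by blast

lemma smooth_on_subset: "smooth_on S f \<Longrightarrow> T \<subseteq> S \<Longrightarrow> smooth_on T f"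
  unfolding smooth_on_def using Ck_on_subset by blast

lemma smooth_on_local:
  "(\<And>x. x \<in> S \<Longrightarrow> \<exists>T. open T \<and> x \<in> T \<and> smooth_on T f) \<Longrightarrow> smooth_on S f"
  unfolding smooth_on_def by (intro allI Ck_on_local) blast

lemma smooth_on_const: "smooth_on S (\<lambda>x. c)"
  by (simp add: smooth_on_def Ck_on_const)

lemma smooth_on_add:
  "open S \<Longrightarrow> smooth_on S f \<Longrightarrow> smooth_on S g \<Longrightarrow> smooth_on S (\<lambda>x. f x + g x)"
  by (simp add: smooth_on_def Ck_on_add)

lemma smooth_on_mult:
  fixes f g :: "'e::euclidean_space \<Rightarrow> real"
  shows "open S \<Longrightarrow> smooth_on S f \<Longrightarrow> smooth_on S g \<Longrightarrow> smooth_on S (\<lambda>x. f x * g x)"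
  by (simp add: smooth_on_def Ck_on_mult)

lemma smooth_on_scaleR:
  "open S \<Longrightarrow> smooth_on S f \<Longrightarrow> smooth_on S g \<Longrightarrow> smooth_on S (\<lambda>x. f x *\<^sub>R g x)"
  by (simp add: smooth_on_def Ck_on_scaleR)

lemma smooth_on_sum:
  "open S \<Longrightarrow> (\<And>i. i \<in> I \<Longrightarrow> smooth_on S (f i)) \<Longrightarrow> smooth_on S (\<lambda>x. \<Sum>i\<in>I. f i x)"
  by (simp add: smooth_on_def Ck_on_sum)

lemma smooth_on_Pair:
  "open S \<Longrightarrow> smooth_on S f \<Longrightarrow> smooth_on S g \<Longrightarrow> smooth_on S (\<lambda>x. (f x, g x))"
  by (simp add: smooth_on_def Ck_on_Pair)

lemma smooth_on_bounded_linear: "open S \<Longrightarrow> bounded_linear f \<Longrightarrow> smooth_on S f"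
  by (simp add: smooth_on_def Ck_on_bounded_linear)

lemma smooth_on_compose:
  fixes f :: "'e::euclidean_space \<Rightarrow> 'f::euclidean_space"
  shows "smooth_on S f \<Longrightarrow> smooth_on T g \<Longrightarrow> open S \<Longrightarrow> open T \<Longrightarrow> f ` S \<subseteq> T \<Longrightarrow>
    smooth_on S (\<lambda>x. g (f x))"
  unfolding smooth_on_def using Ck_on_compose[of S T f _ g] by blast

lemma smooth_on_has_derivative:
  "smooth_on S f \<Longrightarrow> x \<in> S \<Longrightarrow> (f has_derivative frechet_derivative f (at x)) (at x)"
  using Ck_on_has_derivative[of 0 S f x] smooth_onD[of S f "Suc 0"] by blast

lemma smooth_on_frechet_derivative:
  "smooth_on S f \<Longrightarrow> smooth_on S (\<lambda>x. frechet_derivative f (at x) v)"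
  unfolding smooth_on_def
proof
  fix k
  assume "\<forall>k. Ck_on k S f"
  then have "Ck_on (Suc k) S f" by blast
  then show "Ck_on k S (\<lambda>x. frechet_derivative f (at x) v)" by simp
qed

lemma smooth_on_continuous: "smooth_on S f \<Longrightarrow> continuous_on S f"
  using smooth_onD[of S f 0] by simp

lemma smooth_on_exp: "smooth_on UNIV (exp :: real \<Rightarrow> real)"
  unfolding smooth_on_def
proof
  fix k
  show "Ck_on k UNIV (exp :: real \<Rightarrow> real)"
  proof (induction k)
    case (Suc k)
    show ?case
    proof (rule Ck_on_SucI')
      show "(exp has_derivative (\<lambda>v. exp x * v)) (at x)" for x :: real
        using DERIV_exp[of x] by (simp add: has_field_derivative_def)
      show "Ck_on k UNIV (\<lambda>x::real. exp x * v)" for v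
        by (rule Ck_on_mult[OF open_UNIV Suc Ck_on_const])
    qed simp
  qed (simp add: continuous_on_exp)
qed

lemma smooth_on_inverse: "smooth_on {x. x \<noteq> 0} (inverse :: real \<Rightarrow> real)"
  unfolding smooth_on_def
proof
  fix k
  have o: "open {x::real. x \<noteq> 0}" by (simp add: open_Collect_neq)
  show "Ck_on k {x. x \<noteq> 0} (inverse :: real \<Rightarrow> real)"
  proof (induction k)
    case (Suc k)
    show ?case
    proof (rule Ck_on_SucI'[OF o])
      show "(inverse has_derivative (\<lambda>v. inverse x * inverse x * (-v))) (at x)" if "x \<in> {x. x \<noteq> 0}" for x :: real
        using that by (auto intro!: derivative_eq_intros)
      show "Ck_on k {x. x \<noteq> 0} (\<lambda>x::real. inverse x * inverse x * (- v))" for v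
        by (intro Ck_on_mult[OF o] Suc Ck_on_const)
    qed
  qed (simp add: continuous_on_inverse)
qed

section \<open>Cut-off functions and Hadamard's lemma\<close>

text \<open>The functions \<open>t\<^sup>-\<^sup>m e\<^sup>-\<^sup>1\<^sup>/\<^sup>t\<close>, continued by zero. Treating all \<open>m\<close> at once makes the family
  closed under differentiation, so that smoothness at \<open>0\<close> needs only one limit.\<close>

definition flat :: "nat \<Rightarrow> real \<Rightarrow> real" where
  "flat m t = (if t \<le> 0 then 0 else inverse t ^ m * exp (- inverse t))"

lemma flat_tendsto_0: "(flat m \<longlongrightarrow> 0) (at 0)"
proof -
  have "((\<lambda>t. inverse t ^ m / exp (inverse t)) \<longlongrightarrow> 0) (at_right (0::real))"
    by (rule filterlim_compose[OF tendsto_power_div_exp_0 filterlim_inverse_at_top_right])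
  moreover have "\<forall>\<^sub>F t in at_right 0. inverse t ^ m / exp (inverse t) = flat m t"
    by (rule eventually_at_rightI[of 0 1]) (auto simp: flat_def exp_minus field_simps)
  ultimately have r: "(flat m \<longlongrightarrow> 0) (at_right 0)"
    using tendsto_cong by fast
  have "\<forall>\<^sub>F t in at_left 0. 0 = flat m t"
    by (rule eventually_at_leftI[of "-1"]) (auto simp: flat_def)
  then have "(flat m \<longlongrightarrow> 0) (at_left 0)"
    by (rule tendsto_eventually[OF eventually_mono]) auto
  with r show ?thesis by (simp add: filterlim_at_split)
qed

text \<open>The difference quotient of one member of the family at \<open>0\<close> is the next member.\<close>

lemma flat_has_derivative:
  "(flat m has_real_derivative (flat (m + 2) t - real m * flat (Suc m) t)) (at t)"
proof -
  consider "t > 0" | "t = 0" | "t < 0" by linarith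
  then show ?thesis
  proof cases
    case 1
    have "((\<lambda>t. inverse t ^ m * exp (- inverse t)) has_real_derivative
        (flat (m + 2) t - real m * flat (Suc m) t)) (at t)"
    proof -
      have "((\<lambda>t. inverse t ^ m) has_real_derivative (- real m * inverse t ^ Suc m)) (at t)"
      proof (cases m)
        case (Suc n)
        have "((\<lambda>t. inverse t ^ Suc n) has_real_derivative
            (1 + real n) * (- (inverse t * inverse t) * inverse t ^ n)) (at t)"
          by (rule DERIV_power_Suc) (use 1 in \<open>auto intro!: derivative_eq_intros simp: power2_eq_square\<close>)
        then show ?thesis by (simp add: Suc algebra_simps)
      qed simp
      moreover have "((\<lambda>t. exp (- inverse t)) has_real_derivative exp (- inverse t) * (inverse t * inverse t)) (at t)"
        using 1 by (auto intro!: derivative_eq_intros)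
      ultimately have "((\<lambda>t. inverse t ^ m * exp (- inverse t)) has_real_derivative
          (- real m * inverse t ^ Suc m) * exp (- inverse t)
          + (exp (- inverse t) * (inverse t * inverse t)) * inverse t ^ m) (at t)"
        by (rule DERIV_mult)
      then show ?thesis using 1 by (simp add: flat_def algebra_simps)
    qed
    then show ?thesis
      by (rule has_field_derivative_transform_within_open[where S = "{0<..}"]) (use 1 in \<open>auto simp: flat_def\<close>)
  next
    case 2
    have "((\<lambda>h. (flat m (0 + h) - flat m 0) / h) \<longlongrightarrow> 0) (at 0)"
      by (rule Lim_transform_eventually[OF flat_tendsto_0[of "Suc m"]])
        (auto simp: flat_def eventually_at_filter field_simps)
    then show ?thesis using 2 by (simp add: DERIV_def flat_def)
  next
    case 3
    have "((\<lambda>t. 0) has_real_derivative (flat (m + 2) t - real m * flat (Suc m) t)) (at t)"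
      using 3 by (simp add: flat_def)
    then show ?thesis
      by (rule has_field_derivative_transform_within_open[where S = "{..<0}"]) (use 3 in \<open>auto simp: flat_def\<close>)
  qed
qed

lemma smooth_on_flat: "smooth_on UNIV (flat m)"
  unfolding smooth_on_def
proof
  fix k
  show "Ck_on k UNIV (flat m)"
  proof (induction k arbitrary: m)
    case 0
    have "continuous_on UNIV (flat m)"
      by (intro continuous_at_imp_continuous_on ballI DERIV_isCont[OF flat_has_derivative])
    then show ?case by simp
  next
    case (Suc k)
    show ?case
    proof (rule Ck_on_SucI')
      show "(flat m has_derivative (\<lambda>v. (flat (m + 2) t + (- real m) * flat (Suc m) t) * v)) (at t)" for t
        using flat_has_derivative[of m t] by (simp add: has_field_derivative_def)
      show "Ck_on k UNIV (\<lambda>t. (flat (m + 2) t + (- real m) * flat (Suc m) t) * v)" for v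
        by (intro Ck_on_mult Ck_on_add Ck_on_const Suc.IH open_UNIV)
    qed simp
  qed
qed

definition bump :: "'e::euclidean_space \<Rightarrow> real \<Rightarrow> 'e \<Rightarrow> real" where
  "bump x0 r x = flat 0 (r\<^sup>2 - (x - x0) \<bullet> (x - x0))"

lemma smooth_on_bump: "smooth_on UNIV (bump x0 r)"
proof -
  have "smooth_on UNIV (\<lambda>x. r\<^sup>2 + (\<Sum>b\<in>Basis. (-1) * (((x \<bullet> b) + - (x0 \<bullet> b)) * ((x \<bullet> b) + - (x0 \<bullet> b)))))"
    by (intro smooth_on_add smooth_on_sum smooth_on_mult smooth_on_const open_UNIV
        smooth_on_bounded_linear bounded_linear_inner_left)
  also have "(\<lambda>x. r\<^sup>2 + (\<Sum>b\<in>Basis. (-1) * (((x \<bullet> b) + - (x0 \<bullet> b)) * ((x \<bullet> b) + - (x0 \<bullet> b)))))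
      = (\<lambda>x. r\<^sup>2 - (x - x0) \<bullet> (x - x0))"
    by (rule ext, subst (3) euclidean_inner) (simp add: sum_negf inner_diff_left)
  finally show ?thesis
    unfolding bump_def[abs_def] by (rule smooth_on_compose[OF _ smooth_on_flat]) auto
qed

lemma bump_pos: "x \<in> ball x0 r \<Longrightarrow> bump x0 r x > 0"
proof -
  assume "x \<in> ball x0 r"
  then have "norm (x - x0) < r" by (simp add: dist_norm norm_minus_commute)
  then have "(norm (x - x0))\<^sup>2 < r\<^sup>2" by (simp add: power_strict_mono)
  then show ?thesis by (simp add: bump_def flat_def power2_norm_eq_inner)
qed

lemma bump_eq_0: "0 < r \<Longrightarrow> x \<notin> cball x0 r \<Longrightarrow> bump x0 r x = 0"
proof -
  assume "0 < r" "x \<notin> cball x0 r"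
  then have "r \<le> norm (x - x0)" "0 \<le> r" by (auto simp: dist_norm norm_minus_commute)
  then have "r\<^sup>2 \<le> (norm (x - x0))\<^sup>2" by (simp add: power_mono)
  then show ?thesis by (simp add: bump_def flat_def power2_norm_eq_inner)
qed

text \<open>Differentiation under the integral sign raises the exponent of the factor \<open>t\<^sup>m\<close>, which is
  present for the sake of the induction on the order of differentiability.\<close>

lemma Ck_on_ray_integral:
  fixes \<phi> :: "'e::euclidean_space \<Rightarrow> real"
  assumes S: "open S" "convex S" "q \<in> S"
  shows "Ck_on k S \<phi> \<Longrightarrow> Ck_on k S (\<lambda>x. integral {0..1} (\<lambda>t. t ^ m * \<phi> (q + t *\<^sub>R (x - q))))"
proof (induction k arbitrary: m \<phi>)
  case 0
  have seg: "q + t *\<^sub>R (x - q) \<in> S" if "x \<in> S" "t \<in> {0..1}" for t :: real and x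
    using convexD_alt[OF S(2) S(3) that(1), of t] that by (simp add: algebra_simps)
  have "continuous_on (S \<times> {0..1::real}) (\<lambda>z. \<phi> (q + snd z *\<^sub>R (fst z - q)))"
    by (rule continuous_on_compose2[of S \<phi>]) (use 0 seg in \<open>auto intro!: continuous_intros\<close>)
  then have "continuous_on (S \<times> cbox 0 (1::real)) (\<lambda>(x, t). t ^ m * \<phi> (q + t *\<^sub>R (x - q)))"
    by (auto intro!: continuous_intros simp: case_prod_unfold)
  then show ?case
    using integral_continuous_on_param[of S 0 "1::real" "\<lambda>x t. t ^ m * \<phi> (q + t *\<^sub>R (x - q))"] by simp
next
  case (Suc k)
  have seg: "q + t *\<^sub>R (x - q) \<in> S" if "x \<in> S" "t \<in> {0..1}" for t :: real and x
    using convexD_alt[OF S(2) S(3) that(1), of t] that by (simp add: algebra_simps)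
  define D where "D y = frechet_derivative \<phi> (at y)" for y
  have D: "(\<phi> has_derivative D y) (at y)" if "y \<in> S" for y
    using Ck_on_has_derivative[OF Suc.prems that] by (simp add: D_def)
  have blD: "bounded_linear (D y)" if "y \<in> S" for y
    using D[OF that] by (rule has_derivative_bounded_linear)
  define F where "F x t = Blinfun (\<lambda>v. t ^ Suc m * D (q + t *\<^sub>R (x - q)) v)" for x and t :: real
  have F: "blinfun_apply (F x t) = (\<lambda>v. t ^ Suc m * D (q + t *\<^sub>R (x - q)) v)"
    if "x \<in> S" "t \<in> {0..1}" for x t
    unfolding F_def
    by (rule bounded_linear_Blinfun_apply) (intro bounded_linear_const_mult blD seg that)
  have CkD: "Ck_on k S (\<lambda>x. D x v)" for v using Suc.prems by (simp add: D_def)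
  have cont\<phi>: "continuous_on S \<phi>"
    using D by (intro continuous_at_imp_continuous_on ballI has_derivative_continuous) auto
  have contD: "continuous_on S (\<lambda>x. D x v)" for v
  proof -
    have "Ck_on 0 S g" if "Ck_on k S g" for g :: "'e \<Rightarrow> real"
      using that by (induction k) (auto dest: Ck_on_SucD simp del: Ck_on.simps)
    then show ?thesis using CkD by auto
  qed
  have comp: "continuous_on (S \<times> {0..1::real}) (\<lambda>z. g (q + snd z *\<^sub>R (fst z - q)))"
    if "continuous_on S g" for g :: "'e \<Rightarrow> real"
    by (rule continuous_on_compose2[OF that]) (use seg in \<open>auto intro!: continuous_intros\<close>)
  have contF: "continuous_on (S \<times> cbox 0 1) (\<lambda>(x, t). F x t)"
  proof (rule continuous_on_blinfun_componentwise)
    fix i :: 'e assume "i \<in> Basis"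
    have "continuous_on (S \<times> {0..1}) (\<lambda>z. snd z ^ Suc m * D (q + snd z *\<^sub>R (fst z - q)) i)"
      by (intro continuous_intros comp contD)
    then show "continuous_on (S \<times> cbox 0 1) (\<lambda>z. blinfun_apply (case z of (x, t) \<Rightarrow> F x t) i)"
      unfolding cbox_interval by (rule continuous_on_eq) (auto simp: F)
  qed
  have int: "(\<lambda>t. t ^ m * \<phi> (q + t *\<^sub>R (x - q))) integrable_on cbox 0 1" if "x \<in> S" for x
  proof (rule integrable_continuous)
    have "continuous_on {0..1::real} (\<lambda>t. \<phi> (q + t *\<^sub>R (x - q)))"
      by (rule continuous_on_compose2[OF cont\<phi>]) (use seg that in \<open>auto intro!: continuous_intros\<close>)
    then show "continuous_on (cbox 0 1) (\<lambda>t. t ^ m * \<phi> (q + t *\<^sub>R (x - q)))"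
      by (auto intro!: continuous_intros)
  qed
  have intF: "F x integrable_on cbox 0 1" if "x \<in> S" for x
  proof (rule integrable_continuous)
    have "continuous_on (cbox 0 1) ((\<lambda>(x, t). F x t) \<circ> (\<lambda>t. (x, t)))"
      by (rule continuous_on_compose)
        (use that in \<open>auto intro!: continuous_intros continuous_on_subset[OF contF]\<close>)
    then show "continuous_on (cbox 0 1) (F x)" by (simp add: o_def)
  qed
  show ?case
  proof (rule Ck_on_SucI'[OF S(1)])
    fix x assume x: "x \<in> S"
    have "((\<lambda>x. integral (cbox 0 1) (\<lambda>t. t ^ m * \<phi> (q + t *\<^sub>R (x - q)))) has_derivative
        blinfun_apply (integral (cbox 0 1) (F x))) (at x within S)"
    proof (rule leibniz_rule[OF _ int contF x S(2)])
      fix y t assume y: "y \<in> S" and t: "t \<in> cbox 0 (1::real)"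
      have "((\<lambda>y. q + t *\<^sub>R (y - q)) has_derivative (\<lambda>v. t *\<^sub>R v)) (at y)"
        by (auto intro!: derivative_eq_intros)
      from has_derivative_compose[OF this D] seg y t
      have "((\<lambda>y. \<phi> (q + t *\<^sub>R (y - q))) has_derivative (\<lambda>v. D (q + t *\<^sub>R (y - q)) (t *\<^sub>R v))) (at y)"
        by auto
      then have "((\<lambda>y. t ^ m * \<phi> (q + t *\<^sub>R (y - q))) has_derivative
          (\<lambda>v. t ^ m * D (q + t *\<^sub>R (y - q)) (t *\<^sub>R v))) (at y)"
        by (rule has_derivative_mult_right)
      moreover have "(\<lambda>v. t ^ m * D (q + t *\<^sub>R (y - q)) (t *\<^sub>R v)) = blinfun_apply (F y t)"
        using y t blD[OF seg[OF y]] by (auto simp: F linear_simps)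
      ultimately show "((\<lambda>x. t ^ m * \<phi> (q + t *\<^sub>R (x - q))) has_derivative blinfun_apply (F y t)) (at y within S)"
        by (simp add: has_derivative_at_withinI)
    qed
    moreover have "blinfun_apply (integral (cbox 0 1) (F x)) =
        (\<lambda>v. integral {0..1} (\<lambda>t. t ^ Suc m * D (q + t *\<^sub>R (x - q)) v))"
    proof
      fix v
      have "blinfun_apply (integral (cbox 0 1) (F x)) v = integral (cbox 0 1) (\<lambda>t. blinfun_apply (F x t) v)"
        by (rule blinfun_apply_integral[OF intF[OF x]])
      also have "\<dots> = integral (cbox 0 1) (\<lambda>t. t ^ Suc m * D (q + t *\<^sub>R (x - q)) v)"
        by (rule integral_cong) (use x in \<open>auto simp: F\<close>)
      finally show "blinfun_apply (integral (cbox 0 1) (F x)) v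
          = integral {0..1} (\<lambda>t. t ^ Suc m * D (q + t *\<^sub>R (x - q)) v)" by simp
    qed
    ultimately show "((\<lambda>x. integral {0..1} (\<lambda>t. t ^ m * \<phi> (q + t *\<^sub>R (x - q)))) has_derivative
        (\<lambda>v. integral {0..1} (\<lambda>t. t ^ Suc m * D (q + t *\<^sub>R (x - q)) v))) (at x)"
      by (simp only: at_within_open[OF x S(1)] cbox_interval)
  next
    show "Ck_on k S (\<lambda>x. integral {0..1} (\<lambda>t. t ^ Suc m * D (q + t *\<^sub>R (x - q)) v))" for v
      by (rule Suc.IH[OF CkD])
  qed
qed

text \<open>Integrate the derivative of \<open>f\<close> along the segment from \<open>q\<close> to \<open>x\<close>.\<close>

lemma Hadamard:
  fixes f :: "'e::euclidean_space \<Rightarrow> real"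
  assumes S: "open S" "convex S" "q \<in> S" and f: "smooth_on S f"
  obtains h where "\<And>i. smooth_on S (h i)" "\<And>i. h i q = frechet_derivative f (at q) i"
    "\<And>x. x \<in> S \<Longrightarrow> f x = f q + (\<Sum>i\<in>Basis. ((x - q) \<bullet> i) * h i x)"
proof
  define D where "D y = frechet_derivative f (at y)" for y
  have D: "(f has_derivative D y) (at y)" if "y \<in> S" for y
    using smooth_on_has_derivative[OF f that] by (simp add: D_def)
  define h where "h i x = integral {0..1} (\<lambda>t. t ^ 0 * D (q + t *\<^sub>R (x - q)) i)" for i x
  show "smooth_on S (h i)" for i
    using Ck_on_ray_integral[OF S smooth_onD[OF smooth_on_frechet_derivative[OF f, of i]], of _ 0]
    by (simp add: smooth_on_def h_def[abs_def] D_def)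
  show "h i q = frechet_derivative f (at q) i" for i by (simp add: h_def D_def)
  fix x assume x: "x \<in> S"
  have seg: "q + t *\<^sub>R (x - q) \<in> S" if "t \<in> {0..1}" for t :: real
    using convexD_alt[OF S(2) S(3) x, of t] that by (simp add: algebra_simps)
  have ib: "(\<lambda>t. D (q + t *\<^sub>R (x - q)) i) integrable_on {0..1}" for i
  proof (rule integrable_continuous_real)
    have "continuous_on S (\<lambda>x. D x i)"
      unfolding D_def by (rule smooth_on_continuous[OF smooth_on_frechet_derivative[OF f]])
    then show "continuous_on {0..1} (\<lambda>t. D (q + t *\<^sub>R (x - q)) i)"
      by (rule continuous_on_compose2) (use seg in \<open>auto intro!: continuous_intros\<close>)
  qed
  have "((\<lambda>t. D (q + t *\<^sub>R (x - q)) (x - q)) has_integral (f (q + 1 *\<^sub>R (x - q)) - f (q + 0 *\<^sub>R (x - q)))) {0..1}"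
  proof (rule fundamental_theorem_of_calculus)
    fix t :: real assume t: "t \<in> {0..1}"
    have "((\<lambda>t. q + t *\<^sub>R (x - q)) has_derivative (\<lambda>s. s *\<^sub>R (x - q))) (at t)"
      by (auto intro!: derivative_eq_intros)
    from has_derivative_compose[OF this D[OF seg[OF t]]]
    have "((\<lambda>t. f (q + t *\<^sub>R (x - q))) has_derivative (\<lambda>s. D (q + t *\<^sub>R (x - q)) (s *\<^sub>R (x - q)))) (at t)" .
    moreover have "D (q + t *\<^sub>R (x - q)) (s *\<^sub>R (x - q)) = s * D (q + t *\<^sub>R (x - q)) (x - q)" for s
      using has_derivative_bounded_linear[OF D[OF seg[OF t]]] by (simp add: linear_simps)
    ultimately show "((\<lambda>t. f (q + t *\<^sub>R (x - q))) has_vector_derivative D (q + t *\<^sub>R (x - q)) (x - q)) (at t within {0..1})"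
      by (simp add: has_vector_derivative_def has_derivative_at_withinI)
  qed simp
  then have "f x = f q + integral {0..1} (\<lambda>t. D (q + t *\<^sub>R (x - q)) (x - q))"
    by (simp add: integral_unique)
  also have "integral {0..1} (\<lambda>t. D (q + t *\<^sub>R (x - q)) (x - q))
      = integral {0..1} (\<lambda>t. \<Sum>i\<in>Basis. ((x - q) \<bullet> i) * D (q + t *\<^sub>R (x - q)) i)"
  proof (rule integral_cong)
    fix t :: real assume t: "t \<in> {0..1}"
    have l: "linear (D (q + t *\<^sub>R (x - q)))"
      using has_derivative_bounded_linear[OF D[OF seg[OF t]]] by (rule bounded_linear.linear)
    have "D (q + t *\<^sub>R (x - q)) (\<Sum>i\<in>Basis. ((x - q) \<bullet> i) *\<^sub>R i) = (\<Sum>i\<in>Basis. ((x - q) \<bullet> i) * D (q + t *\<^sub>R (x - q)) i)"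
      by (simp only: linear_sum[OF l] linear_scale[OF l] real_scaleR_def)
    then show "D (q + t *\<^sub>R (x - q)) (x - q) = (\<Sum>i\<in>Basis. ((x - q) \<bullet> i) * D (q + t *\<^sub>R (x - q)) i)"
      by (simp only: euclidean_representation)
  qed
  also have "\<dots> = (\<Sum>i\<in>Basis. ((x - q) \<bullet> i) * h i x)"
    using ib by (subst integral_sum) (auto simp: h_def intro!: integrable_on_mult_right)
  finally show "f x = f q + (\<Sum>i\<in>Basis. ((x - q) \<bullet> i) * h i x)" .
qed

section \<open>Smooth functions and point derivations on a manifold\<close>

locale manifold =
  fixes G :: "('a::t2_space, 'e::euclidean_space) lie_data"
  assumes atlas: "smooth_atlas (atlas G)"
begin

lemma
  assumes "(U, \<phi>) \<in> atlas G"
  shows chart_open: "open U" and chart_open_image: "open (\<phi> ` U)"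
    and chart_continuous: "continuous_on U \<phi>"
    and chart_inv_continuous: "continuous_on (\<phi> ` U) (inv_into U \<phi>)"
    and chart_inv: "\<And>p. p \<in> U \<Longrightarrow> inv_into U \<phi> (\<phi> p) = p"
    and chart_inj: "inj_on \<phi> U"
proof -
  have "open U \<and> open (\<phi> ` U) \<and> homeomorphism U (\<phi> ` U) \<phi> (inv_into U \<phi>)"
    using atlas assms unfolding smooth_atlas_def by blast
  then show "open U" "open (\<phi> ` U)" "continuous_on U \<phi>" "continuous_on (\<phi> ` U) (inv_into U \<phi>)"
    and i: "\<And>p. p \<in> U \<Longrightarrow> inv_into U \<phi> (\<phi> p) = p"
    by (auto simp: homeomorphism_def)
  show "inj_on \<phi> U" by (rule inj_on_inverseI) (rule i)
qed

lemma chart_at: obtains U \<phi> where "(U, \<phi>) \<in> atlas G" "p \<in> U"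
proof -
  have "p \<in> (\<Union>(U, \<phi>)\<in>atlas G. U)" using atlas by (simp add: smooth_atlas_def)
  then show ?thesis using that by auto
qed

lemma chart_preimage_open:
  assumes "(U, \<phi>) \<in> atlas G" "open T"
  shows "open (U \<inter> \<phi> -` T)"
  by (rule continuous_open_preimage[OF chart_continuous[OF assms(1)] chart_open[OF assms(1)] assms(2)])

lemma chart_image_open:
  assumes "(U, \<phi>) \<in> atlas G" "open W"
  shows "open (\<phi> ` (U \<inter> W))"
proof -
  have "\<phi> ` (U \<inter> W) = \<phi> ` U \<inter> inv_into U \<phi> -` W"
    using chart_inv[OF assms(1)] by auto
  then show ?thesis
    using continuous_open_preimage[OF chart_inv_continuous chart_open_image] assms by metis
qed

lemma chart_transition:
  assumes "(U, \<phi>) \<in> atlas G" "(V, \<psi>) \<in> atlas G"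
  shows "smooth_on (\<phi> ` (U \<inter> V)) (\<lambda>x. \<psi> (inv_into U \<phi> x))"
  using atlas assms unfolding smooth_atlas_def by (fastforce simp: o_def)

lemma smooth_funs_chart:
  assumes "f \<in> smooth_funs G" "(U, \<phi>) \<in> atlas G"
  shows "smooth_on (\<phi> ` U) (\<lambda>x. f (inv_into U \<phi> x))"
  using assms by (fastforce simp: smooth_funs_def o_def)

lemma smooth_funsI:
  assumes "\<And>U \<phi>. (U, \<phi>) \<in> atlas G \<Longrightarrow> smooth_on (\<phi> ` U) (\<lambda>x. f (inv_into U \<phi> x))"
  shows "f \<in> smooth_funs G"
  using assms by (auto simp: smooth_funs_def o_def)

text \<open>By smoothness of the transition maps, one chart around each point decides.\<close>

lemma smooth_funs_localI:
  assumes "\<And>p. \<exists>U \<phi> W. (U, \<phi>) \<in> atlas G \<and> open W \<and> p \<in> W \<and> W \<subseteq> U \<and>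
      smooth_on (\<phi> ` W) (\<lambda>x. f (inv_into U \<phi> x))"
  shows "f \<in> smooth_funs G"
proof (intro smooth_funsI smooth_on_local)
  fix V \<psi> y assume V: "(V, \<psi>) \<in> atlas G" and "y \<in> \<psi> ` V"
  then obtain p where p: "p \<in> V" "y = \<psi> p" by blast
  from assms[of p] obtain U \<phi> W where U: "(U, \<phi>) \<in> atlas G" and W: "open W" "p \<in> W" "W \<subseteq> U"
    and f: "smooth_on (\<phi> ` W) (\<lambda>x. f (inv_into U \<phi> x))" by blast
  define T where "T = \<psi> ` (V \<inter> W)"
  have T: "open T" unfolding T_def by (rule chart_image_open[OF V W(1)])
  have oW: "open (\<phi> ` W)"
    using chart_image_open[OF U W(1)] W(3) by (simp add: Int_absorb1)
  have s: "smooth_on T (\<lambda>x. \<phi> (inv_into V \<psi> x))"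
    by (rule smooth_on_subset[OF chart_transition[OF V U]]) (use W in \<open>auto simp: T_def\<close>)
  have "smooth_on T (\<lambda>x. f (inv_into U \<phi> (\<phi> (inv_into V \<psi> x))))"
    by (rule smooth_on_compose[OF s f T oW]) (auto simp: T_def chart_inv[OF V])
  then have "smooth_on T (\<lambda>x. f (inv_into V \<psi> x))"
    by (rule smooth_on_cong[OF T]) (use W in \<open>auto simp: T_def chart_inv[OF V] chart_inv[OF U]\<close>)
  then show "\<exists>T. open T \<and> y \<in> T \<and> smooth_on T (\<lambda>x. f (inv_into V \<psi> x))"
    using T p W by (auto simp: T_def)
qed

lemma smooth_funs_const: "(\<lambda>p. k) \<in> smooth_funs G"
  by (intro smooth_funsI smooth_on_const)

lemma smooth_funs_add:
  "f \<in> smooth_funs G \<Longrightarrow> h \<in> smooth_funs G \<Longrightarrow> (\<lambda>p. f p + h p) \<in> smooth_funs G"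
  by (rule smooth_funsI, rule smooth_on_add) (auto intro: chart_open_image smooth_funs_chart)

lemma smooth_funs_mult:
  "f \<in> smooth_funs G \<Longrightarrow> h \<in> smooth_funs G \<Longrightarrow> (\<lambda>p. f p * h p) \<in> smooth_funs G"
  by (rule smooth_funsI, rule smooth_on_mult) (auto intro: chart_open_image smooth_funs_chart)

lemma smooth_funs_sum:
  "(\<And>i. i \<in> I \<Longrightarrow> f i \<in> smooth_funs G) \<Longrightarrow> (\<lambda>p. \<Sum>i\<in>I. f i p) \<in> smooth_funs G"
  by (rule smooth_funsI, rule smooth_on_sum) (auto intro: chart_open_image smooth_funs_chart)

lemma smooth_funs_cmult: "f \<in> smooth_funs G \<Longrightarrow> (\<lambda>p. k * f p) \<in> smooth_funs G"
  by (intro smooth_funs_mult smooth_funs_const)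

lemma smooth_funs_diff:
  "f \<in> smooth_funs G \<Longrightarrow> h \<in> smooth_funs G \<Longrightarrow> (\<lambda>p. f p - h p) \<in> smooth_funs G"
  using smooth_funs_add[OF _ smooth_funs_cmult[of h "-1"], of f] by simp

definition cut_off :: "'a set \<Rightarrow> ('a \<Rightarrow> 'e) \<Rightarrow> 'e \<Rightarrow> real \<Rightarrow> ('e \<Rightarrow> real) \<Rightarrow> 'a \<Rightarrow> real" where
  "cut_off U \<phi> x0 r u = (\<lambda>p. if p \<in> U then bump x0 r (\<phi> p) * u (\<phi> p) else 0)"

text \<open>The support of the cut-off function is compact, hence closed because the manifold is
  Hausdorff; so the function vanishes near each point outside of it.\<close>

lemma cut_off_smooth:
  assumes U: "(U, \<phi>) \<in> atlas G" and T: "open T" "T \<subseteq> \<phi> ` U" "cball x0 r \<subseteq> T" and "0 < r"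
    and u: "smooth_on T u"
  shows "cut_off U \<phi> x0 r u \<in> smooth_funs G"
proof (rule smooth_funs_localI)
  fix p
  define K where "K = inv_into U \<phi> ` cball x0 r"
  have "compact K" unfolding K_def
    by (rule compact_continuous_image) (use T in \<open>auto intro: continuous_on_subset[OF chart_inv_continuous[OF U]]\<close>)
  then have K: "closed K" by (rule compact_imp_closed)
  show "\<exists>V \<psi> W. (V, \<psi>) \<in> atlas G \<and> open W \<and> p \<in> W \<and> W \<subseteq> V \<and>
      smooth_on (\<psi> ` W) (\<lambda>x. cut_off U \<phi> x0 r u (inv_into V \<psi> x))"
  proof (cases "p \<in> U \<and> \<phi> p \<in> T")
    case True
    define W where "W = U \<inter> \<phi> -` T"
    have W: "\<phi> ` W = T" using T(2) by (auto simp: W_def)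
    have "smooth_on T (\<lambda>x. bump x0 r x * u x)"
      by (intro smooth_on_mult T u smooth_on_subset[OF smooth_on_bump]) simp
    then have "smooth_on (\<phi> ` W) (\<lambda>x. cut_off U \<phi> x0 r u (inv_into U \<phi> x))"
      unfolding W
      by (rule smooth_on_cong[OF T(1)]) (use T(2) in \<open>auto simp: cut_off_def chart_inv[OF U]\<close>)
    moreover have "open W" unfolding W_def by (rule chart_preimage_open[OF U T(1)])
    ultimately show ?thesis using U True by (auto simp: W_def)
  next
    case False
    then have pK: "p \<notin> K" using T chart_inv[OF U] by (fastforce simp: K_def)
    obtain V \<psi> where V: "(V, \<psi>) \<in> atlas G" "p \<in> V" by (rule chart_at)
    define W where "W = V \<inter> - K"
    have W: "open W" using K chart_open[OF V(1)] by (simp add: W_def open_Int open_Compl)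
    have z: "cut_off U \<phi> x0 r u q = 0" if "q \<in> W" for q
    proof (cases "q \<in> U")
      case True
      then have "\<phi> q \<notin> cball x0 r"
        using that chart_inv[OF U] by (force simp: W_def K_def)
      then show ?thesis using bump_eq_0[OF \<open>0 < r\<close>, of "\<phi> q" x0] by (simp add: cut_off_def)
    qed (simp add: cut_off_def)
    have oW: "open (\<psi> ` W)"
      unfolding W_def by (rule chart_image_open[OF V(1)]) (use K in \<open>simp add: open_Compl\<close>)
    have "cut_off U \<phi> x0 r u (inv_into V \<psi> x) = 0" if "x \<in> \<psi> ` W" for x
      using that z chart_inv[OF V(1)] by (auto simp: W_def)
    then have "smooth_on (\<psi> ` W) (\<lambda>x. cut_off U \<phi> x0 r u (inv_into V \<psi> x))"
      by (intro smooth_on_cong[OF oW smooth_on_const[of _ 0]]) simp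
    then show ?thesis using V W pK by (auto simp: W_def)
  qed
qed

definition point_derivation :: "'a \<Rightarrow> (('a \<Rightarrow> real) \<Rightarrow> real) \<Rightarrow> bool" where
  "point_derivation p \<delta> \<longleftrightarrow>
     (\<forall>f\<in>smooth_funs G. \<forall>h\<in>smooth_funs G. \<delta> (\<lambda>q. f q + h q) = \<delta> f + \<delta> h) \<and>
     (\<forall>k. \<forall>f\<in>smooth_funs G. \<delta> (\<lambda>q. k * f q) = k * \<delta> f) \<and>
     (\<forall>f\<in>smooth_funs G. \<forall>h\<in>smooth_funs G. \<delta> (\<lambda>q. f q * h q) = \<delta> f * h p + f p * \<delta> h)"

context
  fixes p \<delta> assumes \<delta>: "point_derivation p \<delta>"
begin

lemma
  shows pd_add: "f \<in> smooth_funs G \<Longrightarrow> h \<in> smooth_funs G \<Longrightarrow> \<delta> (\<lambda>q. f q + h q) = \<delta> f + \<delta> h"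
    and pd_cmult: "f \<in> smooth_funs G \<Longrightarrow> \<delta> (\<lambda>q. k * f q) = k * \<delta> f"
    and pd_mult: "f \<in> smooth_funs G \<Longrightarrow> h \<in> smooth_funs G \<Longrightarrow> \<delta> (\<lambda>q. f q * h q) = \<delta> f * h p + f p * \<delta> h"
  using \<delta> by (auto simp: point_derivation_def)

lemma pd_zero: "\<delta> (\<lambda>q. 0) = 0"
  using pd_cmult[OF smooth_funs_const, of 0 0] by simp

lemma pd_sum:
  assumes "finite I" "\<And>i. i \<in> I \<Longrightarrow> f i \<in> smooth_funs G"
  shows "\<delta> (\<lambda>q. \<Sum>i\<in>I. f i q) = (\<Sum>i\<in>I. \<delta> (f i))"
  using assms by (induction I rule: finite_induct) (auto simp: pd_zero pd_add smooth_funs_sum)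

text \<open>With a cut-off factor \<open>b\<close>, Hadamard's expansion becomes the identity
  \<open>b\<^sup>2 f = b\<^sup>2 f(p) + \<Sum>\<^sub>i (b (x\<^sub>i - x\<^sub>i(p))) (b h\<^sub>i)\<close> of globally smooth functions, to which the
  derivation applies. That \<open>b\<close> is merely positive at \<open>p\<close> accounts for the factor on the left.\<close>

lemma point_derivation_chart:
  assumes U: "(U, \<phi>) \<in> atlas G" and R: "ball x0 R \<subseteq> \<phi> ` U" "0 < r" "r < R"
    and p: "p \<in> U" "\<phi> p \<in> ball x0 r" and f: "f \<in> smooth_funs G"
  shows "bump x0 r (\<phi> p) * \<delta> f =
    (\<Sum>i\<in>Basis. \<delta> (cut_off U \<phi> x0 r (\<lambda>x. (x - \<phi> p) \<bullet> i)) *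
       frechet_derivative (\<lambda>x. f (inv_into U \<phi> x)) (at (\<phi> p)) i)"
proof -
  define F where "F x = f (inv_into U \<phi> x)" for x
  have T: "open (ball x0 R)" "convex (ball x0 R)" "\<phi> p \<in> ball x0 R" "cball x0 r \<subseteq> ball x0 R"
    using p R by auto
  have "smooth_on (ball x0 R) F"
    unfolding F_def by (rule smooth_on_subset[OF smooth_funs_chart[OF f U] R(1)])
  from Hadamard[OF T(1-3) this] obtain h where h: "\<And>i. smooth_on (ball x0 R) (h i)"
    "\<And>i. h i (\<phi> p) = frechet_derivative F (at (\<phi> p)) i"
    "\<And>x. x \<in> ball x0 R \<Longrightarrow> F x = F (\<phi> p) + (\<Sum>i\<in>Basis. ((x - \<phi> p) \<bullet> i) * h i x)" by metis
  define B where "B = cut_off U \<phi> x0 r (\<lambda>x. 1)"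
  define X where "X i = cut_off U \<phi> x0 r (\<lambda>x. (x - \<phi> p) \<bullet> i)" for i
  define H where "H i = cut_off U \<phi> x0 r (h i)" for i
  note co = cut_off_smooth[OF U T(1) R(1) T(4) R(2)]
  have B: "B \<in> smooth_funs G" unfolding B_def by (rule co[OF smooth_on_const])
  have X: "X i \<in> smooth_funs G" for i
  proof -
    have "smooth_on (ball x0 R) (\<lambda>x. x \<bullet> i + - (\<phi> p \<bullet> i))"
      by (intro smooth_on_add smooth_on_const smooth_on_bounded_linear bounded_linear_inner_left open_ball)
    then show ?thesis unfolding X_def by (intro co) (simp add: inner_diff_left)
  qed
  have H: "H i \<in> smooth_funs G" for i unfolding H_def by (rule co[OF h(1)])
  have BB: "(\<lambda>q. B q * B q) \<in> smooth_funs G" by (intro smooth_funs_mult B)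
  have Bp: "B p = bump x0 r (\<phi> p)" using p by (simp add: B_def cut_off_def)
  have Xp: "X i p = 0" for i by (simp add: X_def cut_off_def)
  have Hp: "H i p = B p * frechet_derivative F (at (\<phi> p)) i" for i
    using p by (simp add: H_def cut_off_def Bp h(2))
  have "(\<lambda>q. (B q * B q) * f q) = (\<lambda>q. f p * (B q * B q) + (\<Sum>i\<in>Basis. X i q * H i q))"
  proof
    fix q
    show "(B q * B q) * f q = f p * (B q * B q) + (\<Sum>i\<in>Basis. X i q * H i q)"
    proof (cases "q \<in> U \<and> \<phi> q \<in> ball x0 R")
      case True
      have "f q = f p + (\<Sum>i\<in>Basis. ((\<phi> q - \<phi> p) \<bullet> i) * h i (\<phi> q))"
        using h(3)[of "\<phi> q"] True p by (simp add: F_def chart_inv[OF U])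
      then show ?thesis using True
        by (simp add: B_def X_def H_def cut_off_def algebra_simps sum_distrib_left)
    next
      case False
      then have "q \<in> U \<Longrightarrow> bump x0 r (\<phi> q) = 0" using bump_eq_0[OF R(2), of "\<phi> q" x0] R(3) by auto
      then show ?thesis by (auto simp: B_def X_def H_def cut_off_def)
    qed
  qed
  then have "\<delta> (\<lambda>q. (B q * B q) * f q) = \<delta> (\<lambda>q. f p * (B q * B q) + (\<Sum>i\<in>Basis. X i q * H i q))"
    by simp
  moreover have "\<delta> (\<lambda>q. (B q * B q) * f q) = \<delta> (\<lambda>q. B q * B q) * f p + B p * B p * \<delta> f"
    by (rule pd_mult[OF BB f])
  moreover have "\<delta> (\<lambda>q. f p * (B q * B q) + (\<Sum>i\<in>Basis. X i q * H i q))
      = f p * \<delta> (\<lambda>q. B q * B q) + (\<Sum>i\<in>Basis. \<delta> (\<lambda>q. X i q * H i q))"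
    by (simp only: pd_add[OF smooth_funs_cmult[OF BB] smooth_funs_sum[OF smooth_funs_mult[OF X H]]]
        pd_cmult[OF BB] pd_sum[OF finite_Basis smooth_funs_mult[OF X H]])
  moreover have "(\<Sum>i\<in>Basis. \<delta> (\<lambda>q. X i q * H i q))
      = B p * (\<Sum>i\<in>Basis. \<delta> (X i) * frechet_derivative F (at (\<phi> p)) i)"
    by (simp add: pd_mult[OF X H] Xp Hp sum_distrib_left mult.left_commute)
  ultimately have "B p * (B p * \<delta> f) = B p * (\<Sum>i\<in>Basis. \<delta> (X i) * frechet_derivative F (at (\<phi> p)) i)"
    by (simp add: algebra_simps)
  moreover have "B p \<noteq> 0" using bump_pos[OF p(2)] by (simp add: Bp)
  ultimately have "B p * \<delta> f = (\<Sum>i\<in>Basis. \<delta> (X i) * frechet_derivative F (at (\<phi> p)) i)" by simp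
  then show ?thesis by (simp add: Bp X_def F_def[abs_def])
qed

end

lemma
  assumes "X \<in> vector_fields G"
  shows vf_smooth: "f \<in> smooth_funs G \<Longrightarrow> X f \<in> smooth_funs G"
    and vf_nonsmooth: "f \<notin> smooth_funs G \<Longrightarrow> X f = (\<lambda>p. 0)"
    and vf_add: "f \<in> smooth_funs G \<Longrightarrow> h \<in> smooth_funs G \<Longrightarrow> X (\<lambda>p. f p + h p) = (\<lambda>p. X f p + X h p)"
    and vf_cmult: "f \<in> smooth_funs G \<Longrightarrow> X (\<lambda>p. k * f p) = (\<lambda>p. k * X f p)"
    and vf_mult: "f \<in> smooth_funs G \<Longrightarrow> h \<in> smooth_funs G \<Longrightarrow>
      X (\<lambda>p. f p * h p) = (\<lambda>p. X f p * h p + f p * X h p)"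
  using assms unfolding vector_fields_def by blast+

lemma vf_point_derivation: "X \<in> vector_fields G \<Longrightarrow> point_derivation p (\<lambda>f. X f p)"
  by (auto simp: point_derivation_def vf_add vf_cmult vf_mult)

lemma vf_sum:
  assumes "X \<in> vector_fields G" "finite I" "\<And>i. i \<in> I \<Longrightarrow> f i \<in> smooth_funs G"
  shows "X (\<lambda>q. \<Sum>i\<in>I. f i q) p = (\<Sum>i\<in>I. X (f i) p)"
  by (rule pd_sum[OF vf_point_derivation[OF assms(1)] assms(2,3)])

lemma vf_const:
  assumes "X \<in> vector_fields G" shows "X (\<lambda>q. k) = (\<lambda>p. 0)"
proof
  fix p
  have one: "(\<lambda>q. 1) \<in> smooth_funs G" by (rule smooth_funs_const)
  have "X (\<lambda>q. 1 * 1) p = X (\<lambda>q. 1) p * 1 + 1 * X (\<lambda>q. 1) p"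
    by (simp only: vf_mult[OF assms one one])
  then have "X (\<lambda>q. 1) p = 0" by simp
  then show "X (\<lambda>q. k) p = 0" using vf_cmult[OF assms one, of k] by simp
qed

lemma vector_fieldsI:
  assumes "\<And>f. f \<in> smooth_funs G \<Longrightarrow> X f \<in> smooth_funs G"
    and "\<And>f. f \<notin> smooth_funs G \<Longrightarrow> X f = (\<lambda>p. 0)"
    and "\<And>p. point_derivation p (\<lambda>f. X f p)"
  shows "X \<in> vector_fields G"
  using assms by (auto simp: vector_fields_def point_derivation_def)

end

section \<open>The left invariant frame of a Lie group\<close>

lemma frechet_derivative_snd:
  fixes F :: "'e::euclidean_space \<times> 'f::euclidean_space \<Rightarrow> real"
  assumes "smooth_on S F" "(x, y) \<in> S"
  shows "frechet_derivative (\<lambda>y. F (x, y)) (at y) v = frechet_derivative F (at (x, y)) (0, v)"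
proof -
  have p: "((\<lambda>y. (x, y)) has_derivative (\<lambda>v. (0, v))) (at y)"
    by (auto intro!: derivative_eq_intros)
  have "((\<lambda>y. F (x, y)) has_derivative (\<lambda>v. frechet_derivative F (at (x, y)) (0, v))) (at y)"
    by (rule has_derivative_compose[OF p smooth_on_has_derivative[OF assms]])
  then show ?thesis by (simp add: frechet_derivative_eqI)
qed

locale lie_grp =
  fixes G :: "('a::{t2_space,second_countable_topology}, 'e::euclidean_space) lie_data"
  assumes lie: "lie_group G"
begin

sublocale manifold G
  using lie by unfold_locales (simp add: lie_group_def)

sublocale grp: group "gmult G" "gone G" "ginv G"
  using lie by (simp add: lie_group_def)

lemma mult_inv_cancel [simp]:
  "gmult G a (gmult G (ginv G a) p) = p" "gmult G (ginv G a) (gmult G a p) = p"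
  by (simp_all flip: grp.assoc)

lemma inv_mult: "gmult G (ginv G (gmult G a p)) (gmult G a q) = gmult G (ginv G p) q"
proof -
  have "gmult G p (gmult G (ginv G (gmult G a p)) (gmult G a q)) = q"
  proof -
    have "gmult G a (gmult G p (gmult G (ginv G (gmult G a p)) (gmult G a q))) = gmult G a q"
      by (simp flip: grp.assoc[of a p])
    then show ?thesis by (metis mult_inv_cancel(2))
  qed
  then show ?thesis by (metis mult_inv_cancel(2))
qed

text \<open>Smoothness on the product of the group with itself. It is needed for \<open>f(p q)\<close> and
  \<open>f(p\<^sup>-\<^sup>1 q)\<close>, from which the left invariant frame and the coefficients in it are made.\<close>

definition smooth2 :: "('a \<Rightarrow> 'a \<Rightarrow> real) \<Rightarrow> bool" where
  "smooth2 F \<longleftrightarrow> (\<forall>U \<phi> V \<psi>. (U, \<phi>) \<in> atlas G \<longrightarrow> (V, \<psi>) \<in> atlas G \<longrightarrow>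
     smooth_on (\<phi> ` U \<times> \<psi> ` V) (\<lambda>z. F (inv_into U \<phi> (fst z)) (inv_into V \<psi> (snd z))))"

lemma smooth2D:
  "smooth2 F \<Longrightarrow> (U, \<phi>) \<in> atlas G \<Longrightarrow> (V, \<psi>) \<in> atlas G \<Longrightarrow>
     smooth_on (\<phi> ` U \<times> \<psi> ` V) (\<lambda>z. F (inv_into U \<phi> (fst z)) (inv_into V \<psi> (snd z)))"
  by (simp add: smooth2_def)

lemma smooth2_mult:
  assumes f: "f \<in> smooth_funs G"
  shows "smooth2 (\<lambda>p q. f (gmult G p q))"
  unfolding smooth2_def
proof (intro allI impI)
  fix U \<phi> V \<psi> assume U: "(U, \<phi>) \<in> atlas G" and V: "(V, \<psi>) \<in> atlas G"
  let ?M = "\<lambda>(a, b). gmult G a b"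
  let ?A = "prod_atlas (atlas G) (atlas G)"
  have sm: "smooth_map ?A (atlas G) ?M" using lie by (simp add: lie_group_def)
  then have contM: "continuous_on UNIV ?M" by (simp add: smooth_map_def)
  define g where "g z = gmult G (inv_into U \<phi> (fst z)) (inv_into V \<psi> (snd z))" for z
  have contg: "continuous_on (\<phi> ` U \<times> \<psi> ` V) g"
  proof -
    have "continuous_on (\<phi> ` U \<times> \<psi> ` V) (\<lambda>z. (inv_into U \<phi> (fst z), inv_into V \<psi> (snd z)))"
      by (intro continuous_on_Pair continuous_on_compose2[OF chart_inv_continuous[OF U]]
          continuous_on_compose2[OF chart_inv_continuous[OF V]] continuous_on_fst continuous_on_snd
          continuous_on_id) auto
    from continuous_on_compose2[OF contM this] show ?thesis by (simp add: g_def[abs_def])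
  qed
  show "smooth_on (\<phi> ` U \<times> \<psi> ` V) (\<lambda>z. f (gmult G (inv_into U \<phi> (fst z)) (inv_into V \<psi> (snd z))))"
  proof (rule smooth_on_local)
    fix z assume z: "z \<in> \<phi> ` U \<times> \<psi> ` V"
    obtain W \<theta> where W: "(W, \<theta>) \<in> atlas G" "g z \<in> W" by (rule chart_at)
    define T where "T = (\<phi> ` U \<times> \<psi> ` V) \<inter> g -` W"
    have T: "open T" unfolding T_def
      by (rule continuous_open_preimage[OF contg])
        (auto intro: open_Times chart_open_image[OF U] chart_open_image[OF V] chart_open[OF W(1)])
    have "(U \<times> V, map_prod \<phi> \<psi>) \<in> ?A" using U V by (auto simp: prod_atlas_def)
    then have s: "smooth_on (map_prod \<phi> \<psi> ` ((U \<times> V) \<inter> ?M -` W)) (\<theta> \<circ> ?M \<circ> inv_into (U \<times> V) (map_prod \<phi> \<psi>))"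
      using sm W(1) unfolding smooth_map_def by blast
    have inv: "inv_into (U \<times> V) (map_prod \<phi> \<psi>) (\<phi> a, \<psi> b) = (a, b)" if "a \<in> U" "b \<in> V" for a b
    proof -
      have "inv_into (U \<times> V) (map_prod \<phi> \<psi>) (map_prod \<phi> \<psi> (a, b)) = (a, b)"
        by (rule inv_into_f_f)
          (use that chart_inj[OF U] chart_inj[OF V] in \<open>auto intro: map_prod_inj_on\<close>)
      then show ?thesis by simp
    qed
    have sub: "T \<subseteq> map_prod \<phi> \<psi> ` ((U \<times> V) \<inter> ?M -` W)"
      by (force simp: T_def g_def chart_inv[OF U] chart_inv[OF V])
    have s: "smooth_on T (\<lambda>z. \<theta> (g z))"
      by (rule smooth_on_cong[OF T smooth_on_subset[OF s sub]])
        (auto simp: T_def g_def inv chart_inv[OF U] chart_inv[OF V])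
    have "smooth_on T (\<lambda>z. f (inv_into W \<theta> (\<theta> (g z))))"
      by (rule smooth_on_compose[OF s smooth_funs_chart[OF f W(1)] T chart_open_image[OF W(1)]])
        (auto simp: T_def)
    then have "smooth_on T (\<lambda>z. f (g z))"
      by (rule smooth_on_cong[OF T]) (auto simp: T_def chart_inv[OF W(1)])
    then show "\<exists>T. open T \<and> z \<in> T \<and>
        smooth_on T (\<lambda>z. f (gmult G (inv_into U \<phi> (fst z)) (inv_into V \<psi> (snd z))))"
      using T z W(2) by (auto simp: T_def g_def)
  qed
qed

lemma smooth2_inv:
  assumes F: "smooth2 F"
  shows "smooth2 (\<lambda>p q. F (ginv G p) q)"
  unfolding smooth2_def
proof (intro allI impI, rule smooth_on_local)
  fix U \<phi> V \<psi> z assume U: "(U, \<phi>) \<in> atlas G" and V: "(V, \<psi>) \<in> atlas G"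
    and z: "z \<in> \<phi> ` U \<times> \<psi> ` V"
  have sm: "smooth_map (atlas G) (atlas G) (ginv G)" using lie by (simp add: lie_group_def)
  then have cont: "continuous_on UNIV (ginv G)" by (simp add: smooth_map_def)
  obtain p where p: "p \<in> U" "fst z = \<phi> p" using z by auto
  obtain W \<theta> where W: "(W, \<theta>) \<in> atlas G" "ginv G p \<in> W" by (rule chart_at)
  define T where "T = \<phi> ` (U \<inter> ginv G -` W)"
  have T: "open T" unfolding T_def
    by (intro chart_image_open[OF U] open_vimage[OF chart_open[OF W(1)] cont])
  have TV: "open (T \<times> \<psi> ` V)" by (intro open_Times T chart_open_image[OF V])
  have WV: "open (\<theta> ` W \<times> \<psi> ` V)" by (intro open_Times chart_open_image[OF W(1)] chart_open_image[OF V])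
  have "smooth_on T (\<theta> \<circ> ginv G \<circ> inv_into U \<phi>)"
    using sm U W(1) unfolding smooth_map_def T_def by blast
  then have s1: "smooth_on T (\<lambda>x. \<theta> (ginv G (inv_into U \<phi> x)))" by (simp add: o_def)
  have s2: "smooth_on (T \<times> \<psi> ` V) (\<lambda>z. \<theta> (ginv G (inv_into U \<phi> (fst z))))"
    by (rule smooth_on_compose[OF smooth_on_bounded_linear[OF TV bounded_linear_fst] s1 TV T]) auto
  have "smooth_on (T \<times> \<psi> ` V) (\<lambda>z. (\<theta> (ginv G (inv_into U \<phi> (fst z))), snd z))"
    by (intro smooth_on_Pair s2 smooth_on_bounded_linear TV bounded_linear_snd)
  moreover have "(\<lambda>z. (\<theta> (ginv G (inv_into U \<phi> (fst z))), snd z)) ` (T \<times> \<psi> ` V) \<subseteq> \<theta> ` W \<times> \<psi> ` V"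
    by (auto simp: T_def chart_inv[OF U])
  ultimately have "smooth_on (T \<times> \<psi> ` V) (\<lambda>z. F (inv_into W \<theta> (fst (\<theta> (ginv G (inv_into U \<phi> (fst z))), snd z)))
      (inv_into V \<psi> (snd (\<theta> (ginv G (inv_into U \<phi> (fst z))), snd z))))"
    by (intro smooth_on_compose[OF _ smooth2D[OF F W(1) V] TV WV])
  then have "smooth_on (T \<times> \<psi> ` V)
      (\<lambda>z. F (inv_into W \<theta> (\<theta> (ginv G (inv_into U \<phi> (fst z))))) (inv_into V \<psi> (snd z)))"
    by simp
  then have "smooth_on (T \<times> \<psi> ` V) (\<lambda>z. F (ginv G (inv_into U \<phi> (fst z))) (inv_into V \<psi> (snd z)))"
    by (rule smooth_on_cong[OF TV]) (auto simp: T_def chart_inv[OF U] chart_inv[OF W(1)])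
  then show "\<exists>T. open T \<and> z \<in> T \<and>
      smooth_on T (\<lambda>z. F (ginv G (inv_into U \<phi> (fst z))) (inv_into V \<psi> (snd z)))"
    using TV z p W(2) by (intro exI[of _ "T \<times> \<psi> ` V"]) (auto simp: T_def)
qed

lemma smooth2_section:
  assumes F: "smooth2 F"
  shows "F a \<in> smooth_funs G"
proof (rule smooth_funsI)
  fix V \<psi> assume V: "(V, \<psi>) \<in> atlas G"
  obtain U \<phi> where U: "(U, \<phi>) \<in> atlas G" "a \<in> U" by (rule chart_at)
  have o: "open (\<psi> ` V)" "open (\<phi> ` U \<times> \<psi> ` V)"
    by (auto intro: open_Times chart_open_image U V)
  have "smooth_on (\<psi> ` V) (\<lambda>y. (\<phi> a, y))"
    by (intro smooth_on_Pair smooth_on_const smooth_on_bounded_linear bounded_linear_ident o)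
  from smooth_on_compose[OF this smooth2D[OF F U(1) V] o]
  show "smooth_on (\<psi> ` V) (\<lambda>x. F a (inv_into V \<psi> x))"
    using U by (auto simp: chart_inv[OF U(1)])
qed

lemma smooth2_partial:
  assumes F: "smooth2 F" and V: "(V, \<psi>) \<in> atlas G" "q \<in> V"
  shows "(\<lambda>p. frechet_derivative (\<lambda>y. F p (inv_into V \<psi> y)) (at (\<psi> q)) v) \<in> smooth_funs G"
proof (rule smooth_funsI)
  fix U \<phi> assume U: "(U, \<phi>) \<in> atlas G"
  define F' where "F' = (\<lambda>z. F (inv_into U \<phi> (fst z)) (inv_into V \<psi> (snd z)))"
  have F': "smooth_on (\<phi> ` U \<times> \<psi> ` V) F'" unfolding F'_def by (rule smooth2D[OF F U V(1)])
  have o: "open (\<phi> ` U)" "open (\<phi> ` U \<times> \<psi> ` V)"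
    by (auto intro: open_Times chart_open_image U V)
  have "smooth_on (\<phi> ` U) (\<lambda>x. (x, \<psi> q))"
    by (intro smooth_on_Pair smooth_on_const smooth_on_bounded_linear bounded_linear_ident o)
  from smooth_on_compose[OF this smooth_on_frechet_derivative[OF F'] o]
  have "smooth_on (\<phi> ` U) (\<lambda>x. frechet_derivative F' (at (x, \<psi> q)) (0, v))" using V by auto
  then show "smooth_on (\<phi> ` U) (\<lambda>x. frechet_derivative (\<lambda>y. F (inv_into U \<phi> x) (inv_into V \<psi> y)) (at (\<psi> q)) v)"
  proof (rule smooth_on_cong[OF o(1)])
    fix x assume "x \<in> \<phi> ` U"
    then have "(x, \<psi> q) \<in> \<phi> ` U \<times> \<psi> ` V" using V by auto
    from frechet_derivative_snd[OF F' this]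
    show "frechet_derivative F' (at (x, \<psi> q)) (0, v)
        = frechet_derivative (\<lambda>y. F (inv_into U \<phi> x) (inv_into V \<psi> y)) (at (\<psi> q)) v"
      by (simp add: F'_def)
  qed
qed

text \<open>In a chart, the coefficients of \<open>X\<close> near a point are quotients of \<open>X\<close> applied to fixed
  cut-off coordinate functions by a positive function; this makes the diagonal smooth.\<close>

lemma smooth2_diagonal:
  assumes F: "smooth2 F" and X: "X \<in> vector_fields G"
  shows "(\<lambda>p. X (F p) p) \<in> smooth_funs G"
proof (rule smooth_funs_localI)
  fix p0
  obtain U \<phi> where U: "(U, \<phi>) \<in> atlas G" "p0 \<in> U" by (rule chart_at)
  obtain R where R: "0 < R" "ball (\<phi> p0) R \<subseteq> \<phi> ` U"
    using chart_open_image[OF U(1)] U(2) openE by blast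
  define r where "r = R / 2"
  have r: "0 < r" "r < R" using R by (auto simp: r_def)
  define x0 where "x0 = \<phi> p0"
  define W where "W = U \<inter> \<phi> -` ball x0 r"
  have W: "open W" unfolding W_def by (rule chart_preimage_open[OF U(1) open_ball])
  have br: "ball x0 r \<subseteq> \<phi> ` U"
    using R r subset_ball[of r R x0] by (auto simp: x0_def)
  then have im: "\<phi> ` W = ball x0 r" by (auto simp: W_def)
  define F' where "F' = (\<lambda>z. F (inv_into U \<phi> (fst z)) (inv_into U \<phi> (snd z)))"
  have F': "smooth_on (\<phi> ` U \<times> \<phi> ` U) F'" unfolding F'_def by (rule smooth2D[OF F U(1) U(1)])
  have oU: "open (\<phi> ` U \<times> \<phi> ` U)" by (intro open_Times chart_open_image U)
  note co = cut_off_smooth[OF U(1) open_ball, of "x0" R x0 r, folded x0_def]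
  have ball: "ball x0 R \<subseteq> \<phi> ` U" "cball x0 r \<subseteq> ball x0 R" using R r by (auto simp: x0_def)
  define Y where "Y i = X (cut_off U \<phi> x0 r (\<lambda>x. x \<bullet> i))" for i
  define Z where "Z = X (cut_off U \<phi> x0 r (\<lambda>x. 1))"
  have c1: "cut_off U \<phi> x0 r (\<lambda>x. x \<bullet> i) \<in> smooth_funs G" for i
    by (intro co ball r smooth_on_bounded_linear bounded_linear_inner_left open_ball)
  have c2: "cut_off U \<phi> x0 r (\<lambda>x. 1) \<in> smooth_funs G"
    by (intro co ball r smooth_on_const)
  have YZ: "Y i \<in> smooth_funs G" "Z \<in> smooth_funs G" for i
    unfolding Y_def Z_def by (intro vf_smooth[OF X] c1 c2)+
  have eq: "X (F p) p = inverse (bump x0 r (\<phi> p)) *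
      (\<Sum>i\<in>Basis. (Y i p + (- (\<phi> p \<bullet> i)) * Z p) * frechet_derivative F' (at (\<phi> p, \<phi> p)) (0, i))"
    if p: "p \<in> U" "\<phi> p \<in> ball x0 r" for p
  proof -
    have "bump x0 r (\<phi> p) * X (F p) p =
      (\<Sum>i\<in>Basis. X (cut_off U \<phi> x0 r (\<lambda>x. (x - \<phi> p) \<bullet> i)) p *
         frechet_derivative (\<lambda>x. F p (inv_into U \<phi> x)) (at (\<phi> p)) i)"
      by (rule point_derivation_chart[OF vf_point_derivation[OF X] U(1) ball(1) r p smooth2_section[OF F]])
    also have "\<dots> = (\<Sum>i\<in>Basis. (Y i p + (- (\<phi> p \<bullet> i)) * Z p) * frechet_derivative F' (at (\<phi> p, \<phi> p)) (0, i))"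
    proof (intro sum.cong refl arg_cong2[of _ _ _ _ "(*)"])
      fix i
      have "cut_off U \<phi> x0 r (\<lambda>x. (x - \<phi> p) \<bullet> i)
          = (\<lambda>q. cut_off U \<phi> x0 r (\<lambda>x. x \<bullet> i) q + (- (\<phi> p \<bullet> i)) * cut_off U \<phi> x0 r (\<lambda>x. 1) q)"
        by (auto simp: cut_off_def inner_diff_left algebra_simps)
      then show "X (cut_off U \<phi> x0 r (\<lambda>x. (x - \<phi> p) \<bullet> i)) p = Y i p + (- (\<phi> p \<bullet> i)) * Z p"
        by (simp only: Y_def Z_def vf_add[OF X c1 smooth_funs_cmult[OF c2]] vf_cmult[OF X c2])
      have "(\<phi> p, \<phi> p) \<in> \<phi> ` U \<times> \<phi> ` U" using p by auto
      from frechet_derivative_snd[OF F' this]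
      show "frechet_derivative (\<lambda>x. F p (inv_into U \<phi> x)) (at (\<phi> p)) i
          = frechet_derivative F' (at (\<phi> p, \<phi> p)) (0, i)"
        using p by (simp add: F'_def chart_inv[OF U(1)])
    qed
    finally show ?thesis using bump_pos[OF p(2)] by (simp add: field_simps)
  qed
  have "smooth_on (ball x0 r) (\<lambda>x. inverse (bump x0 r x) *
      (\<Sum>i\<in>Basis. (Y i (inv_into U \<phi> x) + (- (x \<bullet> i)) * Z (inv_into U \<phi> x)) *
         frechet_derivative F' (at (x, x)) (0, i)))"
  proof (intro smooth_on_mult smooth_on_sum smooth_on_add open_ball)
    show "smooth_on (ball x0 r) (\<lambda>x. inverse (bump x0 r x))"
      by (rule smooth_on_compose[OF smooth_on_subset[OF smooth_on_bump] smooth_on_inverse])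
        (use bump_pos[of _ x0 r] in \<open>force simp: open_Collect_neq\<close>)+
    show "smooth_on (ball x0 r) (\<lambda>x. Y i (inv_into U \<phi> x))"
         "smooth_on (ball x0 r) (\<lambda>x. Z (inv_into U \<phi> x))" for i
      by (intro smooth_on_subset[OF smooth_funs_chart br] YZ U)+
    show "smooth_on (ball x0 r) (\<lambda>x. - (x \<bullet> i))" for i
      by (intro smooth_on_bounded_linear bounded_linear_minus bounded_linear_inner_left open_ball)
    have "smooth_on (ball x0 r) (\<lambda>x. (x, x))"
      by (intro smooth_on_Pair smooth_on_bounded_linear bounded_linear_ident open_ball)
    from smooth_on_compose[OF this smooth_on_frechet_derivative[OF F'] open_ball oU]
    show "smooth_on (ball x0 r) (\<lambda>x. frechet_derivative F' (at (x, x)) (0, i))" for i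
      using br by auto
  qed
  then have "smooth_on (ball x0 r) (\<lambda>x. X (F (inv_into U \<phi> x)) (inv_into U \<phi> x))"
  proof (rule smooth_on_cong[OF open_ball])
    fix x assume x: "x \<in> ball x0 r"
    then obtain p where "p \<in> U" "x = \<phi> p" using br by blast
    then show "inverse (bump x0 r x) *
      (\<Sum>i\<in>Basis. (Y i (inv_into U \<phi> x) + (- (x \<bullet> i)) * Z (inv_into U \<phi> x)) *
         frechet_derivative F' (at (x, x)) (0, i)) = X (F (inv_into U \<phi> x)) (inv_into U \<phi> x)"
      using eq[of p] x by (simp add: chart_inv[OF U(1)])
  qed
  then show "\<exists>U \<phi> W. (U, \<phi>) \<in> atlas G \<and> open W \<and> p0 \<in> W \<and> W \<subseteq> U \<and>
      smooth_on (\<phi> ` W) (\<lambda>x. X (F (inv_into U \<phi> x)) (inv_into U \<phi> x))"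
    using U W r by (intro exI[of _ U] exI[of _ \<phi>] exI[of _ W]) (simp add: im, simp add: W_def x0_def)
qed

lemma smooth_funs_translate:
  "f \<in> smooth_funs G \<Longrightarrow> (\<lambda>q. f (gmult G a q)) \<in> smooth_funs G"
  by (rule smooth2_section[OF smooth2_mult])

lemma smooth_funs_translate_iff:
  "(\<lambda>q. f (gmult G a q)) \<in> smooth_funs G \<longleftrightarrow> f \<in> smooth_funs G"
  using smooth_funs_translate[of "\<lambda>q. f (gmult G a q)" "ginv G a"] smooth_funs_translate by auto

lemma push_lie_bracket:
  "push G a (lie_bracket X Y) = lie_bracket (push G a X) (push G a Y)"
  by (simp add: push_def lie_bracket_def)

lemma lie_bracket_in_vector_fields:
  assumes X: "X \<in> vector_fields G" and Y: "Y \<in> vector_fields G"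
  shows "lie_bracket X Y \<in> vector_fields G"
proof (rule vector_fieldsI)
  show "lie_bracket X Y f \<in> smooth_funs G" if "f \<in> smooth_funs G" for f
    unfolding lie_bracket_def by (intro smooth_funs_diff vf_smooth[OF X] vf_smooth[OF Y] that)
  show "lie_bracket X Y f = (\<lambda>p. 0)" if "f \<notin> smooth_funs G" for f
    using that by (simp add: lie_bracket_def vf_nonsmooth[OF X] vf_nonsmooth[OF Y] vf_const[OF X] vf_const[OF Y])
  note s = vf_smooth[OF X] vf_smooth[OF Y]
  note r = vf_add[OF X] vf_add[OF Y] vf_cmult[OF X] vf_cmult[OF Y] vf_mult[OF X] vf_mult[OF Y]
  show "point_derivation p (\<lambda>f. lie_bracket X Y f p)" for p
    unfolding point_derivation_def lie_bracket_def
    by (auto simp: r s smooth_funs_mult algebra_simps)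
qed

end

text \<open>The interface between the geometry and the linear algebra: \<open>L v\<close> is the left invariant
  field whose value at the identity is \<open>v\<close>, \<open>c X p\<close> is the value of \<open>X\<close> at \<open>p\<close> in the frame
  formed by these fields, and \<open>br\<close> is the bracket of the Lie algebra, transported to \<open>'e\<close>.\<close>

locale left_invariant_frame = lie_grp G
  for G :: "('a::{t2_space,second_countable_topology}, 'e::euclidean_space) lie_data" +
  fixes L :: "'e \<Rightarrow> 'a vf" and c :: "'a vf \<Rightarrow> 'a \<Rightarrow> 'e" and br :: "'e \<Rightarrow> 'e \<Rightarrow> 'e"
  assumes L_add: "L (v + w) = vplus (L v) (L w)"
    and L_scale: "L (k *\<^sub>R v) = vscale (\<lambda>p. k) (L v)"
    and L_left_invariant: "L v \<in> lie_algebra G"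
    and c_smooth: "X \<in> vector_fields G \<Longrightarrow> (\<lambda>p. c X p \<bullet> b) \<in> smooth_funs G"
    and combine: "(\<And>b. (\<lambda>p. u p \<bullet> b) \<in> smooth_funs G) \<Longrightarrow> (\<lambda>f p. L (u p) f p) \<in> vector_fields G"
    and c_combine: "(\<And>b. (\<lambda>p. u p \<bullet> b) \<in> smooth_funs G) \<Longrightarrow> c (\<lambda>f p. L (u p) f p) p = u p"
    and expand: "X \<in> vector_fields G \<Longrightarrow> X f p = L (c X p) f p"
    and c_push: "X \<in> vector_fields G \<Longrightarrow> c (push G a X) (gmult G a p) = c X p"
    and bracket: "lie_bracket (L v) (L w) = L (br v w)"

locale lie_grp_chart = lie_grp G
  for G :: "('a::{t2_space,second_countable_topology}, 'e::euclidean_space) lie_data" +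
  fixes U0 \<phi>0 R
  assumes chart0: "(U0, \<phi>0) \<in> atlas G" "gone G \<in> U0"
    and R: "0 < R" "ball (\<phi>0 (gone G)) R \<subseteq> \<phi>0 ` U0"
begin

definition x0 where "x0 = \<phi>0 (gone G)"

definition frame :: "'e \<Rightarrow> 'a vf" where
  "frame v = (\<lambda>f p. if f \<in> smooth_funs G
     then frechet_derivative (\<lambda>x. f (gmult G p (inv_into U0 \<phi>0 x))) (at x0) v else 0)"

text \<open>Cut-off coordinate functions, normalized so that their derivatives at \<open>x0\<close> are dual to
  the basis.\<close>

definition coord :: "'e \<Rightarrow> 'a \<Rightarrow> real" where
  "coord b = cut_off U0 \<phi>0 x0 (R / 2) (\<lambda>x. inverse (bump x0 (R / 2) x0) * ((x - x0) \<bullet> b))"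

definition coeff :: "'a vf \<Rightarrow> 'a \<Rightarrow> 'e" where
  "coeff X p = (\<Sum>b\<in>Basis. X (\<lambda>q. coord b (gmult G (ginv G p) q)) p *\<^sub>R b)"

lemma R2: "0 < R / 2" "R / 2 < R" "ball x0 R \<subseteq> \<phi>0 ` U0" "cball x0 (R / 2) \<subseteq> ball x0 R"
    "x0 \<in> ball x0 (R / 2)" "x0 \<in> \<phi>0 ` U0" "\<phi>0 (gone G) \<in> ball x0 (R / 2)"
  using R chart0 by (auto simp: x0_def)

lemma bump0: "bump x0 (R / 2) x0 \<noteq> 0"
  using bump_pos[OF R2(5)] by simp

lemma smooth_on_affine: "smooth_on (ball x0 R) (\<lambda>x. (x - x0) \<bullet> b)"
proof -
  have "smooth_on (ball x0 R) (\<lambda>x. x \<bullet> b + - (x0 \<bullet> b))"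
    by (intro smooth_on_add smooth_on_const smooth_on_bounded_linear bounded_linear_inner_left open_ball)
  then show ?thesis by (simp add: inner_diff_left)
qed

lemma coord_smooth: "coord b \<in> smooth_funs G"
  unfolding coord_def
  by (intro cut_off_smooth[OF chart0(1) open_ball R2(3,4,1)] smooth_on_mult smooth_on_const
      smooth_on_affine open_ball)

lemma frame_has_derivative:
  assumes "f \<in> smooth_funs G"
  shows "((\<lambda>x. f (gmult G p (inv_into U0 \<phi>0 x))) has_derivative (\<lambda>v. frame v f p)) (at x0)"
  using smooth_on_has_derivative[OF smooth_funs_chart[OF smooth_funs_translate[OF assms] chart0(1)] R2(6)] assms
  by (simp add: frame_def)

lemma frame_eqI:
  assumes "f \<in> smooth_funs G"
    and "((\<lambda>x. f (gmult G p (inv_into U0 \<phi>0 x))) has_derivative D) (at x0)"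
  shows "frame v f p = D v"
  using assms by (simp add: frame_def frechet_derivative_eqI)

lemma frame_linear: "linear (\<lambda>v. frame v f p)"
proof (cases "f \<in> smooth_funs G")
  case True
  then show ?thesis
    using frame_has_derivative bounded_linear.linear has_derivative_bounded_linear by blast
qed (simp add: frame_def linear_iff)

lemma frame_nonsmooth: "f \<notin> smooth_funs G \<Longrightarrow> frame v f p = 0"
  by (simp add: frame_def)

lemma frame_smooth: "f \<in> smooth_funs G \<Longrightarrow> frame v f \<in> smooth_funs G"
  using smooth2_partial[OF smooth2_mult chart0, of f v] by (simp add: frame_def x0_def)

lemma frame_point_derivation: "point_derivation p (\<lambda>f. frame v f p)"
  unfolding point_derivation_def
proof (intro conjI ballI allI)
  fix f h assume f: "f \<in> smooth_funs G" and h: "h \<in> smooth_funs G"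
  note d = frame_has_derivative[OF f, of p] frame_has_derivative[OF h, of p]
  show "frame v (\<lambda>q. f q + h q) p = frame v f p + frame v h p"
    by (rule frame_eqI[OF smooth_funs_add[OF f h] has_derivative_add[OF d]])
  have e: "gmult G p (inv_into U0 \<phi>0 x0) = p"
    using chart0 by (simp add: x0_def chart_inv)
  show "frame v (\<lambda>q. f q * h q) p = frame v f p * h p + f p * frame v h p"
    using frame_eqI[OF smooth_funs_mult[OF f h] has_derivative_mult[OF d], of v]
    by (simp add: e add.commute)
next
  fix k f assume f: "f \<in> smooth_funs G"
  show "frame v (\<lambda>q. k * f q) p = k * frame v f p"
    by (rule frame_eqI[OF smooth_funs_cmult[OF f] has_derivative_mult_right[OF frame_has_derivative[OF f]]])
qed

lemma frame_expand: "frame v f p = (\<Sum>b\<in>Basis. (v \<bullet> b) * frame b f p)"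
proof -
  have "frame (\<Sum>b\<in>Basis. (v \<bullet> b) *\<^sub>R b) f p = (\<Sum>b\<in>Basis. (v \<bullet> b) * frame b f p)"
    by (simp only: linear_sum[OF frame_linear] linear_scale[OF frame_linear] real_scaleR_def)
  then show ?thesis by (simp only: euclidean_representation)
qed

lemma frame_combine:
  assumes "\<And>b. (\<lambda>p. u p \<bullet> b) \<in> smooth_funs G"
  shows "(\<lambda>f p. frame (u p) f p) \<in> vector_fields G"
proof (rule vector_fieldsI)
  show "(\<lambda>p. frame (u p) f p) \<in> smooth_funs G" if "f \<in> smooth_funs G" for f
    by (subst frame_expand) (intro smooth_funs_sum smooth_funs_mult assms frame_smooth that)
qed (auto simp: frame_nonsmooth frame_point_derivation)

lemma frame_vector_field: "frame v \<in> vector_fields G"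
  using frame_combine[of "\<lambda>p. v"] smooth_funs_const by simp

lemma frame_push: "push G a (frame v) = frame v"
  by (auto simp: fun_eq_iff push_def frame_def smooth_funs_translate_iff grp.assoc)

lemma coeff_component: "b \<in> Basis \<Longrightarrow> coeff X p \<bullet> b = X (\<lambda>q. coord b (gmult G (ginv G p) q)) p"
  by (simp add: coeff_def inner_sum_left inner_Basis if_distrib cong: if_cong)

lemma coeff_smooth:
  assumes X: "X \<in> vector_fields G"
  shows "(\<lambda>p. coeff X p \<bullet> b) \<in> smooth_funs G"
  unfolding coeff_def inner_sum_left inner_scaleR_left
  by (intro smooth_funs_sum smooth_funs_mult smooth_funs_const
      smooth2_diagonal[OF smooth2_inv[OF smooth2_mult] X] coord_smooth)

text \<open>Translating a field at \<open>p\<close> to the identity reduces the expansion in the frame to the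
  coordinate expression of a derivation at the identity.\<close>

lemma frame_coeff:
  assumes X: "X \<in> vector_fields G"
  shows "X f p = frame (coeff X p) f p"
proof (cases "f \<in> smooth_funs G")
  case False
  then show ?thesis by (simp add: vf_nonsmooth[OF X] frame_nonsmooth)
next
  case True
  define \<delta> where "\<delta> h = X (\<lambda>q. h (gmult G (ginv G p) q)) p" for h
  have \<delta>: "point_derivation (gone G) \<delta>"
    unfolding point_derivation_def \<delta>_def
    by (auto simp: vf_add[OF X] vf_cmult[OF X] vf_mult[OF X] smooth_funs_translate)
  let ?fp = "\<lambda>q. f (gmult G p q)"
  let ?\<beta> = "bump x0 (R / 2) x0"
  have sm: "cut_off U0 \<phi>0 x0 (R / 2) (\<lambda>x. (x - x0) \<bullet> b) \<in> smooth_funs G" for b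
    by (intro cut_off_smooth[OF chart0(1) open_ball R2(3,4,1)] smooth_on_affine)
  have coord: "\<delta> (coord b) = inverse ?\<beta> * \<delta> (cut_off U0 \<phi>0 x0 (R / 2) (\<lambda>x. (x - x0) \<bullet> b))" for b
  proof -
    have "coord b = (\<lambda>q. inverse ?\<beta> * cut_off U0 \<phi>0 x0 (R / 2) (\<lambda>x. (x - x0) \<bullet> b) q)"
      by (auto simp: coord_def cut_off_def)
    then show ?thesis by (simp only: pd_cmult[OF \<delta> sm])
  qed
  have \<beta>: "?\<beta> * \<delta> ?fp = (\<Sum>b\<in>Basis. \<delta> (cut_off U0 \<phi>0 x0 (R / 2) (\<lambda>x. (x - x0) \<bullet> b)) * frame b f p)"
    using point_derivation_chart[OF \<delta> chart0(1) R2(3,1,2) chart0(2) R2(7) smooth_funs_translate[OF True], of p] True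
    by (simp add: frame_def flip: x0_def)
  have "X f p = \<delta> ?fp" by (simp add: \<delta>_def)
  also have "\<dots> = inverse ?\<beta> * (?\<beta> * \<delta> ?fp)" using bump0 by simp
  also have "\<dots> = (\<Sum>b\<in>Basis. \<delta> (coord b) * frame b f p)"
    by (simp only: \<beta> coord sum_distrib_left mult.assoc)
  also have "\<dots> = (\<Sum>b\<in>Basis. (coeff X p \<bullet> b) * frame b f p)"
    by (intro sum.cong refl) (simp add: coeff_component \<delta>_def)
  also have "\<dots> = frame (coeff X p) f p" by (rule frame_expand[symmetric])
  finally show ?thesis .
qed

text \<open>The factor \<open>x - x0\<close> vanishes at \<open>x0\<close>, so the derivative of the cut-off function drops out.\<close>

lemma frame_coord:
  "frame v (\<lambda>q. coord b (gmult G (ginv G p) q)) p = v \<bullet> b"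
proof -
  have "((\<lambda>x. bump x0 (R / 2) x * (inverse (bump x0 (R / 2) x0) * ((x - x0) \<bullet> b))) has_derivative
      (\<lambda>v. bump x0 (R / 2) x0 * (inverse (bump x0 (R / 2) x0) * (v \<bullet> b)) +
        frechet_derivative (bump x0 (R / 2)) (at x0) v * (inverse (bump x0 (R / 2) x0) * ((x0 - x0) \<bullet> b)))) (at x0)"
    by (intro has_derivative_mult smooth_on_has_derivative[OF smooth_on_bump] UNIV_I)
      (auto intro!: derivative_eq_intros)
  then have "((\<lambda>x. bump x0 (R / 2) x * (inverse (bump x0 (R / 2) x0) * ((x - x0) \<bullet> b))) has_derivative
      (\<lambda>v. v \<bullet> b)) (at x0)"
    using bump0 by (simp flip: mult.assoc)
  then have "((\<lambda>x. coord b (inv_into U0 \<phi>0 x)) has_derivative (\<lambda>v. v \<bullet> b)) (at x0)"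
    by (rule has_derivative_transform_within_open[OF _ chart_open_image[OF chart0(1)] R2(6)])
      (auto simp: coord_def cut_off_def chart_inv[OF chart0(1)])
  then have "((\<lambda>x. coord b (gmult G (ginv G p) (gmult G p (inv_into U0 \<phi>0 x)))) has_derivative (\<lambda>v. v \<bullet> b)) (at x0)"
    by simp
  from frame_eqI[OF smooth_funs_translate[OF coord_smooth] this] show ?thesis .
qed

lemma coeff_combine: "coeff (\<lambda>f p. frame (u p) f p) p = u p"
  by (simp add: coeff_def frame_coord euclidean_representation)

lemma coeff_push: "coeff (push G a X) (gmult G a p) = coeff X p"
  by (simp add: coeff_def push_def inv_mult)

lemma left_invariant_eq_frame:
  assumes "X \<in> lie_algebra G"
  shows "X = frame (coeff X (gone G))"
proof -
  have X: "X \<in> vector_fields G" "\<And>a. push G a X = X" using assms by (auto simp: lie_algebra_def)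
  have const: "coeff X p = coeff X (gone G)" for p
    using coeff_push[of p X "gone G"] X(2) by simp
  have "X f p = frame (coeff X (gone G)) f p" for f p
    using frame_coeff[OF X(1), of f p] by (simp only: const[of p])
  then show ?thesis by (intro ext)
qed

lemma frame_lie_algebra: "frame v \<in> lie_algebra G"
  by (simp add: lie_algebra_def frame_vector_field frame_push)

definition frame_bracket :: "'e \<Rightarrow> 'e \<Rightarrow> 'e" where
  "frame_bracket v w = coeff (lie_bracket (frame v) (frame w)) (gone G)"

lemma left_invariant_frame: "left_invariant_frame G frame coeff frame_bracket"
proof unfold_locales
  show "frame (v + w) = vplus (frame v) (frame w)" for v w
    by (simp add: fun_eq_iff vplus_def linear_add[OF frame_linear])
  show "frame (a *\<^sub>R v) = vscale (\<lambda>p. a) (frame v)" for a v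
    by (simp add: fun_eq_iff vscale_def linear_scale[OF frame_linear])
  show "lie_bracket (frame v) (frame w) = frame (frame_bracket v w)" for v w
    unfolding frame_bracket_def
    by (rule left_invariant_eq_frame)
      (simp add: lie_algebra_def lie_bracket_in_vector_fields frame_vector_field push_lie_bracket frame_push)
qed (simp_all add: frame_lie_algebra coeff_smooth frame_combine coeff_combine frame_coeff coeff_push)

end

lemma (in lie_grp) left_invariant_frame_exists:
  "\<exists>L c br. left_invariant_frame G L c br"
proof -
  obtain U \<phi> where U: "(U, \<phi>) \<in> atlas G" "gone G \<in> U" by (rule chart_at)
  obtain R where "0 < R" "ball (\<phi> (gone G)) R \<subseteq> \<phi> ` U"
    using chart_open_image[OF U(1)] U(2) openE by blast
  with U interpret lie_grp_chart G U \<phi> R by unfold_locales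
  show ?thesis using left_invariant_frame by blast
qed

section \<open>Left invariant metrics and their connections\<close>

lemma bilinear_expand:
  fixes h :: "'e::euclidean_space \<Rightarrow> 'e \<Rightarrow> real"
  assumes "bilinear h"
  shows "h x y = (\<Sum>i\<in>Basis. \<Sum>j\<in>Basis. (x \<bullet> i) * (y \<bullet> j) * h i j)"
proof -
  have l: "linear (\<lambda>x. h x y)" "linear (h x)" for x y
    using assms by (auto simp: bilinear_def)
  have "h (\<Sum>i\<in>Basis. (x \<bullet> i) *\<^sub>R i) y = (\<Sum>i\<in>Basis. (x \<bullet> i) * h i y)"
    by (simp only: linear_sum[OF l(1)] linear_scale[OF l(1)] real_scaleR_def)
  also have "\<dots> = (\<Sum>i\<in>Basis. (x \<bullet> i) * h i (\<Sum>j\<in>Basis. (y \<bullet> j) *\<^sub>R j))"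
    by (simp only: euclidean_representation)
  also have "\<dots> = (\<Sum>i\<in>Basis. \<Sum>j\<in>Basis. (x \<bullet> i) * (y \<bullet> j) * h i j)"
    by (simp only: linear_sum[OF l(2)] linear_scale[OF l(2)] real_scaleR_def sum_distrib_left mult.assoc)
  finally show ?thesis by (simp only: euclidean_representation)
qed

lemma bilinear_inner_comp:
  "bilinear h \<Longrightarrow> bilinear (\<lambda>x y. h x y \<bullet> w)"
  by (auto simp: bilinear_def linear_iff inner_add_left)

lemma antisymmetric_self:
  fixes h :: "'e \<Rightarrow> 'e \<Rightarrow> 'f::real_vector"
  assumes "\<And>v w. h v w = - h w v"
  shows "h v v = 0"
proof -
  have "h v v + h v v = 0" using assms[of v v] by (metis add.right_inverse)
  then have "2 *\<^sub>R h v v = 0" by (simp add: scaleR_2)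
  then show ?thesis by simp
qed

definition inner_form :: "('e::euclidean_space \<Rightarrow> 'e \<Rightarrow> real) \<Rightarrow> bool" where
  "inner_form B \<longleftrightarrow> bilinear B \<and> (\<forall>v w. B v w = B w v) \<and> (\<forall>v. v \<noteq> 0 \<longrightarrow> B v v > 0)"

text \<open>The conditions on \<open>\<Gamma> v w\<close> to be the covariant derivative of the left invariant field \<open>w\<close>
  along \<open>v\<close>, for the bracket \<open>br\<close> and the metric \<open>B\<close>.\<close>

definition lc_product ::
  "('e::euclidean_space \<Rightarrow> 'e \<Rightarrow> 'e) \<Rightarrow> ('e \<Rightarrow> 'e \<Rightarrow> real) \<Rightarrow> ('e \<Rightarrow> 'e \<Rightarrow> 'e) \<Rightarrow> bool" where
  "lc_product br B \<Gamma> \<longleftrightarrow> bilinear \<Gamma> \<and> (\<forall>v w. \<Gamma> v w - \<Gamma> w v = br v w) \<and>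
     (\<forall>v w z. B (\<Gamma> v w) z + B w (\<Gamma> v z) = 0)"

definition curv :: "('e \<Rightarrow> 'e \<Rightarrow> 'e::euclidean_space) \<Rightarrow> ('e \<Rightarrow> 'e \<Rightarrow> 'e) \<Rightarrow> 'e \<Rightarrow> 'e \<Rightarrow> 'e \<Rightarrow> 'e" where
  "curv br \<Gamma> x y z = \<Gamma> x (\<Gamma> y z) - \<Gamma> y (\<Gamma> x z) - \<Gamma> (br x y) z"

definition indep2 :: "'e::real_vector \<Rightarrow> 'e \<Rightarrow> bool" where
  "indep2 x y \<longleftrightarrow> (\<forall>a b. a *\<^sub>R x + b *\<^sub>R y = 0 \<longrightarrow> a = 0 \<and> b = 0)"

text \<open>The Cauchy-Schwarz inequality, by the length of the component of \<open>x\<close> orthogonal to \<open>y\<close>.\<close>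

lemma gram_pos:
  assumes B: "inner_form B" and xy: "indep2 x y"
  shows "B x x * B y y - (B x y)\<^sup>2 > 0"
proof -
  have bl: "bilinear B" and sym: "B y x = B x y" using B by (auto simp: inner_form_def)
  have "y \<noteq> 0" using xy[unfolded indep2_def, rule_format, of 0 1] by auto
  then have yy: "B y y > 0" using B by (simp add: inner_form_def)
  define w where "w = B y y *\<^sub>R x + (- B x y) *\<^sub>R y"
  have "w \<noteq> 0"
    using xy[unfolded indep2_def, rule_format, of "B y y" "- B x y"] yy by (auto simp: w_def)
  then have "B w w > 0" using B by (simp add: inner_form_def)
  moreover have "B w w = B y y * (B x x * B y y - (B x y)\<^sup>2)"
    unfolding w_def
    by (simp add: bilinear_ladd[OF bl] bilinear_radd[OF bl] bilinear_lmul[OF bl] bilinear_rmul[OF bl]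
        bilinear_lsub[OF bl] bilinear_rsub[OF bl] sym algebra_simps power2_eq_square)
  ultimately show ?thesis using yy by (simp add: zero_less_mult_iff)
qed

lemma
  assumes "levi_civita G g D"
  shows lc_vf: "X \<in> vector_fields G \<Longrightarrow> Y \<in> vector_fields G \<Longrightarrow> D X Y \<in> vector_fields G"
    and lc_torsion: "X \<in> vector_fields G \<Longrightarrow> Y \<in> vector_fields G \<Longrightarrow>
      vminus (D X Y) (D Y X) = lie_bracket X Y"
    and lc_metric: "X \<in> vector_fields G \<Longrightarrow> Y \<in> vector_fields G \<Longrightarrow> Z \<in> vector_fields G \<Longrightarrow>
      X (g Y Z) p = g (D X Y) Z p + g Y (D X Z) p"
  using assms by (simp_all add: levi_civita_def)

context left_invariant_frame
begin

lemma L_vf [simp]: "L v \<in> vector_fields G"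
  using L_left_invariant by (simp add: lie_algebra_def)

lemma L_push: "push G a (L v) = L v"
  using L_left_invariant by (simp add: lie_algebra_def)

lemma L_linear: "linear (\<lambda>v. L v f p)"
  by (simp add: linear_iff L_add L_scale vplus_def vscale_def)

lemma L_0 [simp]: "L 0 f p = 0"
  using linear_0[OF L_linear] .

lemma L_nonsmooth: "f \<notin> smooth_funs G \<Longrightarrow> L v f p = 0"
  using vf_nonsmooth[OF L_vf] by simp

lemma c_L [simp]: "c (L v) p = v"
  using c_combine[of "\<lambda>p. v" p] smooth_funs_const by simp

text \<open>A left invariant field that vanishes at one point vanishes at all of its translates.\<close>

lemma L_inj:
  assumes "\<And>f. L v f p = L w f p"
  shows "v = w"
proof -
  have z: "L (v - w) f p = 0" for f
    using assms by (simp add: linear_diff[OF L_linear])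
  have "L (v - w) f q = 0" for f q
  proof -
    define a where "a = gmult G q (ginv G p)"
    have "gmult G a p = q" by (simp add: a_def grp.assoc)
    then have "p = gmult G (ginv G a) q" by (metis mult_inv_cancel(2))
    moreover have "L (v - w) f q = push G a (L (v - w)) f q" by (simp add: L_push)
    ultimately show ?thesis using z by (simp add: push_def)
  qed
  then have "L (v - w) = L 0" by (simp add: fun_eq_iff)
  then have "c (L (v - w)) p = c (L 0) p" by simp
  then show ?thesis by simp
qed

lemma c_eqI: "X \<in> vector_fields G \<Longrightarrow> (\<And>f. X f p = L v f p) \<Longrightarrow> c X p = v"
  using L_inj[of "c X p" p v] expand by metis

lemma vanishes_at_iff: "X \<in> vector_fields G \<Longrightarrow> vanishes_at X p \<longleftrightarrow> c X p = 0"
  using c_eqI[of X p 0] expand[of X] by (auto simp: vanishes_at_def)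

lemma vf_eqI:
  assumes "X \<in> vector_fields G" "Y \<in> vector_fields G" "\<And>p. c X p = c Y p"
  shows "X = Y"
  by (intro ext) (metis assms expand)

definition smooth_vec :: "('a \<Rightarrow> 'e) \<Rightarrow> bool" where
  "smooth_vec u \<longleftrightarrow> (\<forall>b. (\<lambda>p. u p \<bullet> b) \<in> smooth_funs G)"

lemma smooth_vecD: "smooth_vec u \<Longrightarrow> (\<lambda>p. u p \<bullet> b) \<in> smooth_funs G"
  by (simp add: smooth_vec_def)

lemma smooth_vec_c [simp]: "X \<in> vector_fields G \<Longrightarrow> smooth_vec (c X)"
  by (simp add: smooth_vec_def c_smooth)

lemma smooth_vec_add: "smooth_vec u \<Longrightarrow> smooth_vec w \<Longrightarrow> smooth_vec (\<lambda>p. u p + w p)"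
  by (auto simp: smooth_vec_def inner_add_left intro!: smooth_funs_add)

lemma smooth_vec_diff: "smooth_vec u \<Longrightarrow> smooth_vec w \<Longrightarrow> smooth_vec (\<lambda>p. u p - w p)"
  by (auto simp: smooth_vec_def inner_diff_left intro!: smooth_funs_diff)

lemma smooth_vec_scale: "k \<in> smooth_funs G \<Longrightarrow> smooth_vec u \<Longrightarrow> smooth_vec (\<lambda>p. k p *\<^sub>R u p)"
  by (auto simp: smooth_vec_def intro!: smooth_funs_mult)

definition field :: "('a \<Rightarrow> 'e) \<Rightarrow> 'a vf" where
  "field u = (\<lambda>f p. L (u p) f p)"

lemma
  assumes "smooth_vec u"
  shows field_vf: "field u \<in> vector_fields G" and c_field: "c (field u) p = u p"
  unfolding field_def using assms combine c_combine by (auto simp: smooth_vec_def)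

lemma
  assumes X: "X \<in> vector_fields G" and Y: "Y \<in> vector_fields G"
  shows vplus_vf: "vplus X Y \<in> vector_fields G" and c_vplus: "c (vplus X Y) p = c X p + c Y p"
    and vminus_vf: "vminus X Y \<in> vector_fields G" and c_vminus: "c (vminus X Y) p = c X p - c Y p"
proof -
  have 1: "vplus X Y = field (\<lambda>p. c X p + c Y p)"
    using expand[OF X] expand[OF Y] by (simp add: fun_eq_iff vplus_def field_def linear_add[OF L_linear])
  have 2: "vminus X Y = field (\<lambda>p. c X p - c Y p)"
    using expand[OF X] expand[OF Y] by (simp add: fun_eq_iff vminus_def field_def linear_diff[OF L_linear])
  show "vplus X Y \<in> vector_fields G" "c (vplus X Y) p = c X p + c Y p"
       "vminus X Y \<in> vector_fields G" "c (vminus X Y) p = c X p - c Y p"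
    unfolding 1 2 using X Y
    by (auto intro!: field_vf c_field smooth_vec_add smooth_vec_diff)
qed

lemma
  assumes k: "k \<in> smooth_funs G" and X: "X \<in> vector_fields G"
  shows vscale_vf: "vscale k X \<in> vector_fields G" and c_vscale: "c (vscale k X) p = k p *\<^sub>R c X p"
proof -
  have 1: "vscale k X = field (\<lambda>p. k p *\<^sub>R c X p)"
    using expand[OF X] by (simp add: fun_eq_iff vscale_def field_def linear_scale[OF L_linear])
  show "vscale k X \<in> vector_fields G" "c (vscale k X) p = k p *\<^sub>R c X p"
    unfolding 1 using k X by (auto intro!: field_vf c_field smooth_vec_scale)
qed

lemma independent_at_iff:
  assumes X: "X \<in> vector_fields G" and Y: "Y \<in> vector_fields G"
  shows "independent_at X Y p \<longleftrightarrow> indep2 (c X p) (c Y p)"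
proof -
  have "vanishes_at (vplus (vscale (\<lambda>q. a) X) (vscale (\<lambda>q. b) Y)) p
      \<longleftrightarrow> a *\<^sub>R c X p + b *\<^sub>R c Y p = 0" for a b
    by (simp add: vanishes_at_iff vplus_vf c_vplus vscale_vf c_vscale X Y smooth_funs_const)
  then show ?thesis by (simp add: independent_at_def indep2_def)
qed

text \<open>Covariant differentiation for the flat connection whose parallel fields are the left
  invariant ones.\<close>

definition der :: "'a vf \<Rightarrow> ('a \<Rightarrow> 'e) \<Rightarrow> 'a \<Rightarrow> 'e" where
  "der X u p = (\<Sum>b\<in>Basis. X (\<lambda>q. u q \<bullet> b) p *\<^sub>R b)"

lemma der_component: "b \<in> Basis \<Longrightarrow> der X u p \<bullet> b = X (\<lambda>q. u q \<bullet> b) p"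
  by (simp add: der_def inner_sum_left inner_Basis if_distrib cong: if_cong)

lemma smooth_vec_der [simp]:
  assumes X: "X \<in> vector_fields G" and u: "smooth_vec u"
  shows "smooth_vec (der X u)"
  unfolding smooth_vec_def der_def inner_sum_left inner_scaleR_left
  by (intro allI smooth_funs_sum smooth_funs_mult smooth_funs_const vf_smooth[OF X] smooth_vecD[OF u])

lemma der_add:
  assumes X: "X \<in> vector_fields G" and u: "smooth_vec u" and w: "smooth_vec w"
  shows "der X (\<lambda>p. u p + w p) p = der X u p + der X w p"
  by (simp add: der_def inner_add_left vf_add[OF X smooth_vecD[OF u] smooth_vecD[OF w]]
      scaleR_add_left sum.distrib)

lemma der_scale:
  assumes X: "X \<in> vector_fields G" and k: "k \<in> smooth_funs G" and u: "smooth_vec u"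
  shows "der X (\<lambda>p. k p *\<^sub>R u p) p = X k p *\<^sub>R u p + k p *\<^sub>R der X u p"
  by (rule euclidean_eqI)
    (simp add: der_component inner_add_left vf_mult[OF X k smooth_vecD[OF u]])

lemma smooth_funs_bilinear:
  fixes h :: "'e \<Rightarrow> 'e \<Rightarrow> real"
  assumes "bilinear h" "smooth_vec u" "smooth_vec w"
  shows "(\<lambda>p. h (u p) (w p)) \<in> smooth_funs G"
  by (subst bilinear_expand[OF assms(1)])
    (intro smooth_funs_sum smooth_funs_mult smooth_funs_const smooth_vecD assms)

lemma smooth_vec_bilinear:
  "bilinear h \<Longrightarrow> smooth_vec u \<Longrightarrow> smooth_vec w \<Longrightarrow> smooth_vec (\<lambda>p. h (u p) (w p))"
  unfolding smooth_vec_def by (intro allI smooth_funs_bilinear bilinear_inner_comp) (auto simp: smooth_vec_def)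

lemma vf_bilinear:
  fixes h :: "'e \<Rightarrow> 'e \<Rightarrow> real"
  assumes X: "X \<in> vector_fields G" and h: "bilinear h" and u: "smooth_vec u" and w: "smooth_vec w"
  shows "X (\<lambda>p. h (u p) (w p)) p = h (der X u p) (w p) + h (u p) (der X w p)"
proof -
  note s = smooth_vecD[OF u] smooth_vecD[OF w]
  have s1: "(\<lambda>q. (u q \<bullet> i) * (w q \<bullet> j)) \<in> smooth_funs G" for i j by (intro smooth_funs_mult s)
  have s2: "(\<lambda>q. h i j * ((u q \<bullet> i) * (w q \<bullet> j))) \<in> smooth_funs G" for i j by (intro smooth_funs_cmult s1)
  have "X (\<lambda>p. h (u p) (w p)) p = X (\<lambda>q. \<Sum>i\<in>Basis. \<Sum>j\<in>Basis. h i j * ((u q \<bullet> i) * (w q \<bullet> j))) p"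
    by (subst bilinear_expand[OF h]) (simp add: ac_simps)
  also have "\<dots> = (\<Sum>i\<in>Basis. \<Sum>j\<in>Basis. X (\<lambda>q. h i j * ((u q \<bullet> i) * (w q \<bullet> j))) p)"
    by (simp only: vf_sum[OF X finite_Basis smooth_funs_sum[OF s2]] vf_sum[OF X finite_Basis s2])
  also have "\<dots> = (\<Sum>i\<in>Basis. \<Sum>j\<in>Basis. (der X u p \<bullet> i) * (w p \<bullet> j) * h i j + (u p \<bullet> i) * (der X w p \<bullet> j) * h i j)"
    by (intro sum.cong refl) (simp add: vf_cmult[OF X s1] vf_mult[OF X s] der_component algebra_simps)
  also have "\<dots> = h (der X u p) (w p) + h (u p) (der X w p)"
    by (subst (1 2) bilinear_expand[OF h]) (simp add: sum.distrib)
  finally show ?thesis .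
qed

lemma der_bilinear:
  assumes "X \<in> vector_fields G" "bilinear h" "smooth_vec u" "smooth_vec w"
  shows "der X (\<lambda>p. h (u p) (w p)) p = h (der X u p) (w p) + h (u p) (der X w p)"
proof (rule euclidean_eqI)
  fix b :: 'e assume b: "b \<in> Basis"
  show "der X (\<lambda>p. h (u p) (w p)) p \<bullet> b = (h (der X u p) (w p) + h (u p) (der X w p)) \<bullet> b"
    using vf_bilinear[OF assms(1) bilinear_inner_comp[OF assms(2)] assms(3,4), of b p]
    by (simp add: der_component[OF b] inner_add_left)
qed

lemma L_sum: "(\<Sum>i\<in>I. k i * L (v i) f p) = L (\<Sum>i\<in>I. k i *\<^sub>R v i) f p"
  by (simp add: linear_sum[OF L_linear] linear_scale[OF L_linear])

lemma br_antisym: "br v w = - br w v"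
proof (rule L_inj)
  show "L (br v w) f p = L (- br w v) f p" for f p
    by (simp add: linear_neg[OF L_linear] flip: bracket) (simp add: lie_bracket_def)
qed

lemma br_self [simp]: "br v v = 0"
  by (rule antisymmetric_self[of br, OF br_antisym])

lemma br_bilinear: "bilinear br"
proof -
  have lin: "linear (br w)" for w
  proof (rule linearI)
    show "br w (v + z) = br w v + br w z" for v z
    proof (rule L_inj)
      fix f p
      show "L (br w (v + z)) f p = L (br w v + br w z) f p"
      proof (cases "f \<in> smooth_funs G")
        case True
        then show ?thesis
          by (simp add: linear_add[OF L_linear] flip: bracket)
            (simp add: lie_bracket_def L_add vplus_def vf_add[OF L_vf] vf_smooth[OF L_vf])
      qed (simp add: L_nonsmooth)
    qed
    show "br w (k *\<^sub>R v) = k *\<^sub>R br w v" for k v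
    proof (rule L_inj)
      fix f p
      show "L (br w (k *\<^sub>R v)) f p = L (k *\<^sub>R br w v) f p"
      proof (cases "f \<in> smooth_funs G")
        case True
        then show ?thesis
          by (simp add: linear_scale[OF L_linear] flip: bracket)
            (simp add: lie_bracket_def L_scale vscale_def vf_cmult[OF L_vf] vf_smooth[OF L_vf] algebra_simps)
      qed (simp add: L_nonsmooth)
    qed
  qed
  then have "linear (\<lambda>v. br v w)" for w
    using linear_compose_neg[OF lin[of w]] by (simp flip: br_antisym)
  then show ?thesis using lin by (simp add: bilinear_def)
qed

text \<open>In \<open>X (Y f) - Y (X f)\<close> the second derivatives \<open>L a (L b f)\<close> and \<open>L b (L a f)\<close> occur with
  opposite coefficients, so they combine to brackets of frame fields.\<close>

lemma c_bracket:
  assumes X: "X \<in> vector_fields G" and Y: "Y \<in> vector_fields G"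
  shows "c (lie_bracket X Y) p = der X (c Y) p - der Y (c X) p + br (c X p) (c Y p)"
proof (rule c_eqI[OF lie_bracket_in_vector_fields[OF X Y]])
  fix f
  show "lie_bracket X Y f p = L (der X (c Y) p - der Y (c X) p + br (c X p) (c Y p)) f p"
  proof (cases "f \<in> smooth_funs G")
    case False
    then show ?thesis
      using vf_nonsmooth[OF lie_bracket_in_vector_fields[OF X Y]] by (simp add: L_nonsmooth)
  next
    case f: True
    have ex: "Z h q = (\<Sum>b\<in>Basis. (c Z q \<bullet> b) * L b h q)" if "Z \<in> vector_fields G" for Z h q
      using expand[OF that] by (simp add: L_sum euclidean_representation)
    have XY: "X (Y f) p = L (der X (c Y) p) f p
        + (\<Sum>a\<in>Basis. \<Sum>b\<in>Basis. (c X p \<bullet> a) * (c Y p \<bullet> b) * L a (L b f) p)"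
      if X: "X \<in> vector_fields G" and Y: "Y \<in> vector_fields G" for X Y
    proof -
      note s = smooth_vecD[OF smooth_vec_c[OF Y]] vf_smooth[OF L_vf f]
      have "X (Y f) p = X (\<lambda>q. \<Sum>b\<in>Basis. (c Y q \<bullet> b) * L b f q) p"
        by (subst ex[OF Y, abs_def]) simp
      also have "\<dots> = (\<Sum>b\<in>Basis. X (\<lambda>q. c Y q \<bullet> b) p * L b f p + (c Y p \<bullet> b) * X (L b f) p)"
        by (simp only: vf_sum[OF X finite_Basis smooth_funs_mult[OF s]] vf_mult[OF X s])
      also have "\<dots> = L (der X (c Y) p) f p + (\<Sum>b\<in>Basis. (c Y p \<bullet> b) * (\<Sum>a\<in>Basis. (c X p \<bullet> a) * L a (L b f) p))"
        by (simp add: sum.distrib L_sum ex[OF X, of "L _ f"] der_def)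
      also have "(\<Sum>b\<in>Basis. (c Y p \<bullet> b) * (\<Sum>a\<in>Basis. (c X p \<bullet> a) * L a (L b f) p))
          = (\<Sum>a\<in>Basis. \<Sum>b\<in>Basis. (c X p \<bullet> a) * (c Y p \<bullet> b) * L a (L b f) p)"
        by (subst sum.swap) (simp add: sum_distrib_left ac_simps)
      finally show ?thesis .
    qed
    have bl: "bilinear (\<lambda>v w. L (br v w) f p)"
      using br_bilinear linear_compose[OF _ L_linear[of f p]] unfolding bilinear_def by (auto simp: o_def)
    have "L (br (c X p) (c Y p)) f p = (\<Sum>a\<in>Basis. \<Sum>b\<in>Basis. (c X p \<bullet> a) * (c Y p \<bullet> b) * L (br a b) f p)"
      by (rule bilinear_expand[OF bl])
    also have "\<dots> = (\<Sum>a\<in>Basis. \<Sum>b\<in>Basis. (c X p \<bullet> a) * (c Y p \<bullet> b) * L a (L b f) p)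
        - (\<Sum>a\<in>Basis. \<Sum>b\<in>Basis. (c X p \<bullet> a) * (c Y p \<bullet> b) * L b (L a f) p)"
      by (simp add: lie_bracket_def algebra_simps sum_subtractf flip: bracket)
    also have "(\<Sum>a\<in>Basis. \<Sum>b\<in>Basis. (c X p \<bullet> a) * (c Y p \<bullet> b) * L b (L a f) p)
        = (\<Sum>a\<in>Basis. \<Sum>b\<in>Basis. (c Y p \<bullet> a) * (c X p \<bullet> b) * L a (L b f) p)"
      by (subst sum.swap) (simp add: ac_simps)
    finally have "L (br (c X p) (c Y p)) f p = (X (Y f) p - L (der X (c Y) p) f p) - (Y (X f) p - L (der Y (c X) p) f p)"
      by (simp add: XY[OF X Y] XY[OF Y X])
    then show ?thesis
      by (simp add: lie_bracket_def linear_add[OF L_linear] linear_diff[OF L_linear])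
  qed
qed

text \<open>Koszul's formula expresses a Levi-Civita connection by the metric.\<close>

lemma levi_civita_unique:
  assumes g: "riemannian_metric G g" and D: "levi_civita G g D" and D': "levi_civita G g D'"
    and X: "X \<in> vector_fields G" and Y: "Y \<in> vector_fields G"
  shows "D X Y = D' X Y"
proof -
  let ?V = "vector_fields G"
  have sym: "g X Y = g Y X" if "X \<in> ?V" "Y \<in> ?V" for X Y
    using g that by (simp add: riemannian_metric_def)
  have gm: "g (vminus X Y) Z p = g X Z p - g Y Z p" if X: "X \<in> ?V" and Y: "Y \<in> ?V" and Z: "Z \<in> ?V" for X Y Z p
  proof -
    have o: "one_form G (\<lambda>X. g X Z)" using g Z by (simp add: riemannian_metric_def bilinear_form_def)
    have "vplus (vminus X Y) Y = X" by (simp add: vplus_def vminus_def)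
    then have "g X Z = (\<lambda>p. g (vminus X Y) Z p + g Y Z p)"
      using o vminus_vf[OF X Y] Y unfolding one_form_def by metis
    then show ?thesis by simp
  qed
  have koszul: "2 * g (D X Y) Z p = X (g Y Z) p + Y (g X Z) p - Z (g X Y) p
      + g (lie_bracket X Y) Z p - g (lie_bracket X Z) Y p - g (lie_bracket Y Z) X p"
    if D: "levi_civita G g D" and Z: "Z \<in> ?V" for D Z p
  proof -
    note V = lc_vf[OF D] and c = lc_metric[OF D] and t = lc_torsion[OF D, symmetric]
    show ?thesis
      using sym[OF Y V[OF X Z]] sym[OF X V[OF Y Z]] sym[OF X V[OF Z Y]]
      by (simp add: c t gm V X Y Z)
  qed
  have V: "D X Y \<in> ?V" "D' X Y \<in> ?V"
    using lc_vf[OF D X Y] lc_vf[OF D' X Y] .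
  define W where "W = vminus (D X Y) (D' X Y)"
  have W: "W \<in> ?V" unfolding W_def by (intro vminus_vf V)
  have "g W W p = 0" for p
    using koszul[OF D W, of p] koszul[OF D' W, of p] by (simp add: gm[OF V W, folded W_def])
  then have "vanishes_at W p" for p
    using g W unfolding riemannian_metric_def by (metis less_irrefl)
  then show ?thesis by (auto simp: vanishes_at_def W_def vminus_def fun_eq_iff)
qed

end

context left_invariant_frame
begin

definition conn :: "('e \<Rightarrow> 'e \<Rightarrow> 'e) \<Rightarrow> 'a vf \<Rightarrow> 'a vf \<Rightarrow> 'a vf" where
  "conn \<Gamma> X Y = field (\<lambda>p. der X (c Y) p + \<Gamma> (c X p) (c Y p))"

definition metric :: "('e \<Rightarrow> 'e \<Rightarrow> real) \<Rightarrow> 'a vf \<Rightarrow> 'a vf \<Rightarrow> 'a \<Rightarrow> real" where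
  "metric B X Y = (\<lambda>p. B (c X p) (c Y p))"

lemma
  assumes "bilinear \<Gamma>" "X \<in> vector_fields G" "Y \<in> vector_fields G"
  shows conn_vf: "conn \<Gamma> X Y \<in> vector_fields G"
    and c_conn: "c (conn \<Gamma> X Y) p = der X (c Y) p + \<Gamma> (c X p) (c Y p)"
proof -
  have "smooth_vec (\<lambda>p. der X (c Y) p + \<Gamma> (c X p) (c Y p))"
    by (intro smooth_vec_add smooth_vec_der smooth_vec_bilinear[OF assms(1)] smooth_vec_c assms)
  then show "conn \<Gamma> X Y \<in> vector_fields G" "c (conn \<Gamma> X Y) p = der X (c Y) p + \<Gamma> (c X p) (c Y p)"
    unfolding conn_def by (auto intro: field_vf c_field)
qed

lemma der_vplus: "der (vplus X Y) u p = der X u p + der Y u p"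
  by (simp add: der_def vplus_def scaleR_add_left sum.distrib)

lemma der_vscale: "der (vscale k X) u p = k p *\<^sub>R der X u p"
  by (simp add: der_def vscale_def scaleR_sum_right)

lemma c_vplus_fun: "X \<in> vector_fields G \<Longrightarrow> Y \<in> vector_fields G \<Longrightarrow> c (vplus X Y) = (\<lambda>p. c X p + c Y p)"
  by (simp add: fun_eq_iff c_vplus)

lemma c_vscale_fun: "k \<in> smooth_funs G \<Longrightarrow> X \<in> vector_fields G \<Longrightarrow> c (vscale k X) = (\<lambda>p. k p *\<^sub>R c X p)"
  by (simp add: fun_eq_iff c_vscale)

text \<open>The flat connection has the torsion \<open>- br\<close> and preserves every left invariant metric, so the
  conditions on \<open>\<Gamma>\<close> are those for the corrected connection.\<close>

lemma levi_civita_conn: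
  assumes B: "inner_form B" and \<Gamma>: "lc_product br B \<Gamma>"
  shows "levi_civita G (metric B) (conn \<Gamma>)"
proof -
  have bB: "bilinear B" using B by (simp add: inner_form_def)
  have b\<Gamma>: "bilinear \<Gamma>" and t\<Gamma>: "\<Gamma> v w - \<Gamma> w v = br v w" and m\<Gamma>: "B (\<Gamma> v w) z + B w (\<Gamma> v z) = 0" for v w z
    using \<Gamma> by (auto simp: lc_product_def)
  note vf = conn_vf[OF b\<Gamma>] vplus_vf vscale_vf vminus_vf lie_bracket_in_vector_fields
  note cs = c_conn[OF b\<Gamma>] c_vplus c_vscale c_vminus c_bracket
  note bl = bilinear_ladd[OF b\<Gamma>] bilinear_radd[OF b\<Gamma>] bilinear_lmul[OF b\<Gamma>] bilinear_rmul[OF b\<Gamma>]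
  show ?thesis
    unfolding levi_civita_def
  proof (intro conjI ballI allI)
    fix X Y Z assume X: "X \<in> vector_fields G" and Y: "Y \<in> vector_fields G" and Z: "Z \<in> vector_fields G"
    show "conn \<Gamma> (vplus X Y) Z = vplus (conn \<Gamma> X Z) (conn \<Gamma> Y Z)"
      by (rule vf_eqI) (simp_all add: X Y Z vf cs bl der_vplus)
    show "conn \<Gamma> X (vplus Y Z) = vplus (conn \<Gamma> X Y) (conn \<Gamma> X Z)"
      by (rule vf_eqI) (simp_all add: X Y Z vf cs bl c_vplus_fun der_add)
    show "X (metric B Y Z) p = metric B (conn \<Gamma> X Y) Z p + metric B Y (conn \<Gamma> X Z) p" for p
    proof -
      have "X (metric B Y Z) p = B (der X (c Y) p) (c Z p) + B (c Y p) (der X (c Z) p)"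
        unfolding metric_def by (intro vf_bilinear X bB smooth_vec_c Y Z)
      then show ?thesis
        using m\<Gamma>[of "c X p" "c Y p" "c Z p"]
        by (simp add: metric_def cs X Y Z bilinear_ladd[OF bB] bilinear_radd[OF bB])
    qed
  next
    fix k X Y assume k: "k \<in> smooth_funs G" and X: "X \<in> vector_fields G" and Y: "Y \<in> vector_fields G"
    show "conn \<Gamma> (vscale k X) Y = vscale k (conn \<Gamma> X Y)"
      by (rule vf_eqI) (simp_all add: k X Y vf cs bl der_vscale scaleR_add_right)
    show "conn \<Gamma> X (vscale k Y) = vplus (vscale (X k) Y) (vscale k (conn \<Gamma> X Y))"
      by (rule vf_eqI) (simp_all add: k X Y vf cs bl c_vscale_fun der_scale vf_smooth[OF X k] scaleR_add_right)
  next
    fix X Y assume X: "X \<in> vector_fields G" and Y: "Y \<in> vector_fields G"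
    show "conn \<Gamma> X Y \<in> vector_fields G" by (simp add: X Y vf)
    show "vminus (conn \<Gamma> X Y) (conn \<Gamma> Y X) = lie_bracket X Y"
      by (rule vf_eqI) (simp_all add: X Y vf cs flip: t\<Gamma>)
  qed
qed

lemma left_invariant_metric_metric:
  assumes B: "inner_form B"
  shows "left_invariant_metric G (metric B)"
proof -
  have bB: "bilinear B" and sB: "B v w = B w v" for v w using B by (auto simp: inner_form_def)
  note bl = bilinear_ladd[OF bB] bilinear_radd[OF bB] bilinear_lmul[OF bB] bilinear_rmul[OF bB]
  have "bilinear_form G (metric B)"
    unfolding bilinear_form_def one_form_def metric_def
    by (auto simp: c_vplus c_vscale bl intro!: smooth_funs_bilinear[OF bB])
  moreover have "\<forall>X\<in>vector_fields G. \<forall>Y\<in>vector_fields G. metric B X Y = metric B Y X"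
    using sB by (simp add: metric_def)
  moreover have "\<forall>X\<in>vector_fields G. \<forall>p. \<not> vanishes_at X p \<longrightarrow> metric B X X p > 0"
    using B by (simp add: vanishes_at_iff metric_def inner_form_def)
  ultimately have "riemannian_metric G (metric B)" by (simp add: riemannian_metric_def)
  then show ?thesis
    by (simp add: left_invariant_metric_def) (simp add: metric_def c_push)
qed

text \<open>A form is additive on pairs of fields only; hence the induction over partial sums of the
  expansion of \<open>X\<close> in the frame.\<close>

lemma one_form_expand:
  assumes \<eta>: "one_form G \<eta>" and X: "X \<in> vector_fields G"
  shows "\<eta> X p = (\<Sum>b\<in>Basis. (c X p \<bullet> b) * \<eta> (L b) p)"
proof -
  have add: "\<eta> (vplus X Y) = (\<lambda>p. \<eta> X p + \<eta> Y p)" if "X \<in> vector_fields G" "Y \<in> vector_fields G" for X Y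
    using \<eta> that by (simp add: one_form_def)
  have scale: "\<eta> (vscale u X) = (\<lambda>p. u p * \<eta> X p)" if "u \<in> smooth_funs G" "X \<in> vector_fields G" for u X
    using \<eta> that by (simp add: one_form_def)
  have part: "field (\<lambda>p. \<Sum>b\<in>A. (c X p \<bullet> b) *\<^sub>R b) \<in> vector_fields G \<and>
      \<eta> (field (\<lambda>p. \<Sum>b\<in>A. (c X p \<bullet> b) *\<^sub>R b)) p = (\<Sum>b\<in>A. (c X p \<bullet> b) * \<eta> (L b) p)"
    if "finite A" for A
    using that
  proof (induction A rule: finite_induct)
    case empty
    have "field (\<lambda>p. 0) = vscale (\<lambda>p. 0) (L 0)" by (simp add: field_def vscale_def)
    then show ?case using smooth_funs_const[of 0]
      by (simp add: vscale_vf scale)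
  next
    case (insert b A)
    let ?F = "field (\<lambda>p. \<Sum>b\<in>A. (c X p \<bullet> b) *\<^sub>R b)"
    have "field (\<lambda>p. \<Sum>b\<in>insert b A. (c X p \<bullet> b) *\<^sub>R b) = vplus (vscale (\<lambda>p. c X p \<bullet> b) (L b)) ?F"
      using insert.hyps
      by (simp add: field_def vplus_def vscale_def linear_add[OF L_linear] linear_scale[OF L_linear])
    then show ?case
      using insert c_smooth[OF X] by (simp add: vplus_vf vscale_vf add scale)
  qed
  have "X = field (\<lambda>p. \<Sum>b\<in>Basis. (c X p \<bullet> b) *\<^sub>R b)"
    using expand[OF X] by (simp add: field_def euclidean_representation fun_eq_iff)
  then show ?thesis using part[OF finite_Basis] by simp
qed

lemma left_invariant_metric_eq:
  assumes g: "left_invariant_metric G g"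
  obtains B where "inner_form B"
    "\<And>X Y. X \<in> vector_fields G \<Longrightarrow> Y \<in> vector_fields G \<Longrightarrow> g X Y = metric B X Y"
proof
  have r: "riemannian_metric G g" using g by (simp add: left_invariant_metric_def)
  then have of: "one_form G (g X)" "one_form G (\<lambda>Y. g Y X)" if "X \<in> vector_fields G" for X
    using that by (auto simp: riemannian_metric_def bilinear_form_def)
  define B where "B v w = g (L v) (L w) (gone G)" for v w
  have inv: "g (L v) (L w) p = B v w" for v w p
  proof -
    have "g (push G p (L v)) (push G p (L w)) (gmult G p (gone G)) = g (L v) (L w) (gone G)"
      using g unfolding left_invariant_metric_def by (meson L_vf)
    then show ?thesis by (simp add: L_push B_def)
  qed
  have "L (v + w) = vplus (L v) (L w)" "L (k *\<^sub>R v) = vscale (\<lambda>p. k) (L v)" for v w k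
    by (rule L_add L_scale)+
  then have "bilinear B"
    using of[OF L_vf] smooth_funs_const
    unfolding bilinear_def linear_iff B_def one_form_def by simp
  moreover have "B v w = B w v" for v w
    using r unfolding riemannian_metric_def B_def by (metis L_vf)
  moreover have "B v v > 0" if "v \<noteq> 0" for v
    using r that by (simp add: riemannian_metric_def B_def vanishes_at_iff)
  ultimately show B: "inner_form B" by (simp add: inner_form_def)
  fix X Y assume X: "X \<in> vector_fields G" and Y: "Y \<in> vector_fields G"
  show "g X Y = metric B X Y"
  proof
    fix p
    have "g X Y p = (\<Sum>a\<in>Basis. (c X p \<bullet> a) * g (L a) Y p)"
      by (rule one_form_expand[OF of(2)[OF Y] X])
    also have "\<dots> = (\<Sum>a\<in>Basis. \<Sum>b\<in>Basis. (c X p \<bullet> a) * (c Y p \<bullet> b) * B a b)"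
      by (simp add: one_form_expand[OF of(1)[OF L_vf] Y] inv sum_distrib_left mult.assoc)
    also have "\<dots> = metric B X Y p"
      unfolding metric_def by (rule bilinear_expand[symmetric]) (use B in \<open>simp add: inner_form_def\<close>)
    finally show "g X Y p = metric B X Y p" .
  qed
qed

text \<open>The derivatives of the coefficient functions cancel: curvature is a tensor.\<close>

lemma c_curvature_conn:
  assumes b: "bilinear \<Gamma>" and X: "X \<in> vector_fields G" and Y: "Y \<in> vector_fields G" and Z: "Z \<in> vector_fields G"
  shows "c (curvature (conn \<Gamma>) X Y Z) p = curv br \<Gamma> (c X p) (c Y p) (c Z p)"
proof -
  note bl = bilinear_ladd[OF b] bilinear_radd[OF b] bilinear_lsub[OF b] bilinear_rsub[OF b]
  note vf = conn_vf[OF b] vminus_vf lie_bracket_in_vector_fields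
  have dd: "der X (c (conn \<Gamma> Y Z)) p
      = der X (der Y (c Z)) p + (\<Gamma> (der X (c Y) p) (c Z p) + \<Gamma> (c Y p) (der X (c Z) p))"
    if X: "X \<in> vector_fields G" and Y: "Y \<in> vector_fields G" for X Y
  proof -
    have "c (conn \<Gamma> Y Z) = (\<lambda>p. der Y (c Z) p + \<Gamma> (c Y p) (c Z p))"
      by (simp add: fun_eq_iff c_conn[OF b] Y Z)
    then show ?thesis
      by (simp add: der_add X Y Z smooth_vec_bilinear[OF b] der_bilinear[OF X b])
  qed
  have comm: "der (lie_bracket X Y) (c Z) p = der X (der Y (c Z)) p - der Y (der X (c Z)) p"
    by (rule euclidean_eqI) (simp add: der_component inner_diff_left lie_bracket_def)
  show ?thesis
    by (simp add: curvature_def curv_def c_vminus vf X Y Z c_conn[OF b] dd comm c_bracket bl)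
qed

lemma levi_civita_eq_conn:
  assumes g: "left_invariant_metric G g" and B: "inner_form B"
    and gB: "\<And>X Y. X \<in> vector_fields G \<Longrightarrow> Y \<in> vector_fields G \<Longrightarrow> g X Y = metric B X Y"
    and D: "levi_civita G g D" and \<Gamma>: "lc_product br B \<Gamma>"
    and X: "X \<in> vector_fields G" and Y: "Y \<in> vector_fields G"
  shows "D X Y = conn \<Gamma> X Y"
proof -
  have LC: "levi_civita G g (conn \<Gamma>)"
    using levi_civita_conn[OF B \<Gamma>] unfolding levi_civita_def by (simp add: gB)
  have "riemannian_metric G g" using g by (simp add: left_invariant_metric_def)
  then show ?thesis by (rule levi_civita_unique[OF _ D LC X Y])
qed

lemma sectional_conn:
  assumes B: "inner_form B" and \<Gamma>: "lc_product br B \<Gamma>"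
    and X: "X \<in> vector_fields G" and Y: "Y \<in> vector_fields G"
  shows "sectional (metric B) (conn \<Gamma>) X Y p = B (curv br \<Gamma> (c X p) (c Y p) (c Y p)) (c X p) /
     (B (c X p) (c X p) * B (c Y p) (c Y p) - (B (c X p) (c Y p))\<^sup>2)"
  using \<Gamma> by (simp add: sectional_def metric_def c_curvature_conn X Y lc_product_def)

text \<open>The passage from geometry to linear algebra; the frame fields already provide all planes.\<close>

theorem constant_sign_algebraic:
  assumes G: "constant_sign_curvature G" and B: "inner_form B" and \<Gamma>: "lc_product br B \<Gamma>"
  shows "(\<forall>x y. indep2 x y \<longrightarrow> B (curv br \<Gamma> x y y) x > 0) \<or> (\<forall>x y. indep2 x y \<longrightarrow> B (curv br \<Gamma> x y y) x < 0)"
proof -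
  have eq: "sectional (metric B) (conn \<Gamma>) (L x) (L y) p
      = B (curv br \<Gamma> x y y) x / (B x x * B y y - (B x y)\<^sup>2)" for x y p
    using sectional_conn[OF B \<Gamma> L_vf L_vf] by simp
  have ind: "independent_at (L x) (L y) p \<longleftrightarrow> indep2 x y" for x y p
    by (simp add: independent_at_iff)
  have "(\<forall>x y. indep2 x y \<longrightarrow> B (curv br \<Gamma> x y y) x / (B x x * B y y - (B x y)\<^sup>2) > 0) \<or>
        (\<forall>x y. indep2 x y \<longrightarrow> B (curv br \<Gamma> x y y) x / (B x x * B y y - (B x y)\<^sup>2) < 0)"
    using G left_invariant_metric_metric[OF B] levi_civita_conn[OF B \<Gamma>]
    unfolding constant_sign_curvature_def by (metis L_vf ind eq)
  then show ?thesis
    using gram_pos[OF B] by (simp add: zero_less_divide_iff divide_less_0_iff) (meson less_asym)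
qed

text \<open>By uniqueness of the Levi-Civita connection and tensoriality of curvature, the planes spanned
  by arbitrary vector fields reduce to those of the Lie algebra.\<close>

theorem constant_sign_negative:
  assumes neg: "\<And>B. inner_form B \<Longrightarrow>
    \<exists>\<Gamma>. lc_product br B \<Gamma> \<and> (\<forall>x y. indep2 x y \<longrightarrow> B (curv br \<Gamma> x y y) x < 0)"
  shows "constant_sign_curvature G"
  unfolding constant_sign_curvature_def
proof (intro allI impI disjI2 ballI)
  fix g D X Y p
  assume gD: "left_invariant_metric G g \<and> levi_civita G g D"
    and X: "X \<in> vector_fields G" and Y: "Y \<in> vector_fields G" and "independent_at X Y p"
  then have xy: "indep2 (c X p) (c Y p)" by (simp add: independent_at_iff)
  obtain B where B: "inner_form B"
    and gB: "\<And>X Y. X \<in> vector_fields G \<Longrightarrow> Y \<in> vector_fields G \<Longrightarrow> g X Y = metric B X Y"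
    using left_invariant_metric_eq gD by blast
  obtain \<Gamma> where \<Gamma>: "lc_product br B \<Gamma>" and n: "\<And>x y. indep2 x y \<Longrightarrow> B (curv br \<Gamma> x y y) x < 0"
    using neg[OF B] by blast
  note D = levi_civita_eq_conn[OF conjunct1[OF gD] B gB conjunct2[OF gD] \<Gamma>]
  have b: "bilinear \<Gamma>" using \<Gamma> by (simp add: lc_product_def)
  have "curvature D X Y Y = curvature (conn \<Gamma>) X Y Y"
    by (simp add: curvature_def D X Y conn_vf[OF b] lie_bracket_in_vector_fields)
  moreover have "curvature (conn \<Gamma>) X Y Y \<in> vector_fields G"
    by (simp add: curvature_def X Y conn_vf[OF b] lie_bracket_in_vector_fields vminus_vf)
  ultimately have "sectional g D X Y p = sectional (metric B) (conn \<Gamma>) X Y p"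
    by (simp add: sectional_def gB X Y)
  also have "\<dots> < 0"
    using n[OF xy] gram_pos[OF B xy] by (simp add: sectional_conn[OF B \<Gamma> X Y] divide_neg_pos)
  finally show "sectional g D X Y p < 0" .
qed

end

section \<open>Brackets all of whose metrics have curvature of constant sign\<close>

lemma linear_functional_inner:
  fixes l :: "'e::euclidean_space \<Rightarrow> real"
  assumes l: "linear l"
  shows "(\<Sum>b\<in>Basis. l b *\<^sub>R b) \<bullet> z = l z"
proof -
  have "l (\<Sum>b\<in>Basis. (z \<bullet> b) *\<^sub>R b) = (\<Sum>b\<in>Basis. (z \<bullet> b) * l b)"
    by (simp only: linear_sum[OF l] linear_scale[OF l] real_scaleR_def)
  then have "l z = (\<Sum>b\<in>Basis. (z \<bullet> b) * l b)" by (simp only: euclidean_representation)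
  then show ?thesis by (simp add: inner_sum_right inner_commute[of _ z] mult.commute)
qed

definition koszul :: "('e \<Rightarrow> 'e \<Rightarrow> 'e) \<Rightarrow> 'e \<Rightarrow> 'e \<Rightarrow> 'e::euclidean_space" where
  "koszul br v w = (\<Sum>b\<in>Basis. ((br v w \<bullet> b - br w b \<bullet> v + br b v \<bullet> w) / 2) *\<^sub>R b)"

lemma koszul_inner:
  assumes "bilinear br"
  shows "koszul br v w \<bullet> z = (br v w \<bullet> z - br w z \<bullet> v + br z v \<bullet> w) / 2"
proof -
  have "linear (\<lambda>z. (br v w \<bullet> z - br w z \<bullet> v + br z v \<bullet> w) / 2)"
    by (rule linearI)
      (simp_all add: inner_add_right inner_add_left bilinear_ladd[OF assms] bilinear_radd[OF assms]
        bilinear_lmul[OF assms] bilinear_rmul[OF assms] field_simps)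
  from linear_functional_inner[OF this, of z] show ?thesis by (simp only: koszul_def)
qed

lemma lc_product_koszul:
  assumes b: "bilinear br" and anti: "\<And>v w. br v w = - br w v"
  shows "lc_product br (\<bullet>) (koszul br)"
proof -
  note bl = bilinear_ladd[OF b] bilinear_radd[OF b] bilinear_lmul[OF b] bilinear_rmul[OF b]
  note k = koszul_inner[OF b]
  have e: "x = y" if "\<And>z. x \<bullet> z = y \<bullet> z" for x y :: 'a
    by (rule euclidean_eqI) (rule that)
  have "bilinear (koszul br)"
    unfolding bilinear_def
    by (intro conjI allI linearI; rule e)
      (simp_all add: k bl inner_add_left inner_add_right field_simps)
  moreover have "koszul br v w - koszul br w v = br v w" for v w
  proof (rule e)
    fix z
    show "(koszul br v w - koszul br w v) \<bullet> z = br v w \<bullet> z"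
      using anti[of w v] anti[of z v] anti[of z w] by (simp add: k inner_diff_left field_simps)
  qed
  moreover have "koszul br v w \<bullet> z + w \<bullet> koszul br v z = 0" for v w z
    using anti[of z w] anti[of z v] anti[of v w]
    by (simp add: inner_commute[of w "koszul _ _ _"] k field_simps)
  ultimately show ?thesis by (simp add: lc_product_def)
qed

lemma inner_form_inner: "inner_form (\<bullet>)"
  by (simp add: inner_form_def inner_commute bilinear_def linear_iff inner_add_left inner_add_right)

text \<open>Changing the metric and changing the bracket by a linear map amount to the same, so that it
  suffices to vary the bracket and keep the standard inner product.\<close>

lemma transport_lc_product:
  fixes F F' :: "'e::euclidean_space \<Rightarrow> 'e"
  assumes F: "linear F" and F': "linear F'" and FF': "\<And>x. F (F' x) = x" and F'F: "\<And>x. F' (F x) = x"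
    and \<Gamma>: "lc_product (\<lambda>v w. F' (br (F v) (F w))) (\<bullet>) \<Gamma>"
  defines "B \<equiv> \<lambda>v w. F' v \<bullet> F' w" and "\<Delta> \<equiv> \<lambda>v w. F (\<Gamma> (F' v) (F' w))"
  shows "inner_form B" and "lc_product br B \<Delta>"
    and "B (curv br \<Delta> (F x) (F y) (F y)) (F x) = curv (\<lambda>v w. F' (br (F v) (F w))) \<Gamma> x y y \<bullet> x"
proof -
  have b\<Gamma>: "bilinear \<Gamma>" and t: "\<Gamma> v w - \<Gamma> w v = F' (br (F v) (F w))"
    and m: "\<Gamma> v w \<bullet> z + w \<bullet> \<Gamma> v z = 0" for v w z
    using \<Gamma> by (auto simp: lc_product_def)
  note lin = linear_add[OF F] linear_add[OF F'] linear_scale[OF F] linear_scale[OF F'] linear_diff[OF F] linear_diff[OF F']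
  note bl = bilinear_ladd[OF b\<Gamma>] bilinear_radd[OF b\<Gamma>] bilinear_lmul[OF b\<Gamma>] bilinear_rmul[OF b\<Gamma>]
  have nz: "F' v \<noteq> 0" if "v \<noteq> 0" for v using FF'[of v] linear_0[OF F] that by auto
  have "bilinear B"
    by (simp add: B_def bilinear_def linear_iff lin inner_add_left inner_add_right)
  then show "inner_form B"
    using nz by (simp add: inner_form_def B_def inner_commute)
  have "bilinear \<Delta>"
    by (simp add: \<Delta>_def bilinear_def linear_iff lin bl)
  moreover have "\<Delta> v w - \<Delta> w v = br v w" for v w
    using arg_cong[OF t[of "F' v" "F' w"], of F] by (simp add: \<Delta>_def lin FF')
  ultimately show "lc_product br B \<Delta>"
    using m by (simp add: lc_product_def B_def \<Delta>_def F'F)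
  show "B (curv br \<Delta> (F x) (F y) (F y)) (F x) = curv (\<lambda>v w. F' (br (F v) (F w))) \<Gamma> x y y \<bullet> x"
    by (simp add: B_def \<Delta>_def curv_def F'F lin)
qed

text \<open>For an orthonormal basis with structure constants \<open>\<alpha>\<close>, these are the coefficients of the
  connection and the curvature of a coordinate plane. Both are polynomials in \<open>\<alpha>\<close>, so they pass
  to the limit.\<close>

definition christoffel :: "('e \<Rightarrow> 'e \<Rightarrow> 'e \<Rightarrow> real) \<Rightarrow> 'e \<Rightarrow> 'e \<Rightarrow> 'e \<Rightarrow> real" where
  "christoffel \<alpha> i j k = (\<alpha> i j k - \<alpha> j k i + \<alpha> k i j) / 2"

definition plane_curv :: "('e::euclidean_space \<Rightarrow> 'e \<Rightarrow> 'e \<Rightarrow> real) \<Rightarrow> 'e \<Rightarrow> 'e \<Rightarrow> real" where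
  "plane_curv \<alpha> i j = (\<Sum>k\<in>Basis. christoffel \<alpha> j j k * christoffel \<alpha> i k i
     - christoffel \<alpha> i j k * christoffel \<alpha> j k i - \<alpha> i j k * christoffel \<alpha> k j i)"

lemma curv_koszul:
  assumes b: "bilinear br" and anti: "\<And>v w. br v w = - br w v"
  shows "curv br (koszul br) i j j \<bullet> i = plane_curv (\<lambda>i j k. br i j \<bullet> k) i j"
proof -
  have k: "bilinear (koszul br)" using lc_product_koszul[OF assms] by (simp add: lc_product_def)
  have c: "koszul br v w \<bullet> z = christoffel (\<lambda>i j k. br i j \<bullet> k) v w z" for v w z
    by (simp add: koszul_inner[OF b] christoffel_def)
  have 1: "koszul br v w \<bullet> z = (\<Sum>k\<in>Basis. (w \<bullet> k) * (koszul br v k \<bullet> z))" for v w z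
  proof -
    have l: "linear (\<lambda>w. koszul br v w \<bullet> z)"
      using bilinear_inner_comp[OF k] by (simp add: bilinear_def)
    have "koszul br v (\<Sum>k\<in>Basis. (w \<bullet> k) *\<^sub>R k) \<bullet> z = (\<Sum>k\<in>Basis. (w \<bullet> k) * (koszul br v k \<bullet> z))"
      by (simp only: linear_sum[OF l] linear_scale[OF l] real_scaleR_def)
    then show ?thesis by (simp only: euclidean_representation)
  qed
  have 2: "koszul br v w \<bullet> z = (\<Sum>k\<in>Basis. (v \<bullet> k) * (koszul br k w \<bullet> z))" for v w z
  proof -
    have l: "linear (\<lambda>v. koszul br v w \<bullet> z)"
      using bilinear_inner_comp[OF k] by (simp add: bilinear_def)
    have "koszul br (\<Sum>k\<in>Basis. (v \<bullet> k) *\<^sub>R k) w \<bullet> z = (\<Sum>k\<in>Basis. (v \<bullet> k) * (koszul br k w \<bullet> z))"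
      by (simp only: linear_sum[OF l] linear_scale[OF l] real_scaleR_def)
    then show ?thesis by (simp only: euclidean_representation)
  qed
  have "curv br (koszul br) i j j \<bullet> i =
      koszul br i (koszul br j j) \<bullet> i - koszul br j (koszul br i j) \<bullet> i - koszul br (br i j) j \<bullet> i"
    by (simp add: curv_def inner_diff_left)
  also have "\<dots> = plane_curv (\<lambda>i j k. br i j \<bullet> k) i j"
    by (subst 1[of i], subst 1[of j "koszul br i j"], subst 2[of "br i j"])
      (simp add: plane_curv_def c sum_subtractf)
  finally show ?thesis .
qed

text \<open>The Heisenberg algebra \<open>[e,f] = z\<close>, with an abelian factor spanned by the other basis vectors.\<close>

definition heisenberg :: "'e \<Rightarrow> 'e \<Rightarrow> 'e \<Rightarrow> 'e \<Rightarrow> 'e \<Rightarrow> 'e \<Rightarrow> real" where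
  "heisenberg e f z i j k = (if i = e \<and> j = f \<and> k = z then 1 else if i = f \<and> j = e \<and> k = z then -1 else 0)"

lemma
  assumes "e \<in> Basis" "f \<in> Basis" "z \<in> Basis" "e \<noteq> f" "e \<noteq> z" "f \<noteq> z"
  shows plane_curv_heisenberg_neg: "plane_curv (heisenberg e f z) e f = - 3 / 4"
    and plane_curv_heisenberg_pos: "plane_curv (heisenberg e f z) e z = 1 / 4"
proof -
  have "plane_curv (heisenberg e f z) e f = (\<Sum>k\<in>Basis. if k = z then - 3 / 4 else 0)"
    unfolding plane_curv_def
    by (intro sum.cong refl) (use assms in \<open>auto simp: heisenberg_def christoffel_def\<close>)
  then show "plane_curv (heisenberg e f z) e f = - 3 / 4" using assms by simp
  have "plane_curv (heisenberg e f z) e z = (\<Sum>k\<in>Basis. if k = f then 1 / 4 else 0)"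
    unfolding plane_curv_def
    by (intro sum.cong refl) (use assms in \<open>auto simp: heisenberg_def christoffel_def\<close>)
  then show "plane_curv (heisenberg e f z) e z = 1 / 4" using assms by simp
qed

lemma plane_curv_tendsto:
  assumes "\<And>i j k. i \<in> Basis \<Longrightarrow> j \<in> Basis \<Longrightarrow> k \<in> Basis \<Longrightarrow> ((\<lambda>t. \<alpha> t i j k) \<longlongrightarrow> \<beta> i j k) F"
    and "i \<in> Basis" "j \<in> Basis"
  shows "((\<lambda>t. plane_curv (\<alpha> t) i j) \<longlongrightarrow> plane_curv \<beta> i j) F"
  unfolding plane_curv_def christoffel_def
  by (intro tendsto_sum tendsto_diff tendsto_mult tendsto_add tendsto_divide tendsto_const assms) auto

definition scaling :: "('e::euclidean_space \<Rightarrow> nat) \<Rightarrow> real \<Rightarrow> 'e \<Rightarrow> 'e" where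
  "scaling w t v = (\<Sum>b\<in>Basis. (t ^ w b * (v \<bullet> b)) *\<^sub>R b)"

lemma scaling_linear: "linear (scaling w t)"
  by (rule linearI)
    (simp_all add: scaling_def inner_add_left algebra_simps sum.distrib scaleR_sum_right)

lemma scaling_inner: "b \<in> Basis \<Longrightarrow> scaling w t v \<bullet> b = t ^ w b * (v \<bullet> b)"
  by (simp add: scaling_def inner_sum_left inner_Basis if_distrib cong: if_cong)

lemma scaling_Basis: "b \<in> Basis \<Longrightarrow> scaling w t b = t ^ w b *\<^sub>R b"
  by (rule euclidean_eqI) (simp add: scaling_inner inner_Basis)

lemma scaling_inverse: "t \<noteq> 0 \<Longrightarrow> scaling w t (scaling w (inverse t) v) = v"
  by (rule euclidean_eqI) (simp add: scaling_inner power_inverse)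

lemma span_pairE:
  assumes "v \<in> span {x, y}"
  obtains s t where "v = s *\<^sub>R x + t *\<^sub>R y"
proof -
  obtain s where "v - s *\<^sub>R x \<in> span {y}" using assms by (auto simp: span_insert)
  then obtain t where "v - s *\<^sub>R x = t *\<^sub>R y" by (auto simp: span_insert)
  then show ?thesis using that[of s t] by (simp add: algebra_simps)
qed

lemma indep2_Basis: "b \<in> Basis \<Longrightarrow> b' \<in> Basis \<Longrightarrow> b \<noteq> b' \<Longrightarrow> indep2 b b'"
  unfolding indep2_def
proof (intro allI impI)
  fix s t :: real assume b: "b \<in> Basis" "b' \<in> Basis" "b \<noteq> b'" and "s *\<^sub>R b + t *\<^sub>R b' = 0"
  then have "(s *\<^sub>R b + t *\<^sub>R b') \<bullet> b = 0" "(s *\<^sub>R b + t *\<^sub>R b') \<bullet> b' = 0" by auto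
  with b show "s = 0 \<and> t = 0" by (simp add: inner_add_left inner_Basis)
qed

lemma indep2_linear_image:
  assumes "linear F" "\<And>x. F x = 0 \<Longrightarrow> x = 0" "indep2 x y"
  shows "indep2 (F x) (F y)"
  unfolding indep2_def
proof (intro allI impI)
  fix s t assume "s *\<^sub>R F x + t *\<^sub>R F y = 0"
  then have "F (s *\<^sub>R x + t *\<^sub>R y) = 0"
    by (simp add: linear_add[OF assms(1)] linear_scale[OF assms(1)])
  from assms(2)[OF this] show "s = 0 \<and> t = 0"
    using assms(3) unfolding indep2_def by blast
qed

lemma linear_frame_through:
  fixes x y z :: "'e::euclidean_space"
  assumes "independent {x, y, z}" "card {x, y, z} = 3"
  obtains F F' :: "'e \<Rightarrow> 'e" and e f g where "linear F" "linear F'" "\<And>v. F (F' v) = v" "\<And>v. F' (F v) = v"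
    "e \<in> Basis" "f \<in> Basis" "g \<in> Basis" "e \<noteq> f" "e \<noteq> g" "f \<noteq> g" "F e = x" "F f = y" "F g = z"
proof -
  have "3 \<le> DIM('e)" using independent_bound[OF assms(1)] assms(2) by simp
  then obtain T where T: "T \<subseteq> (Basis :: 'e set)" "card T = 3"
    by (rule obtain_subset_with_card_n)
  then obtain e f g where efg: "T = {e, f, g}" "e \<noteq> f" "f \<noteq> g" "e \<noteq> g"
    by (auto simp: card_3_iff)
  define h where "h b = (if b = e then x else if b = f then y else z)" for b
  have h: "h e = x" "h f = y" "h g = z" using efg by (auto simp: h_def)
  have "independent T" using independent_mono[OF independent_Basis T(1)] .
  moreover have "h ` T = {x, y, z}" using h efg by auto
  moreover from this have "inj_on h T"
    using assms(2) T(2) by (intro eq_card_imp_inj_on card_ge_0_finite) auto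
  ultimately obtain F where F: "linear F" "inj F" "\<And>b. b \<in> T \<Longrightarrow> F b = h b"
    using eucl.linear_independent_extend_inj[of T h] assms(1) by auto
  obtain F' where "linear F'" "\<And>v. F' (F v) = v" "\<And>v. F (F' v) = v"
    using eucl.linear_injective_isomorphism[OF F(1,2) refl] by auto
  then show ?thesis
    using that[OF F(1), of F' e f g] F(3) T(1) h unfolding efg by (simp add: efg(2-4))
qed

text \<open>Milnor's rescaling: giving \<open>x\<close>, \<open>y\<close> the length \<open>1/t\<close> and all other basis vectors the
  length \<open>1/t\<^sup>2\<close> makes the structure constants tend to those of the Heisenberg algebra as \<open>t\<close>
  tends to zero, and the Heisenberg algebra has planes of both signs.\<close>

theorem mixed_curvature:
  fixes br :: "'e::euclidean_space \<Rightarrow> 'e \<Rightarrow> 'e"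
  assumes b: "bilinear br" and anti: "\<And>v w. br v w = - br w v" and ns: "br x y \<notin> span {x, y}"
  obtains B \<Gamma> where "inner_form B" "lc_product br B \<Gamma>"
    "\<exists>v w. indep2 v w \<and> B (curv br \<Gamma> v w w) v < 0" "\<exists>v w. indep2 v w \<and> B (curv br \<Gamma> v w w) v > 0"
proof -
  note bl = bilinear_ladd[OF b] bilinear_radd[OF b] bilinear_lmul[OF b] bilinear_rmul[OF b]
  have self: "br v v = 0" for v by (rule antisymmetric_self[OF anti])
  have xy: "x \<noteq> y" "y \<noteq> 0" "x \<notin> span {y}"
  proof -
    show "x \<noteq> y" using ns self span_zero by metis
    show "y \<noteq> 0" using ns bilinear_rzero[OF b] span_zero by metis
    show "x \<notin> span {y}"
    proof
      assume "x \<in> span {y}"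
      then obtain s where "x = s *\<^sub>R y" by (auto simp: span_insert)
      then have "br x y = 0" by (simp add: bl self)
      then show False using ns span_zero by metis
    qed
  qed
  let ?z = "br x y"
  have zx: "?z \<noteq> x" "?z \<noteq> y" using ns span_base[of _ "{x, y}"] by auto
  have "independent {?z, x, y}"
    using ns xy by (auto simp: independent_insert)
  then have ind: "independent {x, y, ?z}" by (simp add: insert_commute)
  have "card {x, y, ?z} = 3" using xy zx by auto
  from linear_frame_through[OF ind this] obtain F F' :: "'e \<Rightarrow> 'e" and e f g where
    F: "linear F" "linear F'" "\<And>v. F (F' v) = v" "\<And>v. F' (F v) = v" and
    B: "e \<in> Basis" "f \<in> Basis" "g \<in> Basis" "e \<noteq> f" "e \<noteq> g" "f \<noteq> g" and Fx: "F e = x" "F f = y" "F g = ?z"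
    by metis
  \<comment> \<open>The exponents of \<open>t\<close>: the structure constant with indices \<open>i\<close>, \<open>j\<close>, \<open>k\<close> is multiplied by \<open>t\<close> to the
     power \<open>w i + w j - w k\<close>, which is never negative, and is zero only if \<open>i\<close> and \<open>j\<close> are among
     \<open>e\<close>, \<open>f\<close> while \<open>k\<close> is not.\<close>
  define w where "w b = (if b = e \<or> b = f then 1 else 2 :: nat)" for b
  define E where "E t v = F (scaling w t v)" for t v
  define E' where "E' t v = scaling w (inverse t) (F' v)" for t v
  have lE: "linear (E t)" "linear (E' t)" for t
    using linear_compose[OF scaling_linear F(1)] linear_compose[OF F(2) scaling_linear]
    by (simp_all add: E_def[abs_def] E'_def[abs_def] o_def)
  have EE': "E t (E' t v) = v" "E' t (E t v) = v" if "t \<noteq> 0" for t v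
    using scaling_inverse[OF that, of w] scaling_inverse[of "inverse t" w] that by (simp_all add: E_def E'_def F)
  define brt where "brt t v v' = E' t (br (E t v) (E t v'))" for t v v'
  have bt: "bilinear (brt t)" for t
    by (simp add: bilinear_def linear_iff brt_def linear_add[OF lE(1)] linear_add[OF lE(2)]
        linear_scale[OF lE(1)] linear_scale[OF lE(2)] bl)
  have at: "brt t v v' = - brt t v' v" for t v v'
    unfolding brt_def using anti[of "E t v" "E t v'"] linear_neg[OF lE(2)] by metis
  define \<beta> where "\<beta> i j k = F' (br (F i) (F j)) \<bullet> k" for i j k
  have sc: "brt t i j \<bullet> k = t ^ w i * t ^ w j * inverse t ^ w k * \<beta> i j k"
    if "i \<in> Basis" "j \<in> Basis" "k \<in> Basis" for t i j k
    using that
    by (simp add: brt_def E_def E'_def scaling_inner scaling_Basis linear_scale[OF F(1)] linear_scale[OF F(2)] bl \<beta>_def)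
  have \<beta>z: "\<beta> e f k = (if k = g then 1 else 0)" "\<beta> f e k = (if k = g then -1 else 0)" if "k \<in> Basis" for k
  proof -
    have "F' (br x y) = g" using F(4)[of g] Fx by simp
    moreover have "F' (br y x) = - F' (br x y)" by (subst anti) (rule linear_neg[OF F(2)])
    ultimately show "\<beta> e f k = (if k = g then 1 else 0)" "\<beta> f e k = (if k = g then -1 else 0)"
      using that B by (auto simp: \<beta>_def Fx inner_Basis)
  qed
  have lim: "((\<lambda>t. brt t i j \<bullet> k) \<longlongrightarrow> heisenberg e f g i j k) (at_right 0)"
    if ijk: "i \<in> Basis" "j \<in> Basis" "k \<in> Basis" for i j k
  proof (cases "w i + w j = w k")
    case True
    then have ij: "i = e \<or> i = f" "j = e \<or> j = f" "k \<noteq> e" "k \<noteq> f"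
      by (auto simp: w_def split: if_splits)
    have "\<beta> i j k = heisenberg e f g i j k"
      using ij ijk B by (auto simp: heisenberg_def \<beta>z) (auto simp: \<beta>_def self linear_0[OF F(2)])
    moreover have "brt t i j \<bullet> k = \<beta> i j k" if "t > 0" for t
      using that by (simp add: sc[OF ijk] True flip: power_add) (simp add: field_simps)
    ultimately show ?thesis
      by (intro tendsto_eventually) (auto simp: eventually_at_right_less eventually_at_filter)
  next
    case False
    then obtain n where n: "w i + w j = w k + Suc n"
      by (auto simp: w_def split: if_splits)
    have h0: "heisenberg e f g i j k = 0"
      using False B by (auto simp: heisenberg_def w_def)
    have "((\<lambda>t::real. t ^ Suc n * \<beta> i j k) \<longlongrightarrow> 0 ^ Suc n * \<beta> i j k) (at_right 0)"
      by (intro tendsto_intros)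
    then have "((\<lambda>t::real. t ^ Suc n * \<beta> i j k) \<longlongrightarrow> 0) (at_right 0)" by simp
    moreover have "brt t i j \<bullet> k = t ^ Suc n * \<beta> i j k" if "t > 0" for t
    proof -
      have "t ^ w i * t ^ w j * inverse t ^ w k = t ^ Suc n"
        using that by (simp add: n power_inverse flip: power_add) (simp add: power_add field_simps)
      then show ?thesis by (simp only: sc[OF ijk])
    qed
    then have "\<forall>\<^sub>F t in at_right 0. t ^ Suc n * \<beta> i j k = brt t i j \<bullet> k"
      by (auto simp: eventually_at_filter)
    ultimately show ?thesis unfolding h0 by (rule Lim_transform_eventually)
  qed
  have "\<forall>\<^sub>F t in at_right 0. plane_curv (\<lambda>i j k. brt t i j \<bullet> k) e f < 0"
    by (rule order_tendstoD(2)[OF plane_curv_tendsto[OF lim B(1,2)]])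
      (use plane_curv_heisenberg_neg[OF B] in auto)
  moreover have "\<forall>\<^sub>F t in at_right 0. plane_curv (\<lambda>i j k. brt t i j \<bullet> k) e g > 0"
    by (rule order_tendstoD(1)[OF plane_curv_tendsto[OF lim B(1,3)]])
      (use plane_curv_heisenberg_pos[OF B] in auto)
  moreover have "\<forall>\<^sub>F t :: real in at_right 0. t > 0" by (rule eventually_at_right_less)
  ultimately have "\<forall>\<^sub>F t in at_right 0. plane_curv (\<lambda>i j k. brt t i j \<bullet> k) e f < 0 \<and>
      plane_curv (\<lambda>i j k. brt t i j \<bullet> k) e g > 0 \<and> t > 0"
    by (intro eventually_conj)
  then obtain t where t: "plane_curv (\<lambda>i j k. brt t i j \<bullet> k) e f < 0"
    "plane_curv (\<lambda>i j k. brt t i j \<bullet> k) e g > 0" "t > 0"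
    using eventually_happens[of _ "at_right (0::real)"] by auto
  then have t0: "t \<noteq> 0" by simp
  note EE = EE'[OF t0]
  have lc: "lc_product (\<lambda>v w. E' t (br (E t v) (E t w))) (\<bullet>) (koszul (brt t))"
    using lc_product_koszul[OF bt at] by (simp add: brt_def[abs_def])
  note tr = transport_lc_product[OF lE EE lc]
  have i: "indep2 (E t u) (E t v)" if "u \<in> Basis" "v \<in> Basis" "u \<noteq> v" for u v
    by (rule indep2_linear_image[OF lE(1) _ indep2_Basis[OF that]]) (metis EE(2) linear_0[OF lE(2)])
  show ?thesis
  proof (rule that[OF tr(1,2)])
    show "\<exists>v w. indep2 v w \<and> E' t (curv br (\<lambda>v w. E t (koszul (brt t) (E' t v) (E' t w))) v w w) \<bullet> E' t v < 0"
      using i[OF B(1,2,4)] t(1) tr(3)[of e f] curv_koszul[OF bt at, of t e f]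
      by (intro exI[of _ "E t e"] exI[of _ "E t f"]) (simp add: brt_def[abs_def])
    show "\<exists>v w. indep2 v w \<and> E' t (curv br (\<lambda>v w. E t (koszul (brt t) (E' t v) (E' t w))) v w w) \<bullet> E' t v > 0"
      using i[OF B(1,3,5)] t(2) tr(3)[of e g] curv_koszul[OF bt at, of t e g]
      by (intro exI[of _ "E t e"] exI[of _ "E t g"]) (simp add: brt_def[abs_def])
  qed
qed

lemma alternating_DIM_1:
  fixes h :: "'e::euclidean_space \<Rightarrow> 'e \<Rightarrow> 'f::real_vector"
  assumes "DIM('e) = 1" "bilinear h" "\<And>v. h v v = 0"
  shows "h x y = 0"
proof -
  obtain b where b: "(Basis :: 'e set) = {b}" using assms(1) by (auto simp: card_1_singleton_iff)
  have "v = (v \<bullet> b) *\<^sub>R b" for v using euclidean_representation[of v] unfolding b by simp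
  then have "h x y = h ((x \<bullet> b) *\<^sub>R b) ((y \<bullet> b) *\<^sub>R b)" by metis
  then show ?thesis by (simp add: bilinear_lmul[OF assms(2)] bilinear_rmul[OF assms(2)] assms(3))
qed

text \<open>The bracket \<open>[x,y] = \<alpha>(x) y - \<alpha>(y) x\<close>, where the vector \<open>a\<close> represents the linear form \<open>\<alpha>\<close>.\<close>

definition special_bracket :: "'e::euclidean_space \<Rightarrow> 'e \<Rightarrow> 'e \<Rightarrow> 'e" where
  "special_bracket a x y = (a \<bullet> x) *\<^sub>R y - (a \<bullet> y) *\<^sub>R x"

lemma bilinear_special_bracket: "bilinear (special_bracket a)"
  by (simp add: bilinear_def linear_iff special_bracket_def inner_add_right algebra_simps)

lemma special_bracket_self [simp]: "special_bracket a x x = 0"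
  by (simp add: special_bracket_def)

text \<open>The operator induced by \<open>br x\<close> on the quotient by the line of \<open>x\<close> has each vector as an
  eigenvector, so it is a scalar. In an orthonormal basis, the sum of two basis vectors shows
  that their eigenvalues agree.\<close>

lemma bracket_in_span_special:
  fixes br :: "'e::euclidean_space \<Rightarrow> 'e \<Rightarrow> 'e"
  assumes b: "bilinear br" and anti: "\<And>v w. br v w = - br w v"
    and span: "\<And>x y. br x y \<in> span {x, y}" and dim: "DIM('e) \<noteq> 1"
  shows "\<exists>a. br = special_bracket a"
proof -
  have self: "br v v = 0" for v by (rule antisymmetric_self[OF anti])
  have ex: "\<exists>j. j \<in> Basis \<and> j \<noteq> i" if "i \<in> Basis" for i :: 'e
  proof (rule ccontr)
    assume "\<not> ?thesis"
    then have "(Basis :: 'e set) = {i}" using that by blast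
    then have "DIM('e) = card {i}" by (rule arg_cong)
    then show False using dim by simp
  qed
  define s where "s i = (SOME j. j \<in> Basis \<and> j \<noteq> i)" for i :: 'e
  have s: "s i \<in> Basis" "s i \<noteq> i" if "i \<in> Basis" for i
    using someI_ex[OF ex[OF that]] by (auto simp: s_def)
  define \<alpha> where "\<alpha> i = br i (s i) \<bullet> s i" for i
  have off: "br i j \<bullet> k = 0" if "i \<in> Basis" "j \<in> Basis" "k \<in> Basis" "k \<noteq> i" "k \<noteq> j" for i j k
  proof -
    obtain u t where "br i j = u *\<^sub>R i + t *\<^sub>R j" using span_pairE[OF span] by metis
    then show ?thesis using that by (simp add: inner_add_left inner_Basis)
  qed
  have q: "br i j \<bullet> j = \<alpha> i" if i: "i \<in> Basis" and j: "j \<in> Basis" and ij: "j \<noteq> i" for i j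
  proof (cases "j = s i")
    case False
    obtain u t where "br i (j + s i) = u *\<^sub>R i + t *\<^sub>R (j + s i)" using span_pairE[OF span] by metis
    then have e: "br i j + br i (s i) = u *\<^sub>R i + t *\<^sub>R (j + s i)" by (simp add: bilinear_radd[OF b])
    have "br i j \<bullet> j = t"
      using arg_cong[OF e, of "\<lambda>v. v \<bullet> j"] off[of i "s i" j] i j ij s[OF i] False
      by (simp add: inner_add_left inner_Basis)
    moreover have "br i (s i) \<bullet> s i = t"
      using arg_cong[OF e, of "\<lambda>v. v \<bullet> s i"] off[of i j "s i"] i j ij s[OF i] False
      by (simp add: inner_add_left inner_Basis)
    ultimately show ?thesis by (simp add: \<alpha>_def)
  qed (simp add: \<alpha>_def)
  define a where "a = (\<Sum>i\<in>Basis. \<alpha> i *\<^sub>R i)"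
  have a: "a \<bullet> i = \<alpha> i" if "i \<in> Basis" for i
    using that by (simp add: a_def inner_sum_left inner_Basis if_distrib cong: if_cong)
  have "br = special_bracket a"
  proof (rule bilinear_eq_stdbasis[OF b bilinear_special_bracket])
    fix i j :: 'e assume i: "i \<in> Basis" and j: "j \<in> Basis"
    show "br i j = special_bracket a i j"
    proof (cases "i = j")
      case False
      show ?thesis
      proof (rule euclidean_eqI)
        fix k :: 'e assume k: "k \<in> Basis"
        have "br i j \<bullet> i = - \<alpha> j" using q[OF j i False] anti[of i j] by simp
        then show "br i j \<bullet> k = special_bracket a i j \<bullet> k"
          using q[OF i j] off[OF i j k] i j k False
          by (cases "k = i"; cases "k = j") (auto simp: special_bracket_def a inner_diff_left inner_Basis)
      qed
    qed (simp add: self)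
  qed
  then show ?thesis ..
qed

lemma inner_form_representation:
  assumes B: "inner_form (B :: 'e::euclidean_space \<Rightarrow> 'e \<Rightarrow> real)"
  obtains A where "\<And>z. B A z = a \<bullet> z"
proof -
  have bl: "bilinear B" using B by (simp add: inner_form_def)
  define T where "T v = (\<Sum>b\<in>Basis. B v b *\<^sub>R b)" for v
  have T: "T v \<bullet> z = B v z" for v z
    unfolding T_def by (rule linear_functional_inner) (use bl in \<open>simp add: bilinear_def\<close>)
  have lT: "linear T"
    by (rule linearI) (simp_all add: T_def bilinear_ladd[OF bl] bilinear_lmul[OF bl]
        scaleR_add_left sum.distrib scaleR_sum_right)
  have "v = 0" if "T v = 0" for v
    using T[of v v] that B by (force simp: inner_form_def)
  then have "inj T" using lT by (simp add: linear_injective_0)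
  then have "surj T" using eucl.linear_injective_imp_surjective[OF lT _ refl] by simp
  then obtain A where "T A = a" by (metis surjD)
  then show ?thesis using that[of A] T[of A] by simp
qed

text \<open>For the special bracket, each metric has constant negative curvature \<open>- B A A\<close>, where \<open>A\<close>
  represents \<open>a\<close>.\<close>

lemma special_bracket_curvature:
  assumes B: "inner_form B" and a: "a \<noteq> 0"
  shows "\<exists>\<Gamma>. lc_product (special_bracket a) B \<Gamma> \<and>
    (\<forall>x y. indep2 x y \<longrightarrow> B (curv (special_bracket a) \<Gamma> x y y) x < 0)"
proof -
  obtain A where A: "\<And>z. B A z = a \<bullet> z" using inner_form_representation[OF B] by metis
  have bl: "bilinear B" and sym: "\<And>v w. B v w = B w v" using B by (auto simp: inner_form_def)
  have A': "B z A = a \<bullet> z" for z using A sym by metis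
  note bls = bilinear_ladd[OF bl] bilinear_radd[OF bl] bilinear_lmul[OF bl] bilinear_rmul[OF bl]
    bilinear_lsub[OF bl] bilinear_rsub[OF bl]
  define \<Gamma> where "\<Gamma> v w = B v w *\<^sub>R A - (a \<bullet> w) *\<^sub>R v" for v w
  have "a \<bullet> a \<noteq> 0" using a by simp
  then have "A \<noteq> 0" using A[of a] bilinear_lzero[OF bl] by metis
  then have pos: "a \<bullet> A > 0" using B unfolding A[symmetric] inner_form_def by blast
  have "bilinear \<Gamma>"
    by (simp add: bilinear_def linear_iff \<Gamma>_def bls inner_add_right algebra_simps)
  moreover have "\<Gamma> v w - \<Gamma> w v = special_bracket a v w" for v w
    using sym[of w v] by (simp add: \<Gamma>_def special_bracket_def)
  moreover have "B (\<Gamma> v w) z + B w (\<Gamma> v z) = 0" for v w z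
    using sym[of w v] by (simp add: \<Gamma>_def bls A A')
  ultimately have "lc_product (special_bracket a) B \<Gamma>" by (simp add: lc_product_def)
  moreover have "B (curv (special_bracket a) \<Gamma> x y y) x < 0" if xy: "indep2 x y" for x y
  proof -
    have "B (curv (special_bracket a) \<Gamma> x y y) x = - (a \<bullet> A) * (B x x * B y y - (B x y)\<^sup>2)"
      using sym[of y x]
      by (simp add: curv_def \<Gamma>_def special_bracket_def bls A A' inner_diff_right inner_add_right
          algebra_simps power2_eq_square)
    then show ?thesis using gram_pos[OF B xy] pos by (simp add: mult_pos_pos)
  qed
  ultimately show ?thesis by blast
qed

context left_invariant_frame
begin

theorem special_bracket_constant_sign:
  assumes "br = special_bracket a" "a \<noteq> 0"
  shows "constant_sign_curvature G"
  using constant_sign_negative special_bracket_curvature[OF _ assms(2)] assms(1) by metis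

text \<open>In dimension one, planes do not exist and all alternating brackets coincide. In higher dimension,
  \<open>mixed_curvature\<close> excludes brackets that leave the plane of their arguments, and \<open>a = 0\<close> would
  give a flat metric.\<close>

theorem constant_sign_special_bracket:
  assumes G: "constant_sign_curvature G"
  shows "\<exists>a. a \<noteq> 0 \<and> br = special_bracket a"
proof (cases "DIM('e) = 1")
  case True
  obtain a :: 'e where "a \<in> Basis" using nonempty_Basis by blast
  moreover have "br = special_bracket a"
    using alternating_DIM_1[OF True br_bilinear br_self]
      alternating_DIM_1[OF True bilinear_special_bracket special_bracket_self] by (simp add: fun_eq_iff)
  ultimately show ?thesis using nonzero_Basis by blast
next
  case False
  have "br x y \<in> span {x, y}" for x y
  proof (rule ccontr)
    assume "br x y \<notin> span {x, y}"
    from mixed_curvature[OF br_bilinear br_antisym this] obtain B \<Gamma> where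
      "inner_form B" "lc_product br B \<Gamma>"
      "\<exists>v w. indep2 v w \<and> B (curv br \<Gamma> v w w) v < 0" "\<exists>v w. indep2 v w \<and> B (curv br \<Gamma> v w w) v > 0"
      by metis
    then show False using constant_sign_algebraic[OF G, of B \<Gamma>] by (meson less_asym)
  qed
  then obtain a where a: "br = special_bracket a"
    using bracket_in_span_special[OF br_bilinear br_antisym _ False] by metis
  moreover have "a \<noteq> 0"
  proof
    assume "a = 0"
    then have br0: "br v w = 0" for v w by (simp add: a special_bracket_def)
    have lc: "lc_product br (\<bullet>) (\<lambda>v w. 0)"
      by (simp add: lc_product_def br0 bilinear_def linear_iff)
    obtain i j :: 'e where "i \<in> Basis" "j \<in> Basis" "i \<noteq> j"
    proof -
      have "\<not> is_singleton (Basis :: 'e set)" using False by (simp add: is_singleton_altdef)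
      then show ?thesis using that nonempty_Basis by (metis is_singletonI')
    qed
    then have "indep2 i j" by (rule indep2_Basis)
    then show False
      using constant_sign_algebraic[OF G inner_form_inner lc] by (auto simp: curv_def)
  qed
  ultimately show ?thesis by blast
qed

end

section \<open>Left invariant one-forms, contact and symplectic structures\<close>

text \<open>A form of degree \<open>2 n\<close> is evaluated on a sequence of fields of which only the first \<open>2 n\<close> may
  matter; exchanging entries outside of these leaves its value unchanged.\<close>

lemma two_form_power_cong:
  assumes "\<And>v v'. v 0 = v' 0 \<Longrightarrow> v 1 = v' 1 \<Longrightarrow> \<omega> v p = \<omega> v' p"
    and "\<And>i. i < 2 * n \<Longrightarrow> v i = v' i"
  shows "two_form_power \<omega> n v p = two_form_power \<omega> n v' p"
  using assms(2)
proof (induction n arbitrary: v v')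
  case (Suc n)
  have "\<omega> (\<lambda>i. v (\<sigma> i)) p = \<omega> (\<lambda>i. v' (\<sigma> i)) p \<and>
      two_form_power \<omega> n (\<lambda>i. v (\<sigma> (2 + i))) p = two_form_power \<omega> n (\<lambda>i. v' (\<sigma> (2 + i))) p"
    if \<sigma>: "\<sigma> permutes {..<2 + 2 * n}" for \<sigma>
  proof
    have lt: "\<sigma> i < 2 * Suc n" if "i < 2 + 2 * n" for i
      using permutes_in_image[OF \<sigma>, of i] that by simp
    show "\<omega> (\<lambda>i. v (\<sigma> i)) p = \<omega> (\<lambda>i. v' (\<sigma> i)) p"
      by (rule assms(1)) (intro Suc.prems lt; simp)+
    show "two_form_power \<omega> n (\<lambda>i. v (\<sigma> (2 + i))) p = two_form_power \<omega> n (\<lambda>i. v' (\<sigma> (2 + i))) p"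
      by (intro Suc.IH Suc.prems lt) simp
  qed
  then show ?case
    unfolding two_form_power.simps wedge_def
    by (intro arg_cong2[of _ _ _ _ "(/)"] sum.cong refl) simp
qed simp

lemma antisymmetric_sum_permutations:
  fixes f :: "(nat \<Rightarrow> nat) \<Rightarrow> real"
  assumes "i < N" "j < N" "\<And>\<tau>. \<tau> permutes {..<N} \<Longrightarrow> f (\<tau> \<circ> Transposition.transpose i j) = - f \<tau>"
  shows "(\<Sum>\<tau> | \<tau> permutes {..<N}. f \<tau>) = 0"
proof -
  have "(\<Sum>\<tau> | \<tau> permutes {..<N}. f \<tau>) = (\<Sum>\<tau> | \<tau> permutes {..<N}. f (\<tau> \<circ> Transposition.transpose i j))"
    by (rule sum_permutations_compose_right) (use assms in \<open>auto intro: permutes_swap_id\<close>)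
  also have "\<dots> = (\<Sum>\<tau> | \<tau> permutes {..<N}. - f \<tau>)"
    by (intro sum.cong refl assms(3)) simp
  finally show ?thesis by (simp add: sum_negf)
qed

text \<open>For \<open>\<omega> = \<alpha> \<and> \<eta>\<close>, each term of \<open>\<omega>\<^sup>n \<and> \<eta>\<close> contains \<open>\<eta>\<close> twice, so it cancels against the term
  in which the two arguments of \<open>\<eta>\<close> are exchanged.\<close>

lemma contact_form_vanishes:
  fixes \<alpha> \<eta> :: "'a vf \<Rightarrow> real"
  assumes \<omega>: "\<And>w. \<omega> w p = \<alpha> (w 0) * \<eta> (w 1) - \<alpha> (w 1) * \<eta> (w 0)"
    and \<theta>: "\<And>w. \<theta> w p = \<eta> (w 0)" and n: "n \<noteq> 0"
  shows "wedge (2 * n) 1 (two_form_power \<omega> n) \<theta> v p = 0"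
proof -
  obtain m where m: "n = Suc m" using n by (cases n) auto
  define N where "N = 2 * n + 1"
  define Q where "Q \<tau> = two_form_power \<omega> m (\<lambda>i. v (\<tau> (2 + i))) p" for \<tau> :: "nat \<Rightarrow> nat"
  define f where "f \<tau> = of_int (sign \<tau>) * \<omega> (\<lambda>i. v (\<tau> i)) p * Q \<tau> * \<eta> (v (\<tau> (2 * n)))" for \<tau>
  have sgn: "sign (\<tau> \<circ> \<sigma>) = sign \<tau> * sign \<sigma>"
    if "\<tau> permutes {..<N}" "\<sigma> permutes {..<N}" for \<tau> \<sigma>
    using that by (intro sign_compose permutes_imp_permutation[of "{..<N}"]) auto
  have Q: "Q (\<tau> \<circ> Transposition.transpose i (2 * n)) = Q \<tau>" if "i < 2" for \<tau> i
    unfolding Q_def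
    by (rule two_form_power_cong) (use that m in \<open>auto simp: \<omega> Transposition.transpose_def\<close>)
  have part: "(\<Sum>\<tau> | \<tau> permutes {..<N}. of_int (sign \<tau>) * (\<alpha> (v (\<tau> (1 - i))) * \<eta> (v (\<tau> i))) * Q \<tau> * \<eta> (v (\<tau> (2 * n)))) = 0"
    if i: "i = 0 \<or> i = 1" for i
  proof (rule antisymmetric_sum_permutations[of i N "2 * n"])
    show "i < N" "2 * n < N" using i m by (auto simp: N_def)
    fix \<tau> assume \<tau>: "\<tau> permutes {..<N}"
    define t where "t = Transposition.transpose i (2 * n)"
    have t: "t permutes {..<N}"
      unfolding t_def using i m by (intro permutes_swap_id) (auto simp: N_def)
    have "sign t = - 1" using i m by (auto simp: t_def sign_swap_id)
    then have s: "sign (\<tau> \<circ> t) = - sign \<tau>" by (simp add: sgn[OF \<tau> t])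
    have q: "Q (\<tau> \<circ> t) = Q \<tau>" unfolding t_def using i by (intro Q) auto
    have v: "t (1 - i) = 1 - i" "t i = 2 * n" "t (2 * n) = i"
      using i m by (auto simp: t_def Transposition.transpose_def)
    show "of_int (sign (\<tau> \<circ> t)) * (\<alpha> (v ((\<tau> \<circ> t) (1 - i))) * \<eta> (v ((\<tau> \<circ> t) i))) *
        Q (\<tau> \<circ> t) * \<eta> (v ((\<tau> \<circ> t) (2 * n)))
      = - (of_int (sign \<tau>) * (\<alpha> (v (\<tau> (1 - i))) * \<eta> (v (\<tau> i))) * Q \<tau> * \<eta> (v (\<tau> (2 * n))))"
      unfolding o_apply v s q by simp
  qed
  have f0: "(\<Sum>\<tau> | \<tau> permutes {..<N}. f \<tau>) = 0"
    using part[of 0] part[of 1]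
    by (simp add: f_def \<omega> algebra_simps sum_subtractf)
  have "(\<Sum>\<tau> | \<tau> permutes {..<N}. of_int (sign \<tau>) * two_form_power \<omega> n (\<lambda>i. v (\<tau> i)) p * \<eta> (v (\<tau> (2 * n)))) = 0"
  proof -
    let ?C = "fact 2 * fact (2 * m) :: real"
    \<comment> \<open>Unfolding one wedge product gives an inner sum over permutations \<open>\<sigma>\<close> that fix the last index;
       the outer sum absorbs them.\<close>
    have "(\<Sum>\<tau> | \<tau> permutes {..<N}. of_int (sign \<tau>) * two_form_power \<omega> n (\<lambda>i. v (\<tau> i)) p * \<eta> (v (\<tau> (2 * n))))
        = (\<Sum>\<tau> | \<tau> permutes {..<N}. \<Sum>\<sigma> | \<sigma> permutes {..<2 + 2 * m}. f (\<tau> \<circ> \<sigma>) / ?C)"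
    proof (intro sum.cong refl)
      fix \<tau> assume "\<tau> \<in> {\<tau>. \<tau> permutes {..<N}}"
      then have \<tau>: "\<tau> permutes {..<N}" by simp
      have "of_int (sign \<tau>) * (of_int (sign \<sigma>) * \<omega> (\<lambda>i. v (\<tau> (\<sigma> i))) p *
          two_form_power \<omega> m (\<lambda>i. v (\<tau> (\<sigma> (2 + i)))) p) * \<eta> (v (\<tau> (2 * n))) = f (\<tau> \<circ> \<sigma>)"
        if \<sigma>: "\<sigma> permutes {..<2 + 2 * m}" for \<sigma>
      proof -
        have "\<sigma> permutes {..<N}" by (rule permutes_subset[OF \<sigma>]) (auto simp: N_def m)
        moreover have "\<sigma> (2 * n) = 2 * n" by (rule permutes_not_in[OF \<sigma>]) (simp add: m)
        ultimately show ?thesis by (simp add: f_def Q_def sgn[OF \<tau>])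
      qed
      then show "of_int (sign \<tau>) * two_form_power \<omega> n (\<lambda>i. v (\<tau> i)) p * \<eta> (v (\<tau> (2 * n)))
          = (\<Sum>\<sigma> | \<sigma> permutes {..<2 + 2 * m}. f (\<tau> \<circ> \<sigma>) / ?C)"
        by (simp add: m wedge_def sum_distrib_left sum_distrib_right flip: sum_divide_distrib)
    qed
    also have "\<dots> = (\<Sum>\<sigma> | \<sigma> permutes {..<2 + 2 * m}. (\<Sum>\<tau> | \<tau> permutes {..<N}. f (\<tau> \<circ> \<sigma>)) / ?C)"
      by (subst sum.swap) (simp flip: sum_divide_distrib)
    also have "\<dots> = (\<Sum>\<sigma> | \<sigma> permutes {..<2 + 2 * m}. (\<Sum>\<tau> | \<tau> permutes {..<N}. f \<tau>) / ?C)"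
    proof (rule sum.cong[OF refl])
      fix \<sigma> assume "\<sigma> \<in> {\<sigma>. \<sigma> permutes {..<2 + 2 * m}}"
      then have "\<sigma> permutes {..<N}" by (auto intro: permutes_subset simp: N_def m)
      from sum_permutations_compose_right[OF this, of f]
      show "(\<Sum>\<tau> | \<tau> permutes {..<N}. f (\<tau> \<circ> \<sigma>)) / ?C = (\<Sum>\<tau> | \<tau> permutes {..<N}. f \<tau>) / ?C"
        by simp
    qed
    finally show ?thesis by (simp add: f0)
  qed
  then show ?thesis by (simp add: wedge_def \<theta> N_def)
qed

text \<open>Forms are specified on vector fields only, so identities between them may be used only for
  arguments that are vector fields.\<close>

lemma wedge_cong_fields:
  assumes "\<And>\<sigma>. \<sigma> permutes {..<k + l} \<Longrightarrow> \<alpha> (\<lambda>i. v (\<sigma> i)) p = \<alpha>' (\<lambda>i. v (\<sigma> i)) p"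
    and "\<And>\<sigma>. \<sigma> permutes {..<k + l} \<Longrightarrow> \<beta> (\<lambda>i. v (\<sigma> (k + i))) p = \<beta>' (\<lambda>i. v (\<sigma> (k + i))) p"
  shows "wedge k l \<alpha> \<beta> v p = wedge k l \<alpha>' \<beta>' v p"
  unfolding wedge_def using assms by (intro arg_cong2[of _ _ _ _ "(/)"] sum.cong refl) simp

lemma two_form_power_cong_fields:
  assumes "\<And>v. (\<And>i. v i \<in> V) \<Longrightarrow> \<omega> v p = \<omega>' v p" and "\<And>i. v i \<in> V"
  shows "two_form_power \<omega> n v p = two_form_power \<omega>' n v p"
  using assms(2)
proof (induction n arbitrary: v)
  case (Suc n)
  show ?case
    unfolding two_form_power.simps by (rule wedge_cong_fields; intro assms(1) Suc.IH Suc.prems)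
qed simp

context left_invariant_frame
begin

lemma left_invariant_one_form_eq:
  assumes "left_invariant_one_form G \<eta>"
  obtains k where "\<And>X p. X \<in> vector_fields G \<Longrightarrow> \<eta> X p = k \<bullet> c X p"
proof
  fix X p assume X: "X \<in> vector_fields G"
  have const: "\<eta> (L b) p = \<eta> (L b) (gone G)" for b
  proof -
    have "\<eta> (push G p (L b)) (gmult G p (gone G)) = \<eta> (L b) (gone G)"
      using assms L_vf unfolding left_invariant_one_form_def by blast
    then show ?thesis by (simp add: L_push)
  qed
  have "one_form G \<eta>" using assms by (simp add: left_invariant_one_form_def)
  from one_form_expand[OF this X, of p]
  have "\<eta> X p = (\<Sum>b\<in>Basis. (c X p \<bullet> b) * \<eta> (L b) (gone G))" by (simp only: const)
  then show "\<eta> X p = (\<Sum>b\<in>Basis. \<eta> (L b) (gone G) *\<^sub>R b) \<bullet> c X p"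
    by (simp add: inner_sum_right inner_commute[of _ "c X p"] mult.commute)
qed

lemma ext_deriv_left_invariant:
  assumes \<eta>: "\<And>X p. X \<in> vector_fields G \<Longrightarrow> \<eta> X p = k \<bullet> c X p"
    and X: "X \<in> vector_fields G" and Y: "Y \<in> vector_fields G"
  shows "ext_deriv \<eta> X Y p = - (k \<bullet> br (c X p) (c Y p))"
proof -
  have d: "Z (\<eta> W) p = k \<bullet> der Z (c W) p" if Z: "Z \<in> vector_fields G" and W: "W \<in> vector_fields G" for Z W
  proof -
    have "\<eta> W = (\<lambda>p. k \<bullet> c W p)" using \<eta>[OF W] by auto
    moreover have "bilinear (\<lambda>x y :: 'e. x \<bullet> y)"
      by (rule conjunct1[OF inner_form_inner[unfolded inner_form_def]])
    moreover have "der Z (\<lambda>p. k) p = 0" by (simp add: der_def vf_const[OF Z])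
    moreover have "smooth_vec (\<lambda>p. k)" by (simp add: smooth_vec_def smooth_funs_const)
    ultimately show ?thesis
      using vf_bilinear[OF Z, of "(\<bullet>)" "\<lambda>p. k" "c W" p] W by simp
  qed
  show ?thesis
    by (simp add: ext_deriv_def d X Y \<eta> lie_bracket_in_vector_fields c_bracket inner_diff_right inner_add_right)
qed

lemma no_left_invariant_contact:
  assumes br: "br = special_bracket a" and dim: "DIM('e) \<noteq> 1"
  shows "\<not> left_invariant_contact G \<eta>"
proof
  assume C: "left_invariant_contact G \<eta>"
  then obtain k where k: "\<And>X p. X \<in> vector_fields G \<Longrightarrow> \<eta> X p = k \<bullet> c X p"
    using left_invariant_one_form_eq unfolding left_invariant_contact_def by metis
  obtain n v where n: "DIM('e) = 2 * n + 1" and v: "\<And>i. v i \<in> vector_fields G"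
    and nz: "wedge (2 * n) 1 (two_form_power (\<lambda>v. ext_deriv \<eta> (v 0) (v 1)) n) (\<lambda>v. \<eta> (v 0)) v (gone G) \<noteq> 0"
    using C unfolding left_invariant_contact_def by blast
  let ?p = "gone G"
  define \<omega> :: "'a dform" where "\<omega> w q = (- (a \<bullet> c (w 0) ?p)) * (k \<bullet> c (w 1) ?p) - (- (a \<bullet> c (w 1) ?p)) * (k \<bullet> c (w 0) ?p)" for w q
  define \<theta> :: "'a dform" where "\<theta> w q = k \<bullet> c (w 0) ?p" for w q
  have e: "ext_deriv \<eta> (w 0) (w 1) ?p = \<omega> w ?p" if "\<And>i. w i \<in> vector_fields G" for w :: "nat \<Rightarrow> 'a vf"
    using ext_deriv_left_invariant[OF k that that, where p = ?p]
    by (simp add: \<omega>_def br special_bracket_def inner_diff_right algebra_simps)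
  have "wedge (2 * n) 1 (two_form_power (\<lambda>v. ext_deriv \<eta> (v 0) (v 1)) n) (\<lambda>v. \<eta> (v 0)) v ?p
      = wedge (2 * n) 1 (two_form_power \<omega> n) \<theta> v ?p"
    by (intro wedge_cong_fields two_form_power_cong_fields[where V = "vector_fields G"])
      (auto simp: e[unfolded One_nat_def] v k \<theta>_def)
  also have "\<dots> = 0"
    by (rule contact_form_vanishes[where \<alpha> = "\<lambda>X. - (a \<bullet> c X ?p)" and \<eta> = "\<lambda>X. k \<bullet> c X ?p"])
      (use n dim in \<open>auto simp: \<omega>_def \<theta>_def\<close>)
  finally show False using nz by simp
qed

text \<open>The rank of \<open>d\<eta>\<close> is at most two: in dimension at least three some \<open>z\<close> is orthogonal to \<open>a\<close> and to
  the vector \<open>k\<close> representing \<open>\<eta>\<close>, and in dimension one all two-forms vanish.\<close>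

lemma no_left_invariant_exact_symplectic:
  assumes br: "br = special_bracket a" and dim: "DIM('e) \<noteq> 2"
  shows "\<not> left_invariant_exact_symplectic G \<eta>"
proof
  assume S: "left_invariant_exact_symplectic G \<eta>"
  then obtain k where k: "\<And>X p. X \<in> vector_fields G \<Longrightarrow> \<eta> X p = k \<bullet> c X p"
    using left_invariant_one_form_eq unfolding left_invariant_exact_symplectic_def by metis
  obtain z where z: "z \<noteq> 0" "\<And>y. k \<bullet> br z y = 0"
  proof (cases "DIM('e) = 1")
    case True
    obtain z :: 'e where "z \<in> Basis" using nonempty_Basis by blast
    then show ?thesis
      using that[of z] alternating_DIM_1[OF True br_bilinear br_self] nonzero_Basis by auto
  next
    case False
    have "card {a, k} \<le> 2" using card_insert_le_m1[of 2 "{k}" a] by simp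
    then have "dim {a, k} \<le> 2" using dim_le_card'[of "{a, k}"] by simp
    moreover have "DIM('e) \<noteq> 0" by simp
    ultimately have "dim {a, k} < DIM('e)" using dim False by linarith
    then obtain z where "z \<noteq> 0" "\<And>y. y \<in> span {a, k} \<Longrightarrow> orthogonal z y"
      using orthogonal_to_subspace_exists by blast
    then have "z \<noteq> 0" "a \<bullet> z = 0" "k \<bullet> z = 0"
      by (auto simp: orthogonal_def inner_commute span_base)
    then show ?thesis using that[of z] by (simp add: br special_bracket_def inner_diff_right)
  qed
  have "ext_deriv \<eta> (L z) Y (gone G) = 0" if "Y \<in> vector_fields G" for Y
    using ext_deriv_left_invariant[OF k L_vf that] z by simp
  then have "vanishes_at (L z) (gone G)"
    using S L_vf unfolding left_invariant_exact_symplectic_def symplectic_form_def by blast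
  then show False using z by (simp add: vanishes_at_iff)
qed

lemma lie_algebra_eq_L:
  assumes "X \<in> lie_algebra G"
  shows "X = L (c X (gone G))"
proof (rule vf_eqI)
  have X: "X \<in> vector_fields G" "\<And>a. push G a X = X" using assms by (auto simp: lie_algebra_def)
  then show "X \<in> vector_fields G" by simp
  show "c X p = c (L (c X (gone G))) p" for p
    using c_push[OF X(1), of p "gone G"] X(2) by simp
qed simp

end

section \<open>Uniqueness and existence\<close>

text \<open>An isometry between the kernels of the two linear forms, extended by a map of \<open>a\<close> to a multiple
  of \<open>b\<close>.\<close>

lemma linear_isomorphism_matching:
  fixes a :: "'e::euclidean_space" and b :: "'f::euclidean_space"
  assumes "a \<noteq> 0" "b \<noteq> 0" "DIM('e) = DIM('f)"
  obtains h h' where "linear h" "\<And>v. b \<bullet> h v = a \<bullet> v" "\<And>v. h' (h v) = v" "\<And>w. h (h' w) = w"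
proof -
  let ?S = "{x. a \<bullet> x = 0}" and ?T = "{x. b \<bullet> x = 0}"
  have d: "dim ?S = dim ?T" using assms by (simp add: dim_hyperplane)
  obtain f g where f: "linear f" and g: "linear g" and fg: "f ` ?S = ?T" "g ` ?T = ?S"
    "\<And>x. x \<in> ?S \<Longrightarrow> g (f x) = x" "\<And>x. x \<in> ?T \<Longrightarrow> f (g x) = x"
    by (rule isometries_subspaces[OF subspace_hyperplane subspace_hyperplane d]) (rule that; assumption)
  define h where "h v = f (v - ((a \<bullet> v) / (a \<bullet> a)) *\<^sub>R a) + ((a \<bullet> v) / (b \<bullet> b)) *\<^sub>R b" for v
  define h' where "h' w = g (w - ((b \<bullet> w) / (b \<bullet> b)) *\<^sub>R b) + ((b \<bullet> w) / (a \<bullet> a)) *\<^sub>R a" for w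
  have a: "a \<bullet> (v - ((a \<bullet> v) / (a \<bullet> a)) *\<^sub>R a) = 0" for v
    using assms(1) by (simp add: inner_diff_right)
  have b: "b \<bullet> (w - ((b \<bullet> w) / (b \<bullet> b)) *\<^sub>R b) = 0" for w
    using assms(2) by (simp add: inner_diff_right)
  have bf: "b \<bullet> f x = 0" if "a \<bullet> x = 0" for x using fg(1) that by blast
  have ag: "a \<bullet> g x = 0" if "b \<bullet> x = 0" for x using fg(2) that by blast
  have bh: "b \<bullet> h v = a \<bullet> v" for v
    using assms(2) bf[OF a] by (simp add: h_def inner_add_right)
  have ah: "a \<bullet> h' w = b \<bullet> w" for w
    using assms(1) ag[OF b] by (simp add: h'_def inner_add_right)
  show ?thesis
  proof (rule that[OF _ bh])
    show "linear h"
      by (rule linearI)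
        (simp_all add: h_def linear_add[OF f] linear_diff[OF f] linear_scale[OF f] inner_add_right
          algebra_simps add_divide_distrib)
    have "h' (h v) = g (f (v - ((a \<bullet> v) / (a \<bullet> a)) *\<^sub>R a)) + ((a \<bullet> v) / (a \<bullet> a)) *\<^sub>R a" for v
      unfolding h'_def bh by (simp add: h_def)
    then show "h' (h v) = v" for v using fg(3) a by simp
    have "h (h' w) = f (g (w - ((b \<bullet> w) / (b \<bullet> b)) *\<^sub>R b)) + ((b \<bullet> w) / (b \<bullet> b)) *\<^sub>R b" for w
      unfolding h_def ah by (simp add: h'_def)
    then show "h (h' w) = w" for w using fg(4) b by simp
  qed
qed

lemma special_brackets_locally_isomorphic:
  fixes G :: "('a::{t2_space,second_countable_topology}, 'e::euclidean_space) lie_data"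
    and H :: "('b::{t2_space,second_countable_topology}, 'f::euclidean_space) lie_data"
  assumes "left_invariant_frame G L c (special_bracket a)" "left_invariant_frame H M d (special_bracket b)"
    and "a \<noteq> 0" "b \<noteq> 0" "DIM('e) = DIM('f)"
  shows "locally_isomorphic G H"
proof -
  interpret G: left_invariant_frame G L c "special_bracket a" by fact
  interpret H: left_invariant_frame H M d "special_bracket b" by fact
  obtain h h' where h: "linear h" "\<And>v. b \<bullet> h v = a \<bullet> v" and h': "\<And>v. h' (h v) = v" "\<And>w. h (h' w) = w"
    using linear_isomorphism_matching[OF assms(3-5)] by metis
  have hbr: "h (special_bracket a v w) = special_bracket b (h v) (h w)" for v w
    by (simp add: special_bracket_def linear_diff[OF h(1)] linear_scale[OF h(1)] h(2))
  define F where "F X = M (h (c X (gone G)))" for X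
  have FL: "F (L v) = M (h v)" for v by (simp add: F_def)
  have "bij_betw F (lie_algebra G) (lie_algebra H)"
  proof (rule bij_betw_byWitness[where f' = "\<lambda>Y. L (h' (d Y (gone H)))"])
    show "\<forall>X\<in>lie_algebra G. L (h' (d (F X) (gone H))) = X"
      using G.lie_algebra_eq_L by (simp add: F_def h')
    show "\<forall>Y\<in>lie_algebra H. F (L (h' (d Y (gone H)))) = Y"
      using H.lie_algebra_eq_L by (simp add: FL h')
  qed (auto simp: F_def G.L_left_invariant H.L_left_invariant)
  moreover have "F (vplus X Y) = vplus (F X) (F Y) \<and> F (lie_bracket X Y) = lie_bracket (F X) (F Y)"
    if X: "X \<in> lie_algebra G" and Y: "Y \<in> lie_algebra G" for X Y
  proof -
    obtain v w where "X = L v" "Y = L w"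
      using G.lie_algebra_eq_L[OF X] G.lie_algebra_eq_L[OF Y] by blast
    then show ?thesis
      by (simp add: FL G.bracket H.bracket hbr linear_add[OF h(1)] flip: G.L_add H.L_add)
  qed
  moreover have "F (vscale (\<lambda>p. k) X) = vscale (\<lambda>p. k) (F X)" if X: "X \<in> lie_algebra G" for k X
  proof -
    obtain v where "X = L v" using G.lie_algebra_eq_L[OF X] by blast
    then show ?thesis by (simp add: FL linear_scale[OF h(1)] flip: G.L_scale H.L_scale)
  qed
  ultimately show ?thesis unfolding locally_isomorphic_def by blast
qed

text \<open>The semidirect product of the line of a unit vector \<open>e\<close> with its orthogonal complement, on
  which \<open>s e\<close> acts by the factor \<open>exp s\<close>. With an invariant metric this is hyperbolic space.\<close>

definition hyperbolic_group :: "'e::euclidean_space \<Rightarrow> ('e, 'e) lie_data" where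
  "hyperbolic_group e = \<lparr>
     gmult = (\<lambda>p q. p + (q \<bullet> e) *\<^sub>R e + exp (p \<bullet> e) *\<^sub>R (q - (q \<bullet> e) *\<^sub>R e)),
     gone = 0,
     ginv = (\<lambda>p. - (p \<bullet> e) *\<^sub>R e + (- exp (- (p \<bullet> e))) *\<^sub>R (p - (p \<bullet> e) *\<^sub>R e)),
     atlas = {(UNIV, \<lambda>x. x)} \<rparr>"

lemma inv_ident: "inv (\<lambda>x. x) = (\<lambda>x. x)"
  by (simp add: inv_into_def)

lemma hyperbolic_group_lie_group:
  assumes "norm e = 1"
  shows "lie_group (hyperbolic_group e)"
proof -
  have e: "e \<bullet> e = 1" using assms by (simp add: dot_square_norm)
  let ?K = "hyperbolic_group e"
  have "group (gmult ?K) (gone ?K) (ginv ?K)"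
    by unfold_locales
      (simp_all add: hyperbolic_group_def inner_add_left inner_diff_left e exp_add algebra_simps flip: exp_minus)
  moreover have "smooth_atlas (atlas ?K)"
    by (simp add: smooth_atlas_def hyperbolic_group_def inv_ident homeomorphism_def o_def
        smooth_on_bounded_linear)
  moreover have "smooth_map (prod_atlas (atlas ?K) (atlas ?K)) (atlas ?K) (\<lambda>(a, b). gmult ?K a b)"
  proof -
    have at: "prod_atlas (atlas ?K) (atlas ?K) = {(UNIV, \<lambda>x. x)}"
      by (auto simp: prod_atlas_def hyperbolic_group_def map_prod_def)
    have ex: "smooth_on UNIV (\<lambda>z. exp (fst z \<bullet> e))"
      by (rule smooth_on_compose[OF smooth_on_bounded_linear smooth_on_exp])
        (auto intro: bounded_linear_inner_left_comp bounded_linear_fst)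
    have l: "bounded_linear (\<lambda>z. fst z + (snd z \<bullet> e) *\<^sub>R e)" "bounded_linear (\<lambda>z. snd z - (snd z \<bullet> e) *\<^sub>R e)"
      by (intro bounded_linear_add bounded_linear_sub bounded_linear_fst bounded_linear_snd
          bounded_linear_scaleR_const bounded_linear_inner_left_comp)+
    note sl = smooth_on_bounded_linear[OF open_UNIV]
    have "smooth_on UNIV (\<lambda>z. (fst z + (snd z \<bullet> e) *\<^sub>R e) + exp (fst z \<bullet> e) *\<^sub>R (snd z - (snd z \<bullet> e) *\<^sub>R e))"
      by (rule smooth_on_add[OF open_UNIV sl[OF l(1)] smooth_on_scaleR[OF open_UNIV ex sl[OF l(2)]]])
    then have s: "smooth_on UNIV (\<lambda>(a, b). gmult ?K a b)"
      by (simp add: hyperbolic_group_def case_prod_unfold)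
    then show ?thesis
      by (simp add: smooth_map_def at smooth_on_continuous)
        (simp add: hyperbolic_group_def inv_ident o_def)
  qed
  moreover have "smooth_map (atlas ?K) (atlas ?K) (ginv ?K)"
  proof -
    have ex: "smooth_on UNIV (\<lambda>p. exp (- (p \<bullet> e)))"
      by (rule smooth_on_compose[OF smooth_on_bounded_linear smooth_on_exp])
        (auto intro: bounded_linear_minus bounded_linear_inner_left)
    have l: "bounded_linear (\<lambda>p. (- (p \<bullet> e)) *\<^sub>R e)" "bounded_linear (\<lambda>p. - (p - (p \<bullet> e) *\<^sub>R e))"
      by (intro bounded_linear_minus bounded_linear_sub bounded_linear_ident
          bounded_linear_scaleR_const bounded_linear_inner_left)+
    note sl = smooth_on_bounded_linear[OF open_UNIV]
    have "smooth_on UNIV (\<lambda>p. (- (p \<bullet> e)) *\<^sub>R e + exp (- (p \<bullet> e)) *\<^sub>R (- (p - (p \<bullet> e) *\<^sub>R e)))"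
      by (rule smooth_on_add[OF open_UNIV sl[OF l(1)] smooth_on_scaleR[OF open_UNIV ex sl[OF l(2)]]])
    then have s: "smooth_on UNIV (ginv ?K)"
      by (simp add: hyperbolic_group_def algebra_simps)
    then show ?thesis
      by (simp add: smooth_map_def smooth_on_continuous)
        (simp add: hyperbolic_group_def inv_ident o_def)
  qed
  ultimately show ?thesis by (simp add: lie_group_def)
qed

text \<open>The bracket is read off from the action of left invariant fields on linear functions.\<close>

lemma hyperbolic_group_constant_sign:
  fixes e :: "'e::euclidean_space"
  assumes "norm e = 1"
  shows "constant_sign_curvature (hyperbolic_group e)"
proof -
  have e: "e \<bullet> e = 1" using assms by (simp add: dot_square_norm)
  let ?K = "hyperbolic_group e"
  have one: "gone ?K = 0" and mult: "gmult ?K p q = p + (q \<bullet> e) *\<^sub>R e + exp (p \<bullet> e) *\<^sub>R (q - (q \<bullet> e) *\<^sub>R e)" for p q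
    by (simp_all add: hyperbolic_group_def)
  interpret lie_grp_chart ?K UNIV "\<lambda>x. x" 1
    by unfold_locales
      (use hyperbolic_group_lie_group[OF assms] in \<open>simp_all add: hyperbolic_group_def\<close>)
  interpret left_invariant_frame ?K frame coeff frame_bracket by (rule left_invariant_frame)
  have x0: "x0 = 0" by (simp add: x0_def one)
  have smooth: "f \<in> smooth_funs ?K" if "smooth_on UNIV f" for f
    using that by (simp add: smooth_funs_def hyperbolic_group_def inv_ident o_def)
  have lin: "(\<lambda>p. p \<bullet> u) \<in> smooth_funs ?K" for u
    by (intro smooth smooth_on_bounded_linear bounded_linear_inner_left open_UNIV)
  have 1: "frame v (\<lambda>p. p \<bullet> u) p = (v \<bullet> e) * (e \<bullet> u) + exp (p \<bullet> e) * ((v - (v \<bullet> e) *\<^sub>R e) \<bullet> u)" for v u p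
  proof (rule frame_eqI[OF lin, where D = "\<lambda>v. (v \<bullet> e) * (e \<bullet> u) + exp (p \<bullet> e) * ((v - (v \<bullet> e) *\<^sub>R e) \<bullet> u)"])
    show "((\<lambda>x. gmult ?K p (inv_into UNIV (\<lambda>x. x) x) \<bullet> u) has_derivative
        (\<lambda>v. (v \<bullet> e) * (e \<bullet> u) + exp (p \<bullet> e) * ((v - (v \<bullet> e) *\<^sub>R e) \<bullet> u))) (at x0)"
      unfolding mult inv_ident inner_add_left inner_scaleR_left
      by (auto intro!: derivative_eq_intros)
  qed
  have 2: "frame v (frame w (\<lambda>p. p \<bullet> u)) 0 = (v \<bullet> e) * ((w - (w \<bullet> e) *\<^sub>R e) \<bullet> u)" for v w u
  proof (rule frame_eqI[OF frame_smooth[OF lin], where D = "\<lambda>v. (v \<bullet> e) * ((w - (w \<bullet> e) *\<^sub>R e) \<bullet> u)"])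
    show "((\<lambda>x. frame w (\<lambda>p. p \<bullet> u) (gmult ?K 0 (inv_into UNIV (\<lambda>x. x) x))) has_derivative
        (\<lambda>v. (v \<bullet> e) * ((w - (w \<bullet> e) *\<^sub>R e) \<bullet> u))) (at x0)"
      unfolding 1 mult inv_ident x0
      by (auto intro!: derivative_eq_intros simp: inner_add_left inner_diff_left e)
  qed
  have eq: "frame_bracket v w \<bullet> u = special_bracket e v w \<bullet> u" for v w u
  proof -
    have "frame_bracket v w \<bullet> u = frame (frame_bracket v w) (\<lambda>p. p \<bullet> u) 0"
      by (simp add: 1 inner_diff_left)
    also have "\<dots> = lie_bracket (frame v) (frame w) (\<lambda>p. p \<bullet> u) 0" by (simp add: bracket)
    also have "\<dots> = special_bracket e v w \<bullet> u"
      by (simp add: lie_bracket_def 2 special_bracket_def inner_diff_left inner_commute[of e] algebra_simps)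
    finally show ?thesis .
  qed
  have "frame_bracket = special_bracket e"
    by (rule ext, rule ext, rule euclidean_eqI, rule eq)
  moreover have "e \<noteq> 0" using assms by auto
  ultimately show ?thesis by (rule special_bracket_constant_sign)
qed

lemma constant_sign_frame:
  fixes G :: "('a::{t2_space,second_countable_topology}, 'e::euclidean_space) lie_data"
  assumes "lie_group G" "constant_sign_curvature G"
  obtains L c a where "left_invariant_frame G L c (special_bracket a)" "a \<noteq> 0"
proof -
  interpret lie_grp G by unfold_locales fact
  obtain L c br where f: "left_invariant_frame G L c br" using left_invariant_frame_exists by blast
  then interpret left_invariant_frame G L c br .
  show ?thesis using constant_sign_special_bracket[OF assms(2)] f that by blast
qed

theorem proposition4:
  fixes G :: "('a::{t2_space,second_countable_topology}, 'e::euclidean_space) lie_data"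
    and H :: "('b::{t2_space,second_countable_topology}, 'f::euclidean_space) lie_data"
  shows "(lie_group G \<and> constant_sign_curvature G \<longrightarrow>
            (DIM('e) \<noteq> 1 \<longrightarrow> \<not> (\<exists>\<eta>. left_invariant_contact G \<eta>)) \<and>
            (DIM('e) \<noteq> 2 \<longrightarrow> \<not> (\<exists>\<alpha>. left_invariant_exact_symplectic G \<alpha>)))
       \<and> (\<exists>K :: ('e, 'e) lie_data. lie_group K \<and> constant_sign_curvature K)
       \<and> (lie_group G \<and> constant_sign_curvature G \<and> lie_group H \<and> constant_sign_curvature H \<and>
            DIM('e) = DIM('f) \<longrightarrow> locally_isomorphic G H)"
proof (intro conjI impI)
  assume "lie_group G \<and> constant_sign_curvature G"
  then obtain L c a where f: "left_invariant_frame G L c (special_bracket a)"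
    using constant_sign_frame by blast
  show "\<not> (\<exists>\<eta>. left_invariant_contact G \<eta>)" if "DIM('e) \<noteq> 1"
    using left_invariant_frame.no_left_invariant_contact[OF f refl that] by blast
  show "\<not> (\<exists>\<alpha>. left_invariant_exact_symplectic G \<alpha>)" if "DIM('e) \<noteq> 2"
    using left_invariant_frame.no_left_invariant_exact_symplectic[OF f refl that] by blast
next
  obtain e :: 'e where "e \<in> Basis" using nonempty_Basis by blast
  then show "\<exists>K :: ('e, 'e) lie_data. lie_group K \<and> constant_sign_curvature K"
    using hyperbolic_group_lie_group hyperbolic_group_constant_sign norm_Basis by metis
next
  assume *: "lie_group G \<and> constant_sign_curvature G \<and> lie_group H \<and> constant_sign_curvature H \<and>
    DIM('e) = DIM('f)"
  obtain L c a where "left_invariant_frame G L c (special_bracket a)" "a \<noteq> 0"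
    using constant_sign_frame[of G] * by blast
  moreover obtain M d b where "left_invariant_frame H M d (special_bracket b)" "b \<noteq> 0"
    using constant_sign_frame[of H] * by blast
  ultimately show "locally_isomorphic G H"
    using special_brackets_locally_isomorphic * by blast
qed

end
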